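(* The following decision problem is NP-hard: given a bipartite graph $G=(A\cup B,E)$ in which every node has a strict preference order over its neighbours, decide whether $G$ admits a popular matching that is neither a stable matching nor a dominant matching.
   Context: A matching is a set of pairwise disjoint edges; $M(u)$ denotes the partner of $u$ in $M$. An unmatched node is considered to prefer any neighbour to being unmatched. A node $u$ prefers matching $M$ to matching $N$ if either $u$ is matched in $M$ and unmatched in $N$, or $u$ is matched in both and prefers $M(u)$ to $N(u)$. Let $\phi(M,N)$ be the number of nodes preferring $M$ to $N$ and $\Delta(M,N)=\phi(M,N)-\phi(N,M)$. A matching $M$ is popular if $\Delta(M,N)\ge 0$ for every matching $N$. A matching $M$ is stable if there is no edge $(u,v)\notin M$ such that both $u$ and $v$ prefer each other to their respective situations in $M$ (partner, or being unmatched). A popular matching $M$ is dominant if $\Delta(M,N)>0$ for every matching $N$ with $|N|>|M|$. *)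

theory Defs
  imports Main "HOL-Computational_Algebra.Polynomial"
begin

section \<open>Polynomial time and NP-hardness\<close>

text \<open>
  Deterministic multi-tape Turing machines with tapes that are infinite to the right. States and
  tape symbols are initial segments of the natural numbers; state 0 is the start state and
  state 1 the halting state. Symbol 0 is the blank, 1 the marker that is initially in cell 0 of
  each tape, and 2 and 3 stand for the two bits.
\<close>

datatype head_move = Go_Left | Stay | Go_Right

record turing_machine =
  num_tapes :: nat
  num_symbols :: nat
  num_states :: nat
  delta :: "nat \<Rightarrow> nat list \<Rightarrow> nat \<times> (nat \<times> head_move) list"

definition wf_tm :: "turing_machine \<Rightarrow> bool" where
  "wf_tm M \<longleftrightarrow>
     num_tapes M \<ge> 1 \<and> num_symbols M \<ge> 4 \<and> num_states M \<ge> 2 \<and>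
     (\<forall>q < num_states M. \<forall>ss. length ss = num_tapes M \<and> set ss \<subseteq> {..<num_symbols M} \<longrightarrow>
        fst (delta M q ss) < num_states M \<and>
        length (snd (delta M q ss)) = num_tapes M \<and>
        fst ` set (snd (delta M q ss)) \<subseteq> {..<num_symbols M})"

text \<open>A tape consists of its contents and the position of its head.\<close>

type_synonym tape = "(nat \<Rightarrow> nat) \<times> nat"
type_synonym config = "nat \<times> tape list"

text \<open>In cell 0, a move to the left leaves the head where it is.\<close>

fun move_head :: "head_move \<Rightarrow> nat \<Rightarrow> nat" where
  "move_head Go_Left h = h - 1"
| "move_head Stay h = h"
| "move_head Go_Right h = h + 1"

definition act :: "nat \<times> head_move \<Rightarrow> tape \<Rightarrow> tape" where
  "act a t = ((fst t)(snd t := fst a), move_head (snd a) (snd t))"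

definition tm_step :: "turing_machine \<Rightarrow> config \<Rightarrow> config" where
  "tm_step M c =
     (if fst c = 1 then c
      else let (q, as) = delta M (fst c) (map (\<lambda>(t, h). t h) (snd c))
           in (q, map2 act as (snd c)))"

fun bit_symbol :: "bool \<Rightarrow> nat" where
  "bit_symbol False = 2"
| "bit_symbol True = 3"

definition word_tape :: "bool list \<Rightarrow> nat \<Rightarrow> nat" where
  "word_tape x i =
     (if i = 0 then 1 else if i \<le> length x then bit_symbol (x ! (i - 1)) else 0)"

text \<open>The input is given on the first tape; all other tapes are empty.\<close>

definition tm_init :: "turing_machine \<Rightarrow> bool list \<Rightarrow> config" where
  "tm_init M x = (0, (word_tape x, 0) # replicate (num_tapes M - 1) (word_tape [], 0))"

text \<open>The output is the word to the right of cell 0 of the last tape, up to the first blank.\<close>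

definition has_output :: "config \<Rightarrow> bool list \<Rightarrow> bool" where
  "has_output c y \<longleftrightarrow>
     (\<forall>i < length y. fst (last (snd c)) (i + 1) = bit_symbol (y ! i)) \<and>
     fst (last (snd c)) (length y + 1) = 0"

definition computes_within :: "turing_machine \<Rightarrow> bool list \<Rightarrow> bool list \<Rightarrow> nat \<Rightarrow> bool" where
  "computes_within M x y T \<longleftrightarrow>
     (\<exists>t \<le> T. fst ((tm_step M ^^ t) (tm_init M x)) = 1 \<and>
              has_output ((tm_step M ^^ t) (tm_init M x)) y)"

definition polytime_computable :: "(bool list \<Rightarrow> bool list) \<Rightarrow> bool" where
  "polytime_computable f \<longleftrightarrow>
     (\<exists>M (p :: nat poly). wf_tm M \<and> (\<forall>x. computes_within M x (f x) (poly p (length x))))"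

text \<open>The first component has its bits doubled and is separated from the second one by 01.\<close>

definition pair_word :: "bool list \<Rightarrow> bool list \<Rightarrow> bool list" where
  "pair_word x u = concat (map (\<lambda>b. [b, b]) x) @ [False, True] @ u"

type_synonym language = "bool list set"

definition in_NP :: "language \<Rightarrow> bool" where
  "in_NP L \<longleftrightarrow>
     (\<exists>V (p :: nat poly). polytime_computable V \<and>
        (\<forall>x. x \<in> L \<longleftrightarrow> (\<exists>u. length u \<le> poly p (length x) \<and> V (pair_word x u) = [True])))"

definition polytime_reducible :: "language \<Rightarrow> language \<Rightarrow> bool" where
  "polytime_reducible L L' \<longleftrightarrow>
     (\<exists>f. polytime_computable f \<and> (\<forall>x. x \<in> L \<longleftrightarrow> f x \<in> L'))"

definition NP_hard :: "language \<Rightarrow> bool" where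
  "NP_hard L \<longleftrightarrow> (\<forall>L'. in_NP L' \<longrightarrow> polytime_reducible L' L)"


section \<open>Matchings under preferences\<close>

text \<open>The pair \<open>(v, w)\<close> belongs to \<open>pref G u\<close> if \<open>u\<close> prefers \<open>v\<close> to \<open>w\<close>.\<close>

record 'v pref_graph =
  side_A :: "'v set"
  side_B :: "'v set"
  edges :: "'v set set"
  pref :: "'v \<Rightarrow> ('v \<times> 'v) set"

definition nodes :: "'v pref_graph \<Rightarrow> 'v set" where
  "nodes G = side_A G \<union> side_B G"

definition neighbours :: "'v pref_graph \<Rightarrow> 'v \<Rightarrow> 'v set" where
  "neighbours G u = {v. {u, v} \<in> edges G}"

definition bipartite_with_strict_prefs :: "'v pref_graph \<Rightarrow> bool" where
  "bipartite_with_strict_prefs G \<longleftrightarrow>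
     finite (nodes G) \<and> side_A G \<inter> side_B G = {} \<and>
     (\<forall>e \<in> edges G. \<exists>a \<in> side_A G. \<exists>b \<in> side_B G. e = {a, b}) \<and>
     (\<forall>u \<in> nodes G. pref G u \<subseteq> neighbours G u \<times> neighbours G u \<and>
                     strict_linear_order_on (neighbours G u) (pref G u))"

definition matching :: "'v pref_graph \<Rightarrow> 'v set set \<Rightarrow> bool" where
  "matching G M \<longleftrightarrow> M \<subseteq> edges G \<and> pairwise disjnt M"

definition matched :: "'v set set \<Rightarrow> 'v \<Rightarrow> bool" where
  "matched M u \<longleftrightarrow> u \<in> \<Union>M"

definition partner :: "'v set set \<Rightarrow> 'v \<Rightarrow> 'v" where
  "partner M u = (THE v. {u, v} \<in> M)"

definition prefers_matching ::
    "'v pref_graph \<Rightarrow> 'v \<Rightarrow> 'v set set \<Rightarrow> 'v set set \<Rightarrow> bool" where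
  "prefers_matching G u M N \<longleftrightarrow>
     matched M u \<and> \<not> matched N u \<or>
     matched M u \<and> matched N u \<and> (partner M u, partner N u) \<in> pref G u"

definition phi :: "'v pref_graph \<Rightarrow> 'v set set \<Rightarrow> 'v set set \<Rightarrow> nat" where
  "phi G M N = card {u \<in> nodes G. prefers_matching G u M N}"

definition Delta :: "'v pref_graph \<Rightarrow> 'v set set \<Rightarrow> 'v set set \<Rightarrow> int" where
  "Delta G M N = int (phi G M N) - int (phi G N M)"

definition popular :: "'v pref_graph \<Rightarrow> 'v set set \<Rightarrow> bool" where
  "popular G M \<longleftrightarrow> matching G M \<and> (\<forall>N. matching G N \<longrightarrow> Delta G M N \<ge> 0)"

definition prefers_to_situation :: "'v pref_graph \<Rightarrow> 'v set set \<Rightarrow> 'v \<Rightarrow> 'v \<Rightarrow> bool" where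
  "prefers_to_situation G M u v \<longleftrightarrow> \<not> matched M u \<or> (v, partner M u) \<in> pref G u"

definition stable :: "'v pref_graph \<Rightarrow> 'v set set \<Rightarrow> bool" where
  "stable G M \<longleftrightarrow> matching G M \<and>
     \<not> (\<exists>u v. {u, v} \<in> edges G \<and> {u, v} \<notin> M \<and>
             prefers_to_situation G M u v \<and> prefers_to_situation G M v u)"

definition dominant :: "'v pref_graph \<Rightarrow> 'v set set \<Rightarrow> bool" where
  "dominant G M \<longleftrightarrow> popular G M \<and>
     (\<forall>N. matching G N \<and> card N > card M \<longrightarrow> Delta G M N > 0)"


section \<open>The decision problem\<close>

text \<open>
  An instance \<open>(m, ps)\<close> has the nodes \<open>0, \<dots>, length ps - 1\<close>, of which the first \<open>m\<close> form the
  side \<open>A\<close>; \<open>ps ! u\<close> lists the neighbours of \<open>u\<close> in decreasing order of preference.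
\<close>

type_synonym pref_lists = "nat \<times> nat list list"

fun valid_pref_lists :: "pref_lists \<Rightarrow> bool" where
  "valid_pref_lists (m, ps) \<longleftrightarrow>
     m \<le> length ps \<and>
     (\<forall>u < length ps. distinct (ps ! u) \<and>
        (\<forall>v \<in> set (ps ! u). v < length ps \<and> u \<in> set (ps ! v) \<and> (u < m \<longleftrightarrow> \<not> v < m)))"

fun graph_of :: "pref_lists \<Rightarrow> nat pref_graph" where
  "graph_of (m, ps) =
     \<lparr> side_A = {..<m},
       side_B = {m..<length ps},
       edges = {{u, v} | u v. u < length ps \<and> v \<in> set (ps ! u)},
       pref = (\<lambda>u. if u < length ps
                   then {(ps ! u ! i, ps ! u ! j) | i j. i < j \<and> j < length (ps ! u)}
                   else {}) \<rparr>"

lemma bipartite_with_strict_prefs_graph_of: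
  assumes "valid_pref_lists I"
  shows "bipartite_with_strict_prefs (graph_of I)"
proof -
  obtain m ps where I: "I = (m, ps)" by (cases I)
  have m: "m \<le> length ps" using assms by (simp add: I)
  have dist: "distinct (ps ! u)" if "u < length ps" for u
    using assms that by (simp add: I)
  have sym: "w < length ps \<and> u \<in> set (ps ! w) \<and> (u < m \<longleftrightarrow> \<not> w < m)"
    if "u < length ps" "w \<in> set (ps ! u)" for u w
    using assms that unfolding I valid_pref_lists.simps by blast
  have nb: "neighbours (graph_of I) u = set (ps ! u)" if "u < length ps" for u
    using that by (auto simp: I neighbours_def doubleton_eq_iff dest: sym)
  have "strict_linear_order_on (set (ps ! u)) (pref (graph_of I) u)
        \<and> pref (graph_of I) u \<subseteq> set (ps ! u) \<times> set (ps ! u)" if u: "u < length ps" for u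
  proof -
    note d = dist[OF u]
    have "trans (pref (graph_of I) u)"
    proof (rule transI)
      fix x y z
      assume "(x, y) \<in> pref (graph_of I) u" "(y, z) \<in> pref (graph_of I) u"
      then obtain i j k l where
        "x = ps!u!i" "y = ps!u!j" "i < j" "j < length (ps!u)"
        "y = ps!u!k" "z = ps!u!l" "k < l" "l < length (ps!u)"
        using u by (auto simp: I)
      moreover from this have "j = k"
        using d by (metis nth_eq_iff_index_eq order.strict_trans)
      ultimately have "x = ps!u!i \<and> z = ps!u!l \<and> i < l \<and> l < length (ps!u)"
        by simp
      then show "(x, z) \<in> pref (graph_of I) u"
        using u by (simp add: I) blast
    qed
    moreover have "irrefl (pref (graph_of I) u)"
      using u d by (auto simp: I irrefl_def nth_eq_iff_index_eq)
    moreover have "total_on (set (ps ! u)) (pref (graph_of I) u)"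
      unfolding total_on_def
    proof (intro ballI impI)
      fix x y assume "x \<in> set (ps!u)" "y \<in> set (ps!u)" "x \<noteq> y"
      then obtain i j where
        "x = ps!u!i" "i < length (ps!u)" "y = ps!u!j" "j < length (ps!u)" "i \<noteq> j"
        by (metis in_set_conv_nth)
      then show "(x, y) \<in> pref (graph_of I) u \<or> (y, x) \<in> pref (graph_of I) u"
        using u by (cases "i < j") (auto simp: I)
    qed
    ultimately show ?thesis
      using u by (auto simp: strict_linear_order_on_def I)
  qed
  moreover have sides: "\<exists>a \<in> {..<m}. \<exists>b \<in> {m..<length ps}. {u, w} = {a, b}"
    if "u < length ps" "w \<in> set (ps ! u)" for u w
  proof (cases "u < m")
    case True
    then have "u \<in> {..<m}" "w \<in> {m..<length ps}" using sym[OF that] by auto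
    then show ?thesis by blast
  next
    case False
    then have "w \<in> {..<m}" "u \<in> {m..<length ps}" using sym[OF that] that by auto
    then show ?thesis by blast
  qed
  moreover have "nodes (graph_of I) = {..<length ps}"
    using m by (auto simp: I nodes_def)
  moreover have "finite (nodes (graph_of I))" "side_A (graph_of I) \<inter> side_B (graph_of I) = {}"
    using m by (auto simp: I nodes_def)
  moreover have "\<exists>a \<in> side_A (graph_of I). \<exists>b \<in> side_B (graph_of I). e = {a, b}"
    if "e \<in> edges (graph_of I)" for e
  proof -
    from that obtain u w where "u < length ps" "w \<in> set (ps ! u)" "e = {u, w}"
      by (auto simp: I)
    then show ?thesis using sides[of u w] by (simp add: I)
  qed
  ultimately show ?thesis
    using nb by (simp add: bipartite_with_strict_prefs_def)
qed

text \<open>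
  Every node number in a valid instance is at most the number of nodes, so that unary
  notation of node numbers only costs a polynomial factor.
\<close>

definition enc_nat :: "nat \<Rightarrow> bool list" where
  "enc_nat n = replicate n True @ [False]"

definition enc_list :: "('a \<Rightarrow> bool list) \<Rightarrow> 'a list \<Rightarrow> bool list" where
  "enc_list enc xs = concat (map (\<lambda>x. True # enc x) xs) @ [False]"

fun enc_instance :: "pref_lists \<Rightarrow> bool list" where
  "enc_instance (m, ps) = enc_nat m @ enc_list (enc_list enc_nat) ps"

lemma enc_nat_append: "enc_nat m @ r = enc_nat n @ s \<Longrightarrow> m = n \<and> r = s"
proof (induction m arbitrary: n)
  case 0
  then show ?case by (cases n) (auto simp: enc_nat_def)
next
  case (Suc m)
  then show ?case by (cases n) (auto simp: enc_nat_def)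
qed

lemma enc_list_append:
  assumes "\<And>x y r s. enc x @ r = enc y @ s \<Longrightarrow> x = y \<and> r = s"
  shows "enc_list enc xs @ r = enc_list enc ys @ s \<Longrightarrow> xs = ys \<and> r = s"
proof (induction xs arbitrary: ys)
  case Nil
  then show ?case by (cases ys) (auto simp: enc_list_def)
next
  case (Cons x xs)
  then obtain y ys' where ys: "ys = y # ys'"
    by (cases ys) (auto simp: enc_list_def)
  with Cons.prems have "enc x @ (enc_list enc xs @ r) = enc y @ (enc_list enc ys' @ s)"
    by (simp add: enc_list_def)
  then show ?case using assms Cons.IH ys by blast
qed

lemma inj_enc_instance: "inj enc_instance"
proof (rule injI)
  fix I J assume eq: "enc_instance I = enc_instance J"
  obtain m ps n qs where IJ: "I = (m, ps)" "J = (n, qs)" by (metis surj_pair)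
  from eq have "m = n \<and> enc_list (enc_list enc_nat) ps = enc_list (enc_list enc_nat) qs"
    unfolding IJ enc_instance.simps by (rule enc_nat_append)
  moreover from this have
    "enc_list (enc_list enc_nat) ps @ [] = enc_list (enc_list enc_nat) qs @ []"
    by simp
  then have "ps = qs \<and> [] = ([] :: bool list)"
    by (rule enc_list_append[rotated]) (erule enc_list_append[rotated], erule enc_nat_append)
  ultimately show "I = J"
    by (simp add: IJ)
qed

definition popular_neither_stable_nor_dominant :: language where
  "popular_neither_stable_nor_dominant =
     {enc_instance I | I. valid_pref_lists I \<and>
        (\<exists>M. popular (graph_of I) M \<and> \<not> stable (graph_of I) M \<and> \<not> dominant (graph_of I) M)}"

end

theory Submission
  imports Defs
begin

text \<open>
  Acceptance by a verifier is turned into a binary constraint problem: choose for every time step an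
  item (state, symbols read, head positions, last visits of the scanned cells) such that all items
  are pairwise compatible. In the gadget graph the layers \<open>L < n\<close> and \<open>n \<le> L < 2 * n\<close> are two copies of
  the time steps, an item is a cycle of four nodes that can be matched in two ways, one of which is open,
  and two incompatible items of different copies are joined by an edge that blocks if both are open.

  A popular matching leaves only the nodes \<open>SA\<close> and \<open>TB\<close> unmatched unless it is perfect. It is not dominant iff
  an alternating path from \<open>SA\<close> to \<open>TB\<close> has edges of weight 0 only. Such a path has to cross every layer
  through an open item, since the edges between incompatible items only lead back to earlier layers.
  A separate component with two nodes on each side has a perfect popular matching with a blocking edge;
  it makes the whole matching unstable without any effect on dominance.

  The nodes of the instance are coded by vectors of numbers below a polynomial bound. A program with nested
  loops over unary registers writes the instance; the number of a node is written by counting the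
  lexicographically smaller vectors.
\<close>


section \<open>Turing machines for register programs\<close>


text \<open>There are too many configurations for them to serve as items. An item therefore records
  only what the heads see, and the claimed last visits tie a symbol that is read to the one that was
  written there. The length of an item depends on the verifier alone, so there are polynomially
  many, and every requirement concerns at most two times.

  An edge between two items needs an end on either side of the graph: the first copy supplies the
  ends in \<open>B\<close>, the second one those in \<open>A\<close>, and the open pairing of a
  cycle is the opposite one in the second copy. The copies agree because different items for the
  same time count as incompatible.

  Popularity as such does not exclude blocking edges. It excludes those at a node that an
  alternating walk from an unmatched node reaches, and an augmenting path of weight 0 makes the
  chosen items of the second copy reachable. For the same reason the edge that destroys stability
  lies in a component without unmatched nodes.

  A given popular matching may contain edges between incompatible items. When a choice is read off
  from it, openness is therefore expressed by the votes of nodes.\<close>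

text \<open>Register \<open>r\<close> is the word on tape \<open>r\<close>, whose head rests in cell 0 between two instructions; the last
  tape is the output. \<open>ITest r s c A l\<close> jumps to \<open>l\<close> if the set \<open>A\<close> contains the symbol of tape \<open>s\<close> in the first
  cell after the word of register \<open>r\<close>, or in the second one if \<open>c\<close>. In phase 3 all heads return to cell 0.\<close>

datatype instr =
    IApp nat bool
  | IClear nat
  | IEmit bool
  | IJmp nat
  | ITest nat nat bool "nat set" nat

text \<open>States 0 and 1 are reserved for starting and halting. Every program counter owns a block
  of four states, one for each phase.\<close>

definition st :: "nat \<Rightarrow> nat \<Rightarrow> nat" where
  "st pc ph = 2 + 4 * pc + ph"

text \<open>Next state, symbols written, head moves, and the bit that is emitted on the output tape,
  if any.\<close>

type_synonym action = "nat \<times> (nat \<Rightarrow> nat) \<times> (nat \<Rightarrow> head_move) \<times> bool option"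

definition stay :: "nat \<Rightarrow> head_move" where
  "stay = (\<lambda>_. Stay)"

text \<open>Jump targets are cut off at \<open>n\<close>, the exit of the program, so that the
  machine is well-formed for every instruction list. Instructions that leave heads away from cell 0
  continue in phase 3; \<open>IClear\<close> walks back while erasing and ends in phase 0.\<close>

fun instr_action :: "nat \<Rightarrow> nat \<Rightarrow> nat \<Rightarrow> (nat \<Rightarrow> nat) \<Rightarrow> instr \<Rightarrow> action" where
  "instr_action n pc ph y (IApp r b) =
     (if ph = 0 then (st pc 2, y, stay(r := Go_Right), None)
      else if y r = 0 then (st (pc + 1) 3, y(r := bit_symbol b), stay, None)
      else (st pc 2, y, stay(r := Go_Right), None))"
| "instr_action n pc ph y (IClear r) =
     (if ph = 0 then (st pc 1, y, stay(r := Go_Right), None)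
      else if ph = 1 then
        (if y r = 0 then (st pc 2, y, stay(r := Go_Left), None)
         else (st pc 1, y, stay(r := Go_Right), None))
      else if y r = 1 then (st (pc + 1) 0, y, stay, None)
      else (st pc 2, y(r := 0), stay(r := Go_Left), None))"
| "instr_action n pc ph y (IEmit b) = (st (pc + 1) 0, y, stay, Some b)"
| "instr_action n pc ph y (IJmp l) = (st (min l n) 0, y, stay, None)"
| "instr_action n pc ph y (ITest r s c A l) =
     (if ph = 0 then (st pc (if c then 1 else 2), y, stay(r := Go_Right, s := Go_Right), None)
      else if ph = 1 then (st pc 2, y, stay(s := Go_Right), None)
      else if y r = 0 then (st (if y s \<in> A then min l n else pc + 1) 3, y, stay, None)
      else (st pc 2, y, stay(r := Go_Right, s := Go_Right), None))"

text \<open>In phase 3 all heads can go left at once: a head in cell 0 stays there, and only cell 0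
  contains the marker 1, so the phase ends exactly when every head has arrived. A program counter
  behind the last instruction means halting.\<close>

definition action_of :: "instr list \<Rightarrow> nat \<Rightarrow> nat \<Rightarrow> nat \<Rightarrow> (nat \<Rightarrow> nat) \<Rightarrow> action" where
  "action_of P K pc ph y =
     (if ph = 3 then
        (if \<forall>r<K. y r = 1 then (st pc 0, y, stay, None) else (st pc 3, y, \<lambda>_. Go_Left, None))
      else if pc < length P then instr_action (length P) pc ph y (P ! pc)
      else (1, y, stay, None))"

text \<open>The step out of state 0 only moves the output head off the marker. From then on this
  head stands on the first blank after the output.\<close>

definition tm_delta :: "instr list \<Rightarrow> nat \<Rightarrow> nat \<Rightarrow> nat list \<Rightarrow> nat \<times> (nat \<times> head_move) list" where
  "tm_delta P K q ss =
     (let y = (\<lambda>r. if r < K then ss ! r else 0);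
          (q', w, m, e) = (if q = 0 then (st 0 0, y, stay, None)
                           else action_of P K ((q - 2) div 4) ((q - 2) mod 4) y)
      in (q', map (\<lambda>r. (w r, m r)) [0..<K] @
              [if q = 0 then (ss ! K, Go_Right)
               else case e of None \<Rightarrow> (ss ! K, Stay) | Some b \<Rightarrow> (bit_symbol b, Go_Right)]))"

definition tm_of :: "instr list \<Rightarrow> nat \<Rightarrow> turing_machine" where
  "tm_of P K = \<lparr> num_tapes = K + 1, num_symbols = 4, num_states = 2 + 4 * (length P + 1),
     delta = tm_delta P K \<rparr>"

lemma bit_symbol_bounds: "1 < bit_symbol b" "bit_symbol b < 4"
  by (cases b; simp)+

lemma bit_symbol_range: "bit_symbol b = 2 \<or> bit_symbol b = 3"
  by (cases b) auto

lemma instr_action_bounds: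
  assumes "instr_action n pc ph y i = (q, w, m, e)" "pc < n" "\<And>r. y r < 4"
  shows "q < 2 + 4 * (n + 1) \<and> (\<forall>r. w r < 4)"
proof -
  have *: "st p 0 < 2 + 4 * (n + 1)" "st p 1 < 2 + 4 * (n + 1)" "st p 2 < 2 + 4 * (n + 1)"
    "st p 3 < 2 + 4 * (n + 1)" if "p \<le> n" for p using that by (auto simp: st_def)
  have **: "(y(r := bit_symbol b)) r' < 4" "(y(r := 0)) r' < 4" for r r' b
    using assms(3) bit_symbol_bounds by auto
  show ?thesis
    using assms * ** by (cases i) (auto split: if_splits simp del: fun_upd_apply)
qed

lemma wf_tm_of: "wf_tm (tm_of P K)"
  unfolding wf_tm_def
proof (intro conjI allI impI)
  fix q ss
  assume q: "q < num_states (tm_of P K)"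
    and ss: "length ss = num_tapes (tm_of P K) \<and> set ss \<subseteq> {..<num_symbols (tm_of P K)}"
  define y where "y = (\<lambda>r. if r < K then ss ! r else 0)"
  have y: "y r < 4" for r
    using ss by (auto simp: y_def tm_of_def subset_iff)
  have K: "ss ! K < 4" using ss by (auto simp: tm_of_def subset_iff)
  obtain q' w m e where
    a: "(if q = 0 then (st 0 0, y, stay, None)
         else action_of P K ((q - 2) div 4) ((q - 2) mod 4) y) = (q', w, m, e)"
    by (metis prod_cases4)
  have "q' < 2 + 4 * (length P + 1) \<and> (\<forall>r. w r < 4)"
  proof (cases "q = 0")
    case True
    then show ?thesis using a y by (auto simp: st_def)
  next
    case False
    have "(q - 2) div 4 \<le> length P" using q by (auto simp: tm_of_def)
    then show ?thesis
      using a False y instr_action_bounds[of "length P" "(q - 2) div 4" "(q - 2) mod 4" y _ q' w m e]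
      by (auto simp: action_of_def st_def split: if_splits)
  qed
  moreover have "delta (tm_of P K) q ss =
     (q', map (\<lambda>r. (w r, m r)) [0..<K] @
              [if q = 0 then (ss ! K, Go_Right)
               else case e of None \<Rightarrow> (ss ! K, Stay) | Some b \<Rightarrow> (bit_symbol b, Go_Right)])"
    using a by (simp add: tm_of_def tm_delta_def flip: y_def)
  ultimately show "fst (delta (tm_of P K) q ss) < num_states (tm_of P K)"
    "length (snd (delta (tm_of P K) q ss)) = num_tapes (tm_of P K)"
    "fst ` set (snd (delta (tm_of P K) q ss)) \<subseteq> {..<num_symbols (tm_of P K)}"
    using K bit_symbol_bounds by (auto simp: tm_of_def split: option.splits)
qed (simp_all add: tm_of_def)

definition cfg :: "nat \<Rightarrow> nat \<Rightarrow> (nat \<Rightarrow> nat \<Rightarrow> nat) \<Rightarrow> (nat \<Rightarrow> nat) \<Rightarrow> bool list \<Rightarrow> config" where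
  "cfg K q c h out =
     (q, map (\<lambda>r. (c r, h r)) [0..<K] @ [(word_tape out, Suc (length out))])"

lemma cfg_cong:
  assumes "\<And>r. r < K \<Longrightarrow> c r = c' r" "\<And>r. r < K \<Longrightarrow> h r = h' r"
  shows "cfg K q c h out = cfg K q c' h' out"
  using assms by (simp add: cfg_def)

lemma word_tape_append:
  "(word_tape w)(Suc (length w) := bit_symbol b) = word_tape (w @ [b])"
  by (auto simp: word_tape_def fun_eq_iff nth_append)

lemma word_tape_end: "word_tape w (Suc (length w)) = 0"
  by (simp add: word_tape_def)

lemma map2_act: "map2 act (map f xs) (map g xs) = map (\<lambda>x. act (f x) (g x)) xs"
  by (induction xs) auto

lemma map2_act_snoc:
  "map2 act (map f xs @ [a]) (map g xs @ [b]) = map (\<lambda>x. act (f x) (g x)) xs @ [act a b]"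
  by (induction xs) auto

lemma tm_step_cfg:
  assumes a: "action_of P K pc ph (\<lambda>r. if r < K then c r (h r) else 0) = (q', w, m, e)"
    and ph: "ph < 4"
  shows "tm_step (tm_of P K) (cfg K (st pc ph) c h out) =
         cfg K q' (\<lambda>r. (c r)(h r := w r)) (\<lambda>r. move_head (m r) (h r))
           (case e of None \<Rightarrow> out | Some b \<Rightarrow> out @ [b])"
proof -
  let ?ss = "map (\<lambda>(t, h). t h) (snd (cfg K (st pc ph) c h out))"
  have ss: "(\<lambda>r. if r < K then ?ss ! r else 0) = (\<lambda>r. if r < K then c r (h r) else 0)"
    by (auto simp: cfg_def nth_append fun_eq_iff)
  have K: "?ss ! K = 0" by (simp add: cfg_def nth_append word_tape_end)
  have q: "st pc ph \<noteq> 0" "st pc ph \<noteq> 1" "(st pc ph - 2) div 4 = pc" "(st pc ph - 2) mod 4 = ph"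
    using ph by (auto simp: st_def)
  have d: "delta (tm_of P K) (st pc ph) ?ss =
     (q', map (\<lambda>r. (w r, m r)) [0..<K] @
          [case e of None \<Rightarrow> (0, Stay) | Some b \<Rightarrow> (bit_symbol b, Go_Right)])"
    using a q by (simp add: tm_of_def tm_delta_def ss K split: option.split)
  \<comment> \<open>The output head reads a blank; if nothing is emitted, it writes this blank
    back.\<close>
  have z: "(word_tape out)(Suc (length out) := 0) = word_tape out"
    using word_tape_end by (metis fun_upd_triv)
  have s: "fst (cfg K (st pc ph) c h out) = st pc ph"
      "snd (cfg K (st pc ph) c h out) = map (\<lambda>r. (c r, h r)) [0..<K] @ [(word_tape out, Suc (length out))]"
    by (simp_all add: cfg_def)
  show ?thesis
    unfolding tm_step_def s(1) using d q(2) 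
    by (simp add: map2_act map2_act_snoc s(2)) (auto simp: cfg_def act_def z word_tape_append split: option.splits)
qed

section \<open>Reachable configurations and the cost of single instructions\<close>

definition reach :: "turing_machine \<Rightarrow> nat \<Rightarrow> config \<Rightarrow> config \<Rightarrow> bool" where
  "reach M t c c' \<longleftrightarrow> (\<exists>t' \<le> t. (tm_step M ^^ t') c = c')"

lemma reach_refl: "reach M t c c"
  unfolding reach_def by (rule exI[of _ 0]) simp

lemma reach_trans: "reach M t c c' \<Longrightarrow> reach M t' c' c'' \<Longrightarrow> reach M (t + t') c c''"
  unfolding reach_def
proof clarify
  fix s s' assume "s \<le> t" "s' \<le> t'"
  then show "\<exists>t''\<le>t + t'. (tm_step M ^^ t'') c = (tm_step M ^^ s') ((tm_step M ^^ s) c)"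
    by (intro exI[of _ "s' + s"]) (simp add: funpow_add)
qed

lemma reach_mono: "reach M t c c' \<Longrightarrow> t \<le> t' \<Longrightarrow> reach M t' c c'"
  unfolding reach_def using order_trans by blast

lemma reach_step: "tm_step M c = c' \<Longrightarrow> reach M 1 c c'"
  unfolding reach_def by (intro exI[of _ 1]) simp

lemma reach_step': "tm_step M c = c' \<Longrightarrow> reach M t c' c'' \<Longrightarrow> reach M (Suc t) c c''"
  using reach_trans[OF reach_step] by fastforce

lemma reach_iterate:
  assumes "\<And>i. i < n \<Longrightarrow> tm_step M (f i) = f (Suc i)"
  shows "reach M n (f 0) (f n)"
  using assms
proof (induction n)
  case 0
  show ?case by (simp add: reach_refl)
next
  case (Suc n)
  then show ?case using reach_trans[of M n "f 0" "f n" 1 "f (Suc n)"] reach_step[of M "f n"] by simp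
qed

type_synonym store = "nat \<Rightarrow> bool list"

abbreviation rcfg :: "nat \<Rightarrow> nat \<Rightarrow> nat \<Rightarrow> store \<Rightarrow> (nat \<Rightarrow> nat) \<Rightarrow> bool list \<Rightarrow> config" where
  "rcfg K pc ph \<sigma> h out \<equiv> cfg K (st pc ph) (\<lambda>r. word_tape (\<sigma> r)) h out"

lemma word_tape_eq_1: "word_tape w i = 1 \<longleftrightarrow> i = 0"
  using bit_symbol_bounds[of "w ! (i - 1)"] by (auto simp: word_tape_def)

lemma word_tape_eq_0: "word_tape w i = 0 \<longleftrightarrow> i > length w"
  using bit_symbol_bounds[of "w ! (i - 1)"] by (auto simp: word_tape_def)

text \<open>Every step lowers all positions by one, truncated at 0. The additional step is the one
  that sees nothing but markers and enters phase 0.\<close>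

lemma reach_rewind:
  assumes "\<And>r. r < K \<Longrightarrow> h r \<le> m"
  shows "reach (tm_of P K) (Suc m) (rcfg K pc 3 \<sigma> h out) (rcfg K pc 0 \<sigma> (\<lambda>_. 0) out)"
  using assms
proof (induction m arbitrary: h)
  case 0
  have "tm_step (tm_of P K) (rcfg K pc 3 \<sigma> h out) = rcfg K pc 0 \<sigma> (\<lambda>_. 0) out"
    by (subst tm_step_cfg[where pc = pc and ph = 3])
      (use 0 in \<open>auto simp: action_of_def word_tape_eq_1[unfolded One_nat_def] stay_def intro!: cfg_cong\<close>)
  then show ?case using reach_step by fastforce
next
  case (Suc m)
  show ?case
  proof (cases "\<forall>r<K. h r = 0")
    case True
    have "tm_step (tm_of P K) (rcfg K pc 3 \<sigma> h out) = rcfg K pc 0 \<sigma> (\<lambda>_. 0) out"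
      by (subst tm_step_cfg[where pc = pc and ph = 3])
        (use True in \<open>auto simp: action_of_def word_tape_eq_1[unfolded One_nat_def] stay_def intro!: cfg_cong\<close>)
    then show ?thesis using reach_step reach_mono by (metis One_nat_def Suc_le_mono le0)
  next
    case False
    then have "\<not> (\<forall>r<K. (if r < K then word_tape (\<sigma> r) (h r) else 0) = 1)"
      using word_tape_eq_1 by auto
    then have "action_of P K pc 3 (\<lambda>r. if r < K then word_tape (\<sigma> r) (h r) else 0) =
        (st pc 3, \<lambda>r. if r < K then word_tape (\<sigma> r) (h r) else 0, \<lambda>_. Go_Left, None)"
      unfolding action_of_def by (simp only: if_False if_True simp_thms)
    note step = tm_step_cfg[where c = "\<lambda>r. word_tape (\<sigma> r)" and h = h, OF this]
    have *: "tm_step (tm_of P K) (rcfg K pc 3 \<sigma> h out) = rcfg K pc 3 \<sigma> (\<lambda>r. h r - 1) out"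
      by (subst step) (auto intro!: cfg_cong)
    show ?thesis
      by (rule reach_step'[OF * Suc.IH]) (use Suc.prems in force)
  qed
qed

context
  fixes P :: "instr list" and K :: nat
begin

lemma exec_IEmit:
  assumes "pc < length P" "P ! pc = IEmit b"
  shows "reach (tm_of P K) 1 (rcfg K pc 0 \<sigma> (\<lambda>_. 0) out) (rcfg K (pc + 1) 0 \<sigma> (\<lambda>_. 0) (out @ [b]))"
  by (rule reach_step, subst tm_step_cfg[where pc = pc and ph = 0])
    (use assms in \<open>auto simp: action_of_def stay_def intro!: cfg_cong\<close>)

lemma exec_IJmp:
  assumes "pc < length P" "P ! pc = IJmp l" "l \<le> length P"
  shows "reach (tm_of P K) 1 (rcfg K pc 0 \<sigma> (\<lambda>_. 0) out) (rcfg K l 0 \<sigma> (\<lambda>_. 0) out)"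
  by (rule reach_step, subst tm_step_cfg[where pc = pc and ph = 0])
    (use assms in \<open>auto simp: action_of_def stay_def min_def intro!: cfg_cong\<close>)

text \<open>The head passes over the word once in each direction. The bound
  \<open>3 * length (\<sigma> r) + 10\<close> is a rough one that also covers \<open>IClear\<close>
  and \<open>ITest\<close>.\<close>

lemma exec_IApp:
  assumes "pc < length P" "P ! pc = IApp r b" "r < K"
  shows "reach (tm_of P K) (3 * length (\<sigma> r) + 10) (rcfg K pc 0 \<sigma> (\<lambda>_. 0) out)
           (rcfg K (pc + 1) 0 (\<sigma>(r := \<sigma> r @ [b])) (\<lambda>_. 0) out)"
proof -
  define f where "f i = rcfg K pc 2 \<sigma> ((\<lambda>_. 0)(r := Suc i)) out" for i
  let ?n = "length (\<sigma> r)"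
  have 1: "tm_step (tm_of P K) (rcfg K pc 0 \<sigma> (\<lambda>_. 0) out) = f 0"
    unfolding f_def by (subst tm_step_cfg[where pc = pc and ph = 0])
      (use assms in \<open>auto simp: action_of_def stay_def intro!: cfg_cong\<close>)
  have 2: "reach (tm_of P K) ?n (f 0) (f ?n)"
  proof (rule reach_iterate)
    fix i assume "i < ?n"
    then show "tm_step (tm_of P K) (f i) = f (Suc i)"
      unfolding f_def by (subst tm_step_cfg[where pc = pc and ph = 2])
        (use assms in \<open>auto simp: action_of_def stay_def word_tape_eq_0 intro!: cfg_cong\<close>)
  qed
  have 3: "tm_step (tm_of P K) (f ?n) =
           rcfg K (pc + 1) 3 (\<sigma>(r := \<sigma> r @ [b])) ((\<lambda>_. 0)(r := Suc ?n)) out"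
    unfolding f_def by (subst tm_step_cfg[where pc = pc and ph = 2])
      (use assms in \<open>auto simp: action_of_def stay_def word_tape_eq_0 word_tape_append intro!: cfg_cong\<close>)
  have 4: "reach (tm_of P K) (Suc (Suc ?n))
      (rcfg K (pc + 1) 3 (\<sigma>(r := \<sigma> r @ [b])) ((\<lambda>_. 0)(r := Suc ?n)) out)
      (rcfg K (pc + 1) 0 (\<sigma>(r := \<sigma> r @ [b])) (\<lambda>_. 0) out)"
    by (rule reach_rewind) auto
  show ?thesis
    using reach_mono[OF reach_step'[OF 1 reach_trans[OF 2 reach_step'[OF 3 4]]]] by simp
qed

lemma exec_IClear:
  assumes "pc < length P" "P ! pc = IClear r" "r < K"
  shows "reach (tm_of P K) (3 * length (\<sigma> r) + 10) (rcfg K pc 0 \<sigma> (\<lambda>_. 0) out)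
           (rcfg K (pc + 1) 0 (\<sigma>(r := [])) (\<lambda>_. 0) out)"
proof -
  define f where "f i = rcfg K pc 1 \<sigma> ((\<lambda>_. 0)(r := Suc i)) out" for i
  let ?n = "length (\<sigma> r)"
  \<comment> \<open>In \<open>g i\<close> the last \<open>i\<close> symbols have been erased, and
    the head stands on the end of what remains.\<close>
  define g where "g i = rcfg K pc 2 (\<sigma>(r := take (?n - i) (\<sigma> r))) ((\<lambda>_. 0)(r := ?n - i)) out" for i
  have 1: "tm_step (tm_of P K) (rcfg K pc 0 \<sigma> (\<lambda>_. 0) out) = f 0"
    unfolding f_def by (subst tm_step_cfg[where pc = pc and ph = 0])
      (use assms in \<open>auto simp: action_of_def stay_def intro!: cfg_cong\<close>)
  have 2: "reach (tm_of P K) ?n (f 0) (f ?n)"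
  proof (rule reach_iterate)
    fix i assume "i < ?n"
    then show "tm_step (tm_of P K) (f i) = f (Suc i)"
      unfolding f_def by (subst tm_step_cfg[where pc = pc and ph = 1])
        (use assms in \<open>auto simp: action_of_def stay_def word_tape_eq_0 intro!: cfg_cong\<close>)
  qed
  have 3: "tm_step (tm_of P K) (f ?n) = g 0"
    unfolding f_def g_def by (subst tm_step_cfg[where pc = pc and ph = 1])
      (use assms in \<open>auto simp: action_of_def stay_def word_tape_eq_0 intro!: cfg_cong\<close>)
  have 4: "reach (tm_of P K) ?n (g 0) (g ?n)"
  proof (rule reach_iterate)
    fix i assume i: "i < ?n"
    have "(word_tape (take (?n - i) (\<sigma> r)))(?n - i := 0) = word_tape (take (?n - Suc i) (\<sigma> r))"
      using i by (auto simp: word_tape_def fun_eq_iff)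
    then show "tm_step (tm_of P K) (g i) = g (Suc i)"
      unfolding g_def by (subst tm_step_cfg[where pc = pc and ph = 2])
        (use assms i in \<open>auto simp: action_of_def stay_def word_tape_eq_1[unfolded One_nat_def]
            word_tape_eq_0 intro!: cfg_cong\<close>)
  qed
  have 5: "tm_step (tm_of P K) (g ?n) = rcfg K (pc + 1) 0 (\<sigma>(r := [])) (\<lambda>_. 0) out"
    unfolding g_def by (subst tm_step_cfg[where pc = pc and ph = 2])
      (use assms in \<open>auto simp: action_of_def stay_def word_tape_eq_1[unfolded One_nat_def] intro!: cfg_cong\<close>)
  show ?thesis
    using reach_mono[OF reach_step'[OF 1 reach_trans[OF 2 reach_step'[OF 3 reach_trans[OF 4 reach_step[OF 5]]]]]]
    by simp
qed

text \<open>The heads of \<open>r\<close> and \<open>s\<close> advance together, so one primitive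
  serves two purposes: with the set of bit symbols it compares the lengths of two words, and with a
  singleton it reads the bit of \<open>s\<close> whose index is the length of
  \<open>r\<close>.\<close>

definition test :: "nat \<Rightarrow> nat \<Rightarrow> bool \<Rightarrow> nat set \<Rightarrow> store \<Rightarrow> bool" where
  "test r s c A \<sigma> \<longleftrightarrow> word_tape (\<sigma> s) (Suc (length (\<sigma> r) + of_bool c)) \<in> A"

lemma exec_ITest:
  assumes "pc < length P" "P ! pc = ITest r s c A l" "r < K" "s < K" "r \<noteq> s" "l \<le> length P"
  shows "reach (tm_of P K) (3 * length (\<sigma> r) + 10) (rcfg K pc 0 \<sigma> (\<lambda>_. 0) out)
           (rcfg K (if test r s c A \<sigma> then l else pc + 1) 0 \<sigma> (\<lambda>_. 0) out)"
proof -
  define f where "f i = rcfg K pc 2 \<sigma> ((\<lambda>_. 0)(r := Suc i, s := Suc (i + of_bool c))) out" for i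
  let ?n = "length (\<sigma> r)"
  have 1: "reach (tm_of P K) 2 (rcfg K pc 0 \<sigma> (\<lambda>_. 0) out) (f 0)"
  \<comment> \<open>If \<open>c\<close> holds, phase 1 gives the head of \<open>s\<close> a lead of
    one cell. Either way scanning starts after at most two steps.\<close>
  proof (cases c)
    case False
    have "tm_step (tm_of P K) (rcfg K pc 0 \<sigma> (\<lambda>_. 0) out) = f 0"
      unfolding f_def by (subst tm_step_cfg[where pc = pc and ph = 0])
        (use assms False in \<open>auto simp: action_of_def stay_def intro!: cfg_cong\<close>)
    then show ?thesis using reach_mono[OF reach_step] by simp
  next
    case True
    have "tm_step (tm_of P K) (rcfg K pc 0 \<sigma> (\<lambda>_. 0) out) =
          rcfg K pc 1 \<sigma> ((\<lambda>_. 0)(r := 1, s := 1)) out"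
      by (subst tm_step_cfg[where pc = pc and ph = 0])
        (use assms True in \<open>auto simp: action_of_def stay_def intro!: cfg_cong\<close>)
    moreover have "tm_step (tm_of P K) (rcfg K pc 1 \<sigma> ((\<lambda>_. 0)(r := 1, s := 1)) out) = f 0"
      unfolding f_def by (subst tm_step_cfg[where pc = pc and ph = 1])
        (use assms True in \<open>auto simp: action_of_def stay_def intro!: cfg_cong\<close>)
    ultimately show ?thesis using reach_mono[OF reach_step'[OF _ reach_step]] by simp
  qed
  have 2: "reach (tm_of P K) ?n (f 0) (f ?n)"
  proof (rule reach_iterate)
    fix i assume "i < ?n"
    then show "tm_step (tm_of P K) (f i) = f (Suc i)"
      unfolding f_def by (subst tm_step_cfg[where pc = pc and ph = 2])
        (use assms in \<open>auto simp: action_of_def stay_def word_tape_eq_0 intro!: cfg_cong\<close>)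
  qed
  let ?h = "(\<lambda>_. 0)(r := Suc ?n, s := Suc (?n + of_bool c))"
  have 3: "tm_step (tm_of P K) (f ?n) = rcfg K (if test r s c A \<sigma> then l else pc + 1) 3 \<sigma> ?h out"
    unfolding f_def by (subst tm_step_cfg[where pc = pc and ph = 2])
      (use assms in \<open>auto simp: action_of_def stay_def word_tape_eq_0 test_def min_def
         intro!: cfg_cong\<close>)
  have 4: "reach (tm_of P K) (Suc (Suc (Suc ?n)))
      (rcfg K (if test r s c A \<sigma> then l else pc + 1) 3 \<sigma> ?h out)
      (rcfg K (if test r s c A \<sigma> then l else pc + 1) 0 \<sigma> (\<lambda>_. 0) out)"
    by (rule reach_rewind) auto
  show ?thesis
    using reach_mono[OF reach_trans[OF 1 reach_trans[OF 2 reach_step'[OF 3 4]]]] by simp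
qed

end


section \<open>Accepting computations as choices of pairwise compatible items\<close>


text \<open>A halted machine is regarded as continuing without changing anything.\<close>

definition row_delta :: "turing_machine \<Rightarrow> nat \<times> nat list \<Rightarrow> nat \<times> (nat \<times> head_move) list" where
  "row_delta M r = (if fst r = 1 then (1, map (\<lambda>s. (s, Stay)) (snd r)) else delta M (fst r) (snd r))"

definition reads :: "config \<Rightarrow> nat \<times> nat list" where
  "reads c = (fst c, map (\<lambda>(t, h). t h) (snd c))"

text \<open>Finitely many, and independent of the input, so that an item can name its row of the
  transition table by an index below a constant.\<close>

definition valid_rows :: "turing_machine \<Rightarrow> (nat \<times> nat list) set" where
  "valid_rows M = {..<num_states M} \<times> {ss. length ss = num_tapes M \<and> set ss \<subseteq> {..<num_symbols M}}"

lemma finite_valid_rows: "finite (valid_rows M)"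
proof -
  have "finite {ss. set ss \<subseteq> {..<num_symbols M} \<and> length ss = num_tapes M}"
    by (rule finite_lists_length_eq) simp
  then show ?thesis by (simp add: valid_rows_def conj_commute)
qed

definition valid_cfg :: "turing_machine \<Rightarrow> config \<Rightarrow> bool" where
  "valid_cfg M c \<longleftrightarrow> fst c < num_states M \<and> length (snd c) = num_tapes M \<and>
     (\<forall>j<num_tapes M. \<forall>i. fst (snd c ! j) i < num_symbols M)"

lemma row_delta_bounds:
  assumes "wf_tm M" "r \<in> valid_rows M"
  shows "fst (row_delta M r) < num_states M" "length (snd (row_delta M r)) = num_tapes M"
    "j < num_tapes M \<Longrightarrow> fst (snd (row_delta M r) ! j) < num_symbols M"
proof -
  obtain q ss where r: "r = (q, ss)" by fastforce
  have *: "q < num_states M" "length ss = num_tapes M" "set ss \<subseteq> {..<num_symbols M}" "2 \<le> num_states M"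
    using assms by (auto simp: r valid_rows_def wf_tm_def)
  then have d: "fst (delta M q ss) < num_states M" "length (snd (delta M q ss)) = num_tapes M"
    "fst ` set (snd (delta M q ss)) \<subseteq> {..<num_symbols M}"
    using assms(1) unfolding wf_tm_def by blast+
  show "fst (row_delta M r) < num_states M" "length (snd (row_delta M r)) = num_tapes M"
    using * d by (auto simp: row_delta_def r)
  assume j: "j < num_tapes M"
  have "snd (delta M q ss) ! j \<in> set (snd (delta M q ss))" using j d by simp
  moreover have "ss ! j < num_symbols M" using j * by (metis lessThan_iff nth_mem subsetD)
  ultimately show "fst (snd (row_delta M r) ! j) < num_symbols M"
    using j d(3) * by (auto simp: row_delta_def r)
qed

lemma reads_valid: "valid_cfg M c \<Longrightarrow> reads c \<in> valid_rows M"
  unfolding valid_cfg_def reads_def valid_rows_def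
  by (auto simp: set_conv_nth case_prod_unfold)

lemma tm_step_row:
  assumes "wf_tm M" "valid_cfg M c"
  shows "tm_step M c = (fst (row_delta M (reads c)),
    map (\<lambda>j. act (snd (row_delta M (reads c)) ! j) (snd c ! j)) [0..<num_tapes M])"
proof -
  have len: "length (snd c) = num_tapes M" using assms by (simp add: valid_cfg_def)
  show ?thesis
  proof (cases "fst c = 1")
    case True
    have "map (\<lambda>j. act (snd (row_delta M (reads c)) ! j) (snd c ! j)) [0..<num_tapes M] =
          map (\<lambda>j. snd c ! j) [0..<num_tapes M]"
      using len True by (intro map_cong) (auto simp: row_delta_def reads_def act_def case_prod_unfold)
    also have "\<dots> = snd c" using len map_nth by metis
    finally have "map (\<lambda>j. act (snd (row_delta M (reads c)) ! j) (snd c ! j)) [0..<num_tapes M] = snd c" .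
    then show ?thesis using True by (simp add: tm_step_def row_delta_def reads_def prod_eq_iff)
  next
    case False
    have l: "length (snd (row_delta M (reads c))) = num_tapes M"
      using row_delta_bounds(2)[OF assms(1) reads_valid[OF assms(2)]] .
    have "map2 act xs ys = map (\<lambda>j. act (xs ! j) (ys ! j)) [0..<m]" if "length xs = m" "length ys = m" for xs ys m
      using that by (intro nth_equalityI) auto
    from this[OF l len] False show ?thesis
      by (simp add: tm_step_def row_delta_def reads_def case_prod_unfold Let_def)
  qed
qed

lemma valid_cfg_step:
  assumes "wf_tm M" "valid_cfg M c"
  shows "valid_cfg M (tm_step M c)"
  using row_delta_bounds[OF assms(1) reads_valid[OF assms(2)]] assms(2)
  unfolding tm_step_row[OF assms] valid_cfg_def by (auto simp: act_def)

lemma word_tape_less: "word_tape w i < 4"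
  using bit_symbol_range[of "w ! (i - 1)"] by (auto simp: word_tape_def)

lemma tm_init_nth:
  "j < num_tapes M \<Longrightarrow> snd (tm_init M x) ! j = (word_tape (if j = 0 then x else []), 0)"
  by (cases j) (auto simp: tm_init_def)

lemma valid_cfg_init: "wf_tm M \<Longrightarrow> valid_cfg M (tm_init M x)"
  unfolding valid_cfg_def
proof (intro conjI allI impI)
  assume wf: "wf_tm M"
  then show "fst (tm_init M x) < num_states M" "length (snd (tm_init M x)) = num_tapes M"
    by (auto simp: tm_init_def wf_tm_def)
  fix j i assume "j < num_tapes M"
  then have "fst (snd (tm_init M x) ! j) i < 4" using word_tape_less by (simp add: tm_init_nth)
  then show "fst (snd (tm_init M x) ! j) i < num_symbols M" using wf by (simp add: wf_tm_def)
qed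

lemma valid_cfg_run: "wf_tm M \<Longrightarrow> valid_cfg M ((tm_step M ^^ t) (tm_init M x))"
  by (induction t) (auto simp: valid_cfg_init valid_cfg_step)

lemma halted_stays:
  assumes "fst ((tm_step M ^^ t) c) = 1" "t \<le> t'"
  shows "(tm_step M ^^ t') c = (tm_step M ^^ t) c"
  using assms(2)
proof (induction t' rule: dec_induct)
  case (step n)
  have "(tm_step M ^^ Suc n) c = tm_step M ((tm_step M ^^ t) c)" using step by simp
  also have "\<dots> = (tm_step M ^^ t) c" unfolding tm_step_def[of M "(tm_step M ^^ t) c"] using assms(1) by simp
  finally show ?case .
qed simp

lemma length_pair_word: "length (pair_word x u) = 2 * length x + 2 + length u"
  by (induction x) (auto simp: pair_word_def)

lemma has_output_True: "has_output c [True] \<longleftrightarrow> fst (last (snd c)) 1 = 3 \<and> fst (last (snd c)) 2 = 0"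
  by (auto simp: has_output_def numeral_2_eq_2)

text \<open>Bits are never represented by a blank, so the first blank determines the length of the
  output.\<close>

lemma has_output_unique_True:
  assumes "has_output c y" "fst (last (snd c)) 1 = 3" "fst (last (snd c)) 2 = 0"
  shows "y = [True]"
proof -
  have *: "\<And>i. i < length y \<Longrightarrow> fst (last (snd c)) (i + 1) = bit_symbol (y ! i)"
    "fst (last (snd c)) (length y + 1) = 0"
    using assms(1) by (auto simp: has_output_def)
  have "length y \<noteq> 0" using *(2) assms(2) by auto
  moreover have "\<not> 1 < length y"
    using *(1)[of 1] assms(3) bit_symbol_range[of "y ! 1"] by (auto simp: numeral_2_eq_2)
  ultimately have "length y = 1" by linarith
  then obtain b where y: "y = [b]" by (auto simp: length_Suc_conv)
  then show ?thesis using *(1)[of 0] assms(2) by (cases b) auto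
qed

text \<open>This is what makes last visits sufficient: a symbol that is read now was written at the
  last visit, or is initial if there was none.\<close>

lemma content_unchanged:
  fixes con :: "nat \<Rightarrow> nat \<Rightarrow> 'c"
  assumes "\<And>t. con (Suc t) = (con t)(pos t := w t)" "a \<le> b" "\<And>s. a \<le> s \<Longrightarrow> s < b \<Longrightarrow> pos s \<noteq> y"
  shows "con b y = con a y"
  using assms(2,3)
proof (induction b rule: dec_induct)
  case (step m)
  then have "pos m \<noteq> y" "con m y = con a y" by simp_all
  then show ?case using assms(1)[of m] by simp
qed simp

text \<open>An item \<open>[l, c] @ hs @ vs\<close> for time \<open>t\<close> consists of the length \<open>l\<close> of the verifier's input, the
  index \<open>c\<close> of the state and the symbols that are read, the head positions \<open>hs\<close> and, for each tape,
  the last time before \<open>t\<close> at which its head was in the same cell, or \<open>t\<close> if there is none. At the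
  two additional times \<open>T + 1\<close> and \<open>T + 2\<close> the heads are put on the cells 1 and 2, to read the output.\<close>

locale tableau =
  fixes M :: turing_machine and rows :: "(nat \<times> nat list) list" and W :: "bool list"
    and lo hi T B :: nat
  assumes wf: "wf_tm M" and rows: "set rows = valid_rows M"
begin

abbreviation k :: nat where "k \<equiv> num_tapes M"

definition state :: "nat \<Rightarrow> nat" where "state c = fst (rows ! c)"
definition sym :: "nat \<Rightarrow> nat \<Rightarrow> nat" where "sym c j = snd (rows ! c) ! j"
definition nstate :: "nat \<Rightarrow> nat" where "nstate c = fst (row_delta M (rows ! c))"
definition wr :: "nat \<Rightarrow> nat \<Rightarrow> nat" where "wr c j = fst (snd (row_delta M (rows ! c)) ! j)"
definition mv :: "nat \<Rightarrow> nat \<Rightarrow> head_move" where "mv c j = snd (snd (row_delta M (rows ! c)) ! j)"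

abbreviation hd_pos :: "nat list \<Rightarrow> nat \<Rightarrow> nat" where "hd_pos d j \<equiv> d ! (2 + j)"
abbreviation lv :: "nat list \<Rightarrow> nat \<Rightarrow> nat" where "lv d j \<equiv> d ! (2 + k + j)"

text \<open>The possible initial symbols of cell \<open>h\<close>. \<open>W\<close> is the part of
  the verifier's input that is known in advance, preceded by a dummy bit for the marker, so that
  cell \<open>h\<close> contains \<open>W ! h\<close>. The cells from there up to \<open>l\<close>
  belong to the certificate and may contain either bit; this is the only place where something is
  guessed about the tapes.\<close>

definition ini :: "nat \<Rightarrow> nat \<Rightarrow> nat \<Rightarrow> nat \<Rightarrow> bool" where
  "ini j h s l \<longleftrightarrow>
     (if h = 0 then s = 1
      else if j = 0 \<and> h < length W then s = bit_symbol (W ! h)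
      else if j = 0 \<and> h \<le> l then s = 2 \<or> s = 3
      else s = 0)"

text \<open>The symbol 3 in cell 1 and the blank in cell 2 of the last tape, demanded for the two
  additional times, express the output \<open>[True]\<close>.\<close>

definition self :: "nat \<Rightarrow> nat list \<Rightarrow> bool" where
  "self t d \<longleftrightarrow>
     lo \<le> d ! 0 \<and> d ! 0 \<le> hi \<and> d ! 1 < length rows \<and>
     (t = 0 \<longrightarrow> state (d ! 1) = 0 \<and> (\<forall>j<k. hd_pos d j = 0)) \<and>
     (t = T \<longrightarrow> state (d ! 1) = 1) \<and>
     (t = T + 1 \<longrightarrow> sym (d ! 1) (k - 1) = 3 \<and> (\<forall>j<k. hd_pos d j = 1)) \<and>
     (t = T + 2 \<longrightarrow> sym (d ! 1) (k - 1) = 0 \<and> (\<forall>j<k. hd_pos d j = 2)) \<and>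
     (\<forall>j<k. lv d j \<le> t \<and> (lv d j = t \<longrightarrow> ini j (hd_pos d j) (sym (d ! 1) j) (d ! 0)))"

text \<open>The two clauses on \<open>lv\<close> make the claimed last visit the true one: at that
  time the head was in the cell, and at no time in between it was. Each clause speaks of two times
  only, although the notion of a last visit involves all of them.\<close>

definition before :: "nat \<Rightarrow> nat list \<Rightarrow> nat \<Rightarrow> nat list \<Rightarrow> bool" where
  "before t d t' e \<longleftrightarrow>
     d ! 0 = e ! 0 \<and>
     (t' = Suc t \<and> t' \<le> T \<longrightarrow> state (e ! 1) = nstate (d ! 1) \<and>
        (\<forall>j<k. hd_pos e j = move_head (mv (d ! 1) j) (hd_pos d j))) \<and>
     (\<forall>j<k. (lv e j = t \<longrightarrow> hd_pos d j = hd_pos e j \<and> sym (e ! 1) j = wr (d ! 1) j) \<and>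
            (lv e j = t' \<or> lv e j < t \<longrightarrow> hd_pos d j \<noteq> hd_pos e j))"

text \<open>The case of equal times synchronises two families of items that are chosen
  independently.\<close>

definition compat :: "nat \<Rightarrow> nat list \<Rightarrow> nat \<Rightarrow> nat list \<Rightarrow> bool" where
  "compat t d t' e \<longleftrightarrow> (if t = t' then d = e \<and> self t d else if t < t' then before t d t' e else before t' e t d)"

definition items :: "nat list set" where
  "items = {d. length d = 2 + 2 * k \<and> set d \<subseteq> {..<B}}"

lemma k_pos: "0 < k" using wf by (auto simp: wf_tm_def)

lemma accepting_of_items:
  assumes W: "W = True # concat (map (\<lambda>b. [b, b]) x) @ [False, True]" and lo: "lo = 2 * length x + 2"
    and comp: "\<And>u. length u \<le> hi - lo \<Longrightarrow> computes_within M (pair_word x u) (V (pair_word x u)) T"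
    and c: "\<And>t t'. t < T + 3 \<Longrightarrow> t' < T + 3 \<Longrightarrow> compat t (ch t) t' (ch' t')"
  shows "\<exists>u. length u \<le> hi - lo \<and> V (pair_word x u) = [True]"
proof -
  have eq: "ch' t = ch t" if "t < T + 3" for t
    using c[OF that that] by (simp add: compat_def)
  have self: "self t (ch t)" if "t < T + 3" for t
    using c[OF that that] unfolding compat_def if_P[OF refl] by (rule conjunct2)
  have bef: "before t (ch t) t' (ch t')" if "t < t'" "t' < T + 3" for t t'
    using c[of t t'] eq[of t'] that by (simp add: compat_def)
  let ?l = "ch 0 ! 0"
  have l: "ch t ! 0 = ?l" if "t < T + 3" for t
    using bef[of 0 t] that by (cases "t = 0") (auto simp: before_def)
  let ?h = "\<lambda>j t. hd_pos (ch t) j" and ?s = "\<lambda>j t. sym (ch t ! 1) j" and ?w = "\<lambda>j t. wr (ch t ! 1) j"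
    and ?v = "\<lambda>j t. lv (ch t) j"
  have lhi: "lo \<le> ?l" "?l \<le> hi" using self[of 0] by (auto simp: self_def)
  \<comment> \<open>A bit of the certificate is the symbol guessed at the first visit of its cell,
    which is cell \<open>lo + 1 + i\<close> because of the marker. Cells that are never visited get
    \<open>False\<close>.\<close>
  define u where "u = map (\<lambda>i. \<exists>t<T+3. ?h 0 t = lo + 1 + i \<and> ?v 0 t = t \<and> ?s 0 t = 3) [0..<?l - lo]"
  have lenu: "length u = ?l - lo" "length u \<le> hi - lo" using lhi by (simp_all add: u_def)
  let ?pw = "pair_word x u"
  have lenW: "length W = lo + 1" using length_pair_word[of x "[]"] by (simp add: W lo pair_word_def)
  have pw: "True # ?pw = W @ u" by (simp add: W pair_word_def)
  \<comment> \<open>A cell has at most one visit that claims to be the first, so all guesses are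
    consistent.\<close>
  have fresh: "?h j t' \<noteq> ?h j t" if "?v j t = t" "t' < t" "t < T + 3" "j < k" for j t t'
    using bef[of t' t] that unfolding before_def by blast
  \<comment> \<open>The tapes are reconstructed by replaying the writes of all items on the true
    initial contents. It remains to see that the symbols named by the items are really
    there.\<close>
  define con where "con j = rec_nat (word_tape (if j = 0 then ?pw else []))
     (\<lambda>t c. c(?h j t := ?w j t))" for j
  have con0: "con j 0 = word_tape (if j = 0 then ?pw else [])" for j by (simp add: con_def)
  have conS: "con j (Suc t) = (con j t)(?h j t := ?w j t)" for j t by (simp add: con_def)
  have read: "con j t (?h j t) = ?s j t" if t: "t < T + 3" and j: "j < k" for j t
  proof (cases "?v j t = t")
    case True
    have "con j t (?h j t) = con j 0 (?h j t)"
      by (rule content_unchanged[where con = "con j" and pos = "?h j" and w = "?w j", OF conS]) (use fresh[OF True _ t j] in auto)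
    moreover have "ini j (?h j t) (?s j t) ?l"
      using self[OF t] True j l[OF t] by (simp add: self_def)
    moreover have "con 0 0 (?h j t) = ?s j t" if j0: "j = 0" and ini: "ini j (?h j t) (?s j t) ?l"
    proof -
      have nth: "?pw ! (i - 1) = (W @ u) ! i" if "i > 0" for i
        using pw that by (metis nth_Cons_pos)
      have len: "length ?pw = ?l" using lenu lhi by (simp add: length_pair_word lo)
      consider "?h j t = 0" | "0 < ?h j t" "?h j t < length W" | "length W \<le> ?h j t" "?h j t \<le> ?l" | "?l < ?h j t" "?h j t \<noteq> 0"
        by linarith
      then show ?thesis
      proof cases
        case 1
        then show ?thesis using ini by (simp add: con0 word_tape_def ini_def)
      next
        case 2
        then have "?h j t \<le> ?l" using lenW lhi by simp
        then show ?thesis using 2 ini nth[of "?h j t"] len j0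
          by (simp add: con0 word_tape_def ini_def nth_append)
      next
        case 3
        let ?i = "?h j t - length W"
        have s: "?s j t = 2 \<or> ?s j t = 3" using 3 ini j0 lenW by (simp add: ini_def)
        have i: "?i < length u" "?h j t = lo + 1 + ?i" using 3 lenu lenW by auto
        have "u ! ?i \<longleftrightarrow> (\<exists>t'<T+3. ?h 0 t' = lo + 1 + ?i \<and> ?v 0 t' = t' \<and> ?s 0 t' = 3)"
          using i(1) lenu(1) by (simp add: u_def)
        also have "\<dots> \<longleftrightarrow> ?s j t = 3"
        proof
          assume "\<exists>t'<T+3. ?h 0 t' = lo + 1 + ?i \<and> ?v 0 t' = t' \<and> ?s 0 t' = 3"
          then obtain t' where t': "t' < T + 3" "?h 0 t' = ?h 0 t" "?v 0 t' = t'" "?s 0 t' = 3"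
            using i(2) j0 by auto
          have "\<not> t < t'" using fresh[OF t'(3) _ t'(1) k_pos, of t] t'(2) by metis
          moreover have "\<not> t' < t" using fresh[where j = 0 and t = t and t' = t'] True t k_pos t'(2) j0 by metis
          ultimately have "t' = t" by simp
          then show "?s j t = 3" using t' j0 by simp
        next
          assume "?s j t = 3"
          then show "\<exists>t'<T+3. ?h 0 t' = lo + 1 + ?i \<and> ?v 0 t' = t' \<and> ?s 0 t' = 3"
            using t True i(2) j0 by (intro exI[of _ t]) auto
        qed
        finally have "bit_symbol (u ! ?i) = ?s j t" using s by (cases "u ! ?i") auto
        moreover have "con 0 0 (?h j t) = bit_symbol (u ! ?i)"
          using 3 len nth[of "?h j t"] lenW by (simp add: con0 word_tape_def nth_append)
        ultimately show ?thesis by simp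
      next
        case 4
        then show ?thesis using ini len lenW lhi by (auto simp: con0 word_tape_def ini_def split: if_splits)
      qed
    qed
    moreover have "con j 0 (?h j t) = ?s j t" if "j \<noteq> 0" "ini j (?h j t) (?s j t) ?l"
      using that by (auto simp: con0 word_tape_def ini_def split: if_splits)
    ultimately show ?thesis by metis
  next
    case False
    let ?a = "?v j t"
    have a: "?a < t" using self[OF t] j False by (auto simp: self_def le_less)
    have b: "?h j ?a = ?h j t" "?s j t = ?w j ?a"
      using bef[OF a t] j unfolding before_def by auto
    have "con j t (?h j t) = con j (Suc ?a) (?h j t)"
    proof (rule content_unchanged[where con = "con j" and pos = "?h j" and w = "?w j", OF conS])
      fix s assume "Suc ?a \<le> s" "s < t"
      then show "?h j s \<noteq> ?h j t" using bef[of s t] t j unfolding before_def by auto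
    qed (use a in simp)
    then show ?thesis using b conS[of j ?a] by simp
  qed
  let ?cf = "\<lambda>t. (tm_step M ^^ t) (tm_init M ?pw)"
  have c_less: "ch t ! 1 < length rows" if "t < T + 3" for t using self[OF that] by (simp add: self_def)
  have row_len: "length (snd (rows ! (ch t ! 1))) = k" if "t < T + 3" for t
  proof -
    have "rows ! (ch t ! 1) \<in> valid_rows M" using c_less[OF that] rows nth_mem by blast
    then show ?thesis by (auto simp: valid_rows_def)
  qed
  have cf: "?cf t = (state (ch t ! 1), map (\<lambda>j. (con j t, ?h j t)) [0..<k])" if "t \<le> T" for t
    using that
  proof (induction t)
    case 0
    have "?cf 0 = (0, map (\<lambda>j. (word_tape (if j = 0 then ?pw else []), 0)) [0..<k])"
      unfolding funpow_0
    proof (rule prod_eqI)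
      show "snd (tm_init M ?pw) = snd (0, map (\<lambda>j. (word_tape (if j = 0 then ?pw else []), 0)) [0..<k])"
        using k_pos by (intro nth_equalityI) (auto simp: tm_init_nth, auto simp: tm_init_def)
    qed (simp add: tm_init_def)
    then show ?case using self[of 0] by (simp add: self_def con0 cong: map_cong)
  next
    case (Suc t)
    then have t: "t < T + 3" "t \<le> T" by auto
    have IH: "?cf t = (state (ch t ! 1), map (\<lambda>j. (con j t, ?h j t)) [0..<k])" using Suc by simp
    have "reads (?cf t) = rows ! (ch t ! 1)"
      unfolding IH reads_def using read[OF t(1)] row_len[OF t(1)]
      by (intro prod_eqI nth_equalityI) (auto simp: state_def sym_def)
    then have "?cf (Suc t) = (nstate (ch t ! 1),
       map (\<lambda>j. act (snd (row_delta M (rows ! (ch t ! 1))) ! j) (snd (?cf t) ! j)) [0..<k])"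
      using tm_step_row[OF wf valid_cfg_run[OF wf, of t ?pw]] by (simp add: nstate_def)
    also have "\<dots> = (state (ch (Suc t) ! 1), map (\<lambda>j. (con j (Suc t), ?h j (Suc t))) [0..<k])"
      using bef[of t "Suc t"] Suc.prems unfolding IH
      by (auto simp: before_def act_def conS wr_def mv_def)
    finally show ?case .
  qed
  have fin: "fst (?cf T) = 1" using cf[of T] self[of T] by (simp add: self_def)
  have "last [0..<k] = k - 1" using k_pos by (metis last_upt)
  then have last: "fst (last (snd (?cf T))) = con (k - 1) T"
    using cf[of T] k_pos by (simp add: last_map)
  \<comment> \<open>At time \<open>T\<close> the machine has halted, so the row of this item writes
    back what it reads and the output is still intact at time \<open>T + 1\<close>.\<close>
  have wT: "?w (k - 1) T = ?s (k - 1) T"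
    using fin cf[of T] row_len[of T] k_pos by (simp add: wr_def sym_def row_delta_def state_def)
  have "con (k - 1) (Suc T) = con (k - 1) T"
    using conS[of "k - 1" T] read[of T "k - 1"] wT k_pos by (metis diff_less fun_upd_triv less_add_same_cancel1 zero_less_numeral zero_less_one)
  moreover have out1: "con (k - 1) (Suc T) 1 = 3" and h1: "?h (k - 1) (Suc T) = 1"
  proof -
    have "\<forall>j<k. ?h j (Suc T) = 1" and s: "?s (k - 1) (Suc T) = 3"
      using self[of "Suc T"] by (simp_all add: self_def)
    then show h: "?h (k - 1) (Suc T) = 1" using k_pos by (meson diff_less zero_less_one)
    have "con (k - 1) (Suc T) (?h (k - 1) (Suc T)) = ?s (k - 1) (Suc T)"
      by (rule read) (use k_pos in auto)
    then show "con (k - 1) (Suc T) 1 = 3" unfolding h s .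
  qed
  moreover have "con (k - 1) (Suc (Suc T)) 2 = 0"
  proof -
    have "\<forall>j<k. ?h j (Suc (Suc T)) = 2" and s: "?s (k - 1) (Suc (Suc T)) = 0"
      using self[of "Suc (Suc T)"] by (simp_all add: self_def)
    then have h: "?h (k - 1) (Suc (Suc T)) = 2" using k_pos by (meson diff_less zero_less_one)
    have "con (k - 1) (Suc (Suc T)) (?h (k - 1) (Suc (Suc T))) = ?s (k - 1) (Suc (Suc T))"
      by (rule read) (use k_pos in auto)
    then show ?thesis unfolding h s .
  qed
  \<comment> \<open>Whatever the item at time \<open>T + 1\<close> writes goes to cell 1, so cell 2
    is still as the machine left it.\<close>
  moreover have "con (k - 1) (Suc (Suc T)) 2 = con (k - 1) (Suc T) 2"
    unfolding conS[of "k - 1" "Suc T"] h1 by simp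
  ultimately have out: "fst (last (snd (?cf T))) 1 = 3" "fst (last (snd (?cf T))) 2 = 0"
    unfolding last by auto
  obtain t where "t \<le> T" "fst (?cf t) = 1" "has_output (?cf t) (V ?pw)"
    using comp[OF lenu(2)] by (auto simp: computes_within_def)
  then have "has_output (?cf T) (V ?pw)" using halted_stays by metis
  from has_output_unique_True[OF this out] show ?thesis using lenu(2) by blast
qed

lemma items_of_accepting:
  assumes W: "W = True # concat (map (\<lambda>b. [b, b]) x) @ [False, True]" and lo: "lo = 2 * length x + 2"
    and comp: "computes_within M (pair_word x u) [True] T" and u: "length u \<le> hi - lo" and lohi: "lo \<le> hi"
    and B: "hi < B" "length rows \<le> B" "T + 2 < B"
  shows "\<exists>ch. (\<forall>t<T+3. ch t \<in> items) \<and> (\<forall>t<T+3. \<forall>t'<T+3. compat t (ch t) t' (ch t'))"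
proof -
  let ?pw = "pair_word x u"
  let ?cf = "\<lambda>t. (tm_step M ^^ t) (tm_init M ?pw)"
  have valid: "valid_cfg M (?cf t)" for t by (rule valid_cfg_run[OF wf])
  have lenW: "length W = lo + 1" using length_pair_word[of x "[]"] by (simp add: W lo pair_word_def)
  have pw: "True # ?pw = W @ u" by (simp add: W pair_word_def)
  obtain t0 where t0: "t0 \<le> T" "fst (?cf t0) = 1" "has_output (?cf t0) [True]"
    using comp by (auto simp: computes_within_def)
  then have T: "?cf t = ?cf T" if "T \<le> t" for t
    using halted_stays[OF t0(2), of t] halted_stays[OF t0(2), of T] that by simp
  have finT: "fst (?cf T) = 1" "has_output (?cf T) [True]"
    using t0 halted_stays[OF t0(2,1)] by auto
  \<comment> \<open>After time \<open>T\<close> the positions are fictitious: cells 1 and 2, where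
    the output is inspected.\<close>
  define pos where "pos j t = (if t \<le> T then snd (snd (?cf t) ! j) else t - T)" for j t
  define con where "con j t = fst (snd (?cf t) ! j)" for j t
  define row where "row t = (fst (?cf t), map (\<lambda>j. con j t (pos j t)) [0..<k])" for t
  have row_reads: "row t = reads (?cf t)" if "t \<le> T" for t
    using valid[of t] that
    by (auto simp: row_def reads_def valid_cfg_def con_def pos_def case_prod_unfold intro!: nth_equalityI)
  have "row t \<in> valid_rows M" for t
    using valid[of t] by (auto simp: row_def valid_rows_def valid_cfg_def con_def)
  then have "\<exists>c. c < length rows \<and> rows ! c = row t" for t
    using rows by (metis in_set_conv_nth)
  then obtain c where c: "\<And>t. c t < length rows" "\<And>t. rows ! c t = row t" by metis
  have symc: "sym (c t) j = con j t (pos j t)" if "j < k" for t j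
    using that by (simp add: sym_def c(2) row_def)
  have statec: "state (c t) = fst (?cf t)" for t by (simp add: state_def c(2) row_def)
  have stepcf: "?cf (Suc t) = (nstate (c t), map (\<lambda>j. act (wr (c t) j, mv (c t) j) (snd (?cf t) ! j)) [0..<k])"
    if "t \<le> T" for t
    using tm_step_row[OF wf valid[of t]] row_reads[OF that]
    by (simp add: nstate_def wr_def mv_def c(2))
  have conS: "con j (Suc t) = (con j t)(pos j t := wr (c t) j)" if j: "j < k" for j t
  proof (cases "t \<le> T")
    case True
    then show ?thesis using stepcf[OF True] j by (simp add: con_def act_def pos_def)
  next
    case False
    \<comment> \<open>In the halting state a row rewrites the symbol it reads, so the fictitious
      positions do not disturb the contents.\<close>
    have "wr (c t) j = con j t (pos j t)"
      using finT T[of t] False j by (simp add: wr_def c(2) row_def row_delta_def)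
    moreover have "con j (Suc t) = con j t" using T[of t] T[of "Suc t"] False by (simp add: con_def)
    ultimately show ?thesis by simp
  qed
  have posS: "pos j (Suc t) = move_head (mv (c t) j) (pos j t)" if "j < k" "Suc t \<le> T" for j t
    using stepcf[of t] that by (simp add: pos_def act_def)
  have move_le: "move_head m h \<le> Suc h" for m h by (cases m) auto
  have con0: "con j 0 = word_tape (if j = 0 then ?pw else [])" "pos j 0 = 0" if "j < k" for j
    using that by (simp_all add: con_def pos_def tm_init_nth)
  have pos_le: "pos j t \<le> t" if "j < k" for j t
  proof (cases "t \<le> T")
    case True
    then show ?thesis
    proof (induction t)
      case (Suc t)
      then show ?case using posS[OF that, of t] move_le[of "mv (c t) j" "pos j t"] by simp
    qed (simp add: con0 that)
  qed (simp add: pos_def)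
  define last where "last j t = (if \<exists>s<t. pos j s = pos j t then Max {s. s < t \<and> pos j s = pos j t} else t)" for j t
  have last_le: "last j t \<le> t" for j t
  proof (cases "\<exists>s<t. pos j s = pos j t")
    case True
    have "Max {s. s < t \<and> pos j s = pos j t} \<in> {s. s < t \<and> pos j s = pos j t}"
      using True by (intro Max_in) auto
    then show ?thesis using True by (simp add: last_def)
  qed (auto simp: last_def)
  have last_eq: "pos j s = pos j t \<and> (\<forall>r. s < r \<and> r < t \<longrightarrow> pos j r \<noteq> pos j t)"
    if "last j t = s" "s < t" for j t s
  proof -
    have ex: "\<exists>s<t. pos j s = pos j t" using that by (auto simp: last_def split: if_splits)
    then have m: "s = Max {s. s < t \<and> pos j s = pos j t}" using that by (simp add: last_def)
    have "s \<in> {s. s < t \<and> pos j s = pos j t}" unfolding m using ex by (intro Max_in) auto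
    moreover have "r \<le> s" if "r < t" "pos j r = pos j t" for r
      unfolding m using that by (intro Max_ge) auto
    ultimately show ?thesis by fastforce
  qed
  have last_none: "pos j s \<noteq> pos j t" if "last j t = t" "s < t" for j t s
  proof
    assume "pos j s = pos j t"
    then have ex: "\<exists>s<t. pos j s = pos j t" using that by auto
    have "Max {s. s < t \<and> pos j s = pos j t} \<in> {s. s < t \<and> pos j s = pos j t}"
      using ex by (intro Max_in) auto
    then have "Max {s. s < t \<and> pos j s = pos j t} < t" by blast
    moreover have "last j t = Max {s. s < t \<and> pos j s = pos j t}" using ex by (simp only: last_def if_True)
    ultimately show False using that(1) by linarith
  qed
  define l where "l = lo + length u"
  define ch where "ch t = [l, c t] @ map (\<lambda>j. pos j t) [0..<k] @ map (\<lambda>j. last j t) [0..<k]" for t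
  have ch: "ch t ! 0 = l" "ch t ! 1 = c t" "j < k \<Longrightarrow> hd_pos (ch t) j = pos j t" "j < k \<Longrightarrow> lv (ch t) j = last j t" for t j
    by (simp_all add: ch_def nth_append)
  have ini: "ini j (pos j t) (con j t (pos j t)) l" if j: "j < k" and l: "last j t = t" for j t
  proof -
    have "con j t (pos j t) = con j 0 (pos j t)"
      by (rule content_unchanged[where con = "con j" and pos = "pos j" and w = "\<lambda>t. wr (c t) j", OF conS[OF j]]) (use last_none[OF l] in auto)
    also have "ini j (pos j t) (con j 0 (pos j t)) (lo + length u)"
    proof -
      have nth: "?pw ! (i - 1) = (W @ u) ! i" if "i > 0" for i
        using pw that by (metis nth_Cons_pos)
      have len: "length ?pw = lo + length u" by (simp add: length_pair_word lo)
      show ?thesis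
        using nth[of "pos j t"] len lenW bit_symbol_range
        by (auto simp: con0[OF j] ini_def word_tape_def nth_append)
    qed
    finally show ?thesis by (simp add: l_def)
  qed
  have self: "self t (ch t)" if "t < T + 3" for t
  proof -
    have lastk: "List.last (snd (?cf T)) = snd (?cf T) ! (k - 1)"
      using valid[of T] k_pos by (subst last_conv_nth) (auto simp: valid_cfg_def)
    have out: "con (k - 1) (Suc T) 1 = 3" "con (k - 1) (Suc (Suc T)) 2 = 0"
      using finT(2) T[of "Suc T"] T[of "Suc (Suc T)"] unfolding has_output_True lastk con_def by simp_all
    show ?thesis
      unfolding self_def ch(1,2)
    proof (intro conjI impI allI)
      show "lo \<le> l" "l \<le> hi" using u lohi by (simp_all add: l_def)
      show "c t < length rows" by (rule c(1))
    next
      assume "t = 0"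
      then show "state (c t) = 0" by (simp add: statec tm_init_def)
    next
      fix j assume "t = 0" "j < k"
      then show "hd_pos (ch t) j = 0" using ch(3)[of j t] con0(2)[of j] by simp
    next
      assume "t = T"
      then show "state (c t) = 1" using finT(1) statec by simp
    next
      assume "t = T + 1"
      then show "sym (c t) (k - 1) = 3" using out(1) symc[of "k - 1" t] k_pos by (simp add: pos_def)
    next
      fix j assume "t = T + 1" "j < k"
      then show "hd_pos (ch t) j = 1" using ch(3)[of j t] by (simp add: pos_def)
    next
      assume "t = T + 2"
      then show "sym (c t) (k - 1) = 0" using out(2) symc[of "k - 1" t] k_pos by (simp add: pos_def)
    next
      fix j assume "t = T + 2" "j < k"
      then show "hd_pos (ch t) j = 2" using ch(3)[of j t] by (simp add: pos_def)
    next
      fix j assume "j < k"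
      then show "lv (ch t) j \<le> t" using ch(4)[of j t] last_le[of j t] by simp
    next
      fix j assume "j < k" "lv (ch t) j = t"
      then show "ini j (hd_pos (ch t) j) (sym (c t) j) l"
        using ch(3,4)[of j t] symc[of j t] ini[of j t] by simp
    qed
  qed
  have bef: "before t (ch t) t' (ch t')" if tt: "t < t'" for t t'
    unfolding before_def ch(1,2)
  proof (intro conjI allI impI)
    assume "t' = Suc t \<and> t' \<le> T"
    then show "state (c t') = nstate (c t)" using stepcf[of t] by (simp add: statec)
  next
    fix j assume "t' = Suc t \<and> t' \<le> T" "j < k"
    then show "hd_pos (ch t') j = move_head (mv (c t) j) (hd_pos (ch t) j)" using posS[of j t] ch(3)[of j t] ch(3)[of j t'] by simp
  next
    fix j assume j: "j < k" and l: "lv (ch t') j = t"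
    then have l: "last j t' = t" using ch(4)[of j t'] by simp
    show "hd_pos (ch t) j = hd_pos (ch t') j" using last_eq[OF l tt] j ch(3)[of j t] ch(3)[of j t'] by simp
    have "con j t' (pos j t') = con j (Suc t) (pos j t')"
      by (rule content_unchanged[where con = "con j" and pos = "pos j" and w = "\<lambda>t. wr (c t) j", OF conS[OF j]]) (use tt last_eq[OF l tt] in auto)
    then show "sym (c t') j = wr (c t) j"
      using last_eq[OF l tt] by (simp add: symc[OF j] conS[OF j])
  next
    fix j assume j: "j < k" and l: "lv (ch t') j = t' \<or> lv (ch t') j < t"
    then show "hd_pos (ch t) j \<noteq> hd_pos (ch t') j"
      using last_none[of j t' t] last_eq[of j t' "last j t'"] tt ch(3)[of j t] ch(3,4)[of j t'] by auto
  qed simp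
  have "ch t \<in> items" if "t < T + 3" for t
  proof -
    have "l \<le> hi" using u lohi by (simp add: l_def)
    moreover have "pos j t < B" "last j t < B" if "j < k" for j
      using pos_le[OF that, of t] last_le[of j t] \<open>t < T + 3\<close> B(3) by simp_all
    ultimately show ?thesis using B(1,2) c(1)[of t] by (auto simp: items_def ch_def)
  qed
  moreover have "compat t (ch t) t' (ch t')" if "t < T + 3" "t' < T + 3" for t t'
    using self bef that by (auto simp: compat_def)
  ultimately show ?thesis by blast
qed

end


section \<open>Popular matchings\<close>


text \<open>The vote is +1 in favour of the first partner. Ranks count from the top of the list, so
  smaller is better, and being unmatched is worst.\<close>

fun vote :: "('c \<Rightarrow> nat) \<Rightarrow> 'c option \<Rightarrow> 'c option \<Rightarrow> int" where
  "vote k (Some x) (Some y) = sgn (int (k y) - int (k x))"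
| "vote k (Some x) None = 1"
| "vote k None (Some y) = -1"
| "vote k None None = 0"

lemma vote_swap: "vote k x y = - vote k y x"
  by (cases x; cases y) (auto simp: sgn_if)

lemma vote_cases: "vote k x y \<in> {-1, 0, 1}"
  by (cases x; cases y) (auto simp: sgn_if)

text \<open>The two sides are separate types and a matching is a relation between them, with
  preferences given by injective ranks. The edge sets of \<open>pref_graph\<close> enter later,
  through \<open>mk\<close>.\<close>

locale prefs =
  fixes E :: "'a \<Rightarrow> 'b \<Rightarrow> bool" and ka :: "'a \<Rightarrow> 'b \<Rightarrow> nat" and kb :: "'b \<Rightarrow> 'a \<Rightarrow> nat"
  assumes finite_E: "finite {(a, b). E a b}"
    and ka_inj: "E a b \<Longrightarrow> E a b' \<Longrightarrow> ka a b = ka a b' \<Longrightarrow> b = b'"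
    and kb_inj: "E a b \<Longrightarrow> E a' b \<Longrightarrow> kb b a = kb b a' \<Longrightarrow> a = a'"
begin

definition mt :: "('a \<times> 'b) set \<Rightarrow> bool" where
  "mt X \<longleftrightarrow> (\<forall>a b. (a, b) \<in> X \<longrightarrow> E a b) \<and>
     (\<forall>a b b'. (a, b) \<in> X \<longrightarrow> (a, b') \<in> X \<longrightarrow> b = b') \<and>
     (\<forall>a a' b. (a, b) \<in> X \<longrightarrow> (a', b) \<in> X \<longrightarrow> a = a')"

lemma mtD:
  assumes "mt X"
  shows "(a, b) \<in> X \<Longrightarrow> E a b" "(a, b) \<in> X \<Longrightarrow> (a, b') \<in> X \<Longrightarrow> b = b'"
    "(a, b) \<in> X \<Longrightarrow> (a', b) \<in> X \<Longrightarrow> a = a'"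
  using assms unfolding mt_def by blast+

lemma mt_finite: "mt X \<Longrightarrow> finite X"
  by (rule finite_subset[OF _ finite_E]) (auto dest: mtD)

definition pa :: "('a \<times> 'b) set \<Rightarrow> 'a \<Rightarrow> 'b option" where
  "pa X a = (if a \<in> Domain X then Some (THE b. (a, b) \<in> X) else None)"

definition pb :: "('a \<times> 'b) set \<Rightarrow> 'b \<Rightarrow> 'a option" where
  "pb X b = (if b \<in> Range X then Some (THE a. (a, b) \<in> X) else None)"

lemma pa_eq: "mt X \<Longrightarrow> (a, b) \<in> X \<Longrightarrow> pa X a = Some b"
  unfolding pa_def by (auto dest: mtD intro!: the_equality)

lemma pb_eq: "mt X \<Longrightarrow> (a, b) \<in> X \<Longrightarrow> pb X b = Some a"
  unfolding pb_def by (auto dest: mtD intro!: the_equality)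

lemma pa_None: "a \<notin> Domain X \<Longrightarrow> pa X a = None"
  unfolding pa_def by simp

lemma pb_None: "b \<notin> Range X \<Longrightarrow> pb X b = None"
  unfolding pb_def by simp

text \<open>The usual weight of an edge relative to a matching: 2 for a blocking edge, -2 if both
  ends prefer their present situation, and 0 otherwise.\<close>

definition wt :: "('a \<times> 'b) set \<Rightarrow> 'a \<Rightarrow> 'b \<Rightarrow> int" where
  "wt X a b = vote (ka a) (Some b) (pa X a) + vote (kb b) (Some a) (pb X b)"

lemma wt_in: "mt X \<Longrightarrow> (a, b) \<in> X \<Longrightarrow> wt X a b = 0"
  by (simp add: wt_def pa_eq pb_eq)

lemma vote_a_cases:
  assumes "mt X" "E a b" "(a, b) \<notin> X"
  shows "vote (ka a) (Some b) (pa X a) \<in> {-1, 1}"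
proof (cases "a \<in> Domain X")
  case True
  then obtain b' where b': "(a, b') \<in> X" by auto
  then have "ka a b \<noteq> ka a b'" using ka_inj[of a b b'] assms mtD(1)[OF assms(1)] by auto
  then show ?thesis using pa_eq[OF assms(1) b'] by (auto simp: sgn_if)
qed (simp add: pa_None)

lemma vote_b_cases:
  assumes "mt X" "E a b" "(a, b) \<notin> X"
  shows "vote (kb b) (Some a) (pb X b) \<in> {-1, 1}"
proof (cases "b \<in> Range X")
  case True
  then obtain a' where a': "(a', b) \<in> X" by auto
  then have "kb b a \<noteq> kb b a'" using kb_inj[of a b a'] assms mtD(1)[OF assms(1)] by auto
  then show ?thesis using pb_eq[OF assms(1) a'] by (auto simp: sgn_if)
qed (simp add: pb_None)

lemma wt_cases: "mt X \<Longrightarrow> E a b \<Longrightarrow> wt X a b \<in> {-2, 0, 2}"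
proof (cases "(a, b) \<in> X")
  case False
  assume "mt X" "E a b"
  then show ?thesis
    using vote_a_cases[OF _ _ False] vote_b_cases[OF _ _ False] unfolding wt_def by fastforce
qed (simp add: wt_in)

text \<open>The margin by which \<open>Y\<close> beats \<open>X\<close>; it turns into
  \<open>Delta\<close> in \<open>Delta_mk\<close>.\<close>

definition score :: "('a \<times> 'b) set \<Rightarrow> ('a \<times> 'b) set \<Rightarrow> int" where
  "score Y X = (\<Sum>a\<in>Domain X \<union> Domain Y. vote (ka a) (pa Y a) (pa X a)) +
               (\<Sum>b\<in>Range X \<union> Range Y. vote (kb b) (pb Y b) (pb X b))"

lemma score_swap: "score Y X = - score X Y"
  unfolding score_def Un_commute[of "Domain X"] Un_commute[of "Range X"]
  using vote_swap[of "ka _" "pa Y _" "pa X _"] vote_swap[of "kb _" "pb Y _" "pb X _"]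
  by (simp flip: sum_negf)

lemma inj_on_fst_mt: "mt X \<Longrightarrow> inj_on fst X" and inj_on_snd_mt: "mt X \<Longrightarrow> inj_on snd X"
  by (auto simp: inj_on_def dest: mtD)

text \<open>A node matched by \<open>Y\<close> votes through its edge in \<open>Y\<close>. The
  remaining voters are matched by \<open>X\<close> only, and each of them votes -1.\<close>

lemma score_eq:
  assumes X: "mt X" and Y: "mt Y"
  shows "score Y X = (\<Sum>(a, b)\<in>Y. wt X a b) - int (card (Domain X - Domain Y))
           - int (card (Range X - Range Y))"
proof -
  have fin: "finite (Domain X)" "finite (Domain Y)" "finite (Range X)" "finite (Range Y)"
    using mt_finite[OF X] mt_finite[OF Y] by (simp_all add: finite_Domain finite_Range)
  have "(\<Sum>a\<in>Domain X \<union> Domain Y. vote (ka a) (pa Y a) (pa X a)) =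
        (\<Sum>a\<in>Domain Y. vote (ka a) (pa Y a) (pa X a)) +
        (\<Sum>a\<in>Domain X - Domain Y. vote (ka a) (pa Y a) (pa X a))"
    using fin by (subst sum.union_disjoint[symmetric]) (auto intro!: sum.cong)
  also have "(\<Sum>a\<in>Domain X - Domain Y. vote (ka a) (pa Y a) (pa X a)) = (\<Sum>a\<in>Domain X - Domain Y. -1)"
  proof (rule sum.cong)
    fix a assume "a \<in> Domain X - Domain Y"
    then show "vote (ka a) (pa Y a) (pa X a) = -1"
      using pa_eq[OF X] by (auto simp: pa_None)
  qed simp
  also have "(\<Sum>a\<in>Domain Y. vote (ka a) (pa Y a) (pa X a)) =
      (\<Sum>(a, b)\<in>Y. vote (ka a) (Some b) (pa X a))"
    unfolding Domain_fst
    by (subst sum.reindex[OF inj_on_fst_mt[OF Y]]) (auto intro!: sum.cong simp: pa_eq[OF Y])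
  finally have 1: "(\<Sum>a\<in>Domain X \<union> Domain Y. vote (ka a) (pa Y a) (pa X a)) =
      (\<Sum>(a, b)\<in>Y. vote (ka a) (Some b) (pa X a)) - int (card (Domain X - Domain Y))" by simp
  have "(\<Sum>b\<in>Range X \<union> Range Y. vote (kb b) (pb Y b) (pb X b)) =
        (\<Sum>b\<in>Range Y. vote (kb b) (pb Y b) (pb X b)) +
        (\<Sum>b\<in>Range X - Range Y. vote (kb b) (pb Y b) (pb X b))"
    using fin by (subst sum.union_disjoint[symmetric]) (auto intro!: sum.cong)
  also have "(\<Sum>b\<in>Range X - Range Y. vote (kb b) (pb Y b) (pb X b)) = (\<Sum>b\<in>Range X - Range Y. -1)"
  proof (rule sum.cong)
    fix b assume "b \<in> Range X - Range Y"
    then show "vote (kb b) (pb Y b) (pb X b) = -1"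
      using pb_eq[OF X] by (auto simp: pb_None)
  qed simp
  also have "(\<Sum>b\<in>Range Y. vote (kb b) (pb Y b) (pb X b)) =
      (\<Sum>(a, b)\<in>Y. vote (kb b) (Some a) (pb X b))"
    unfolding Range_snd
    by (subst sum.reindex[OF inj_on_snd_mt[OF Y]]) (auto intro!: sum.cong simp: pb_eq[OF Y])
  finally have 2: "(\<Sum>b\<in>Range X \<union> Range Y. vote (kb b) (pb Y b) (pb X b)) =
      (\<Sum>(a, b)\<in>Y. vote (kb b) (Some a) (pb X b)) - int (card (Range X - Range Y))" by simp
  show ?thesis
    unfolding score_def 1 2 wt_def by (simp add: sum.distrib case_prod_unfold)
qed

definition pop :: "('a \<times> 'b) set \<Rightarrow> bool" where
  "pop X \<longleftrightarrow> mt X \<and> (\<forall>Y. mt Y \<longrightarrow> score Y X \<le> 0)"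

lemma score_stable_le:
  assumes S: "mt S" and X: "mt X" and st: "\<And>a b. E a b \<Longrightarrow> wt S a b \<le> 0"
  shows "score X S \<le> - int (card (Domain S - Domain X)) - int (card (Range S - Range X))"
proof -
  have "(\<Sum>(a, b)\<in>X. wt S a b) \<le> 0"
    by (rule sum_nonpos) (use st mtD[OF X] in auto)
  then show ?thesis using score_eq[OF S X] by linarith
qed

text \<open>No edge has positive weight against a stable \<open>S\<close>, and every node that
  \<open>S\<close> covers and \<open>X\<close> misses is a vote that \<open>X\<close> loses. A
  popular \<open>X\<close> cannot afford any such loss.\<close>

lemma pop_covers_stable:
  assumes S: "mt S" and st: "\<And>a b. E a b \<Longrightarrow> wt S a b \<le> 0" and X: "pop X"
  shows "Domain S \<subseteq> Domain X" "Range S \<subseteq> Range X"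
proof -
  have fin: "finite (Domain S - Domain X)" "finite (Range S - Range X)"
    using mt_finite[OF S] by (simp_all add: finite_Domain finite_Range)
  have X': "mt X" using X by (simp add: pop_def)
  have "0 \<le> score X S" using X S score_swap[of X S] by (simp add: pop_def)
  with score_stable_le[OF S X' st] have "card (Domain S - Domain X) = 0" "card (Range S - Range X) = 0"
    by auto
  then show "Domain S \<subseteq> Domain X" "Range S \<subseteq> Range X" using fin by auto
qed

section \<open>Exchanging edges of a matching\<close>

definition patch :: "'a set \<Rightarrow> ('a \<Rightarrow> 'b) \<Rightarrow> ('a \<times> 'b) set \<Rightarrow> ('a \<times> 'b) set" where
  "patch S g X = (\<lambda>a. (a, g a)) ` S \<union> {e \<in> X. fst e \<notin> S \<and> snd e \<notin> g ` S}"

context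
  fixes X S and g :: "'a \<Rightarrow> 'b"
  assumes X: "mt X" and S: "finite S" "inj_on g S" "\<And>a. a \<in> S \<Longrightarrow> E a (g a)"
begin

lemma mt_patch: "mt (patch S g X)"
  unfolding mt_def
proof (intro conjI allI impI)
  fix a b assume "(a, b) \<in> patch S g X"
  then show "E a b" using S(3) mtD(1)[OF X] by (auto simp: patch_def)
next
  fix a b b' assume "(a, b) \<in> patch S g X" "(a, b') \<in> patch S g X"
  then show "b = b'" using mtD(2)[OF X] by (auto simp: patch_def)
next
  fix a a' b assume "(a, b) \<in> patch S g X" "(a', b) \<in> patch S g X"
  then show "a = a'" using mtD(3)[OF X] S(2) by (auto simp: patch_def inj_on_def)
qed

text \<open>Edges that are kept have weight 0. An edge of \<open>X\<close> with exactly one end in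
  the patch is given up, and its other end loses its partner, which is a vote of -1.\<close>

lemma score_patch:
  "score (patch S g X) X = (\<Sum>a\<in>S. wt X a (g a))
     - int (card {e \<in> X. fst e \<notin> S \<and> snd e \<in> g ` S}) - int (card {e \<in> X. fst e \<in> S \<and> snd e \<notin> g ` S})"
proof -
  let ?Y = "patch S g X" and ?X = "{e \<in> X. fst e \<notin> S \<and> snd e \<notin> g ` S}"
  have fin: "finite X" using mt_finite[OF X] .
  have "(\<Sum>(a, b)\<in>?Y. wt X a b) = (\<Sum>(a, b)\<in>(\<lambda>a. (a, g a)) ` S. wt X a b) + (\<Sum>(a, b)\<in>?X. wt X a b)"
    unfolding patch_def using fin S by (intro sum.union_disjoint) auto
  also have "(\<Sum>(a, b)\<in>?X. wt X a b) = 0"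
    by (rule sum.neutral) (use wt_in[OF X] in auto)
  also have "(\<Sum>(a, b)\<in>(\<lambda>a. (a, g a)) ` S. wt X a b) = (\<Sum>a\<in>S. wt X a (g a))"
    by (subst sum.reindex) (auto simp: inj_on_def)
  finally have 1: "(\<Sum>(a, b)\<in>?Y. wt X a b) = (\<Sum>a\<in>S. wt X a (g a))" by simp
  have "Domain X - Domain ?Y = fst ` {e \<in> X. fst e \<notin> S \<and> snd e \<in> g ` S}"
  proof (intro equalityI subsetI)
    fix a assume a: "a \<in> Domain X - Domain ?Y"
    then obtain b where b: "(a, b) \<in> X" by auto
    have "a \<notin> S" using a by (auto simp: patch_def)
    moreover have "b \<in> g ` S"
    proof (rule ccontr)
      assume "b \<notin> g ` S"
      then have "(a, b) \<in> ?Y" using b \<open>a \<notin> S\<close> by (auto simp: patch_def)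
      then show False using a by auto
    qed
    ultimately show "a \<in> fst ` {e \<in> X. fst e \<notin> S \<and> snd e \<in> g ` S}" using b by force
  next
    fix a assume "a \<in> fst ` {e \<in> X. fst e \<notin> S \<and> snd e \<in> g ` S}"
    then obtain b where "(a, b) \<in> X" "a \<notin> S" "b \<in> g ` S" by auto
    then show "a \<in> Domain X - Domain ?Y" using mtD(2)[OF X] by (fastforce simp: patch_def)
  qed
  then have 2: "card (Domain X - Domain ?Y) = card {e \<in> X. fst e \<notin> S \<and> snd e \<in> g ` S}"
    using card_image[OF inj_on_subset[OF inj_on_fst_mt[OF X]]] by simp
  have "Range X - Range ?Y = snd ` {e \<in> X. fst e \<in> S \<and> snd e \<notin> g ` S}"
  proof (intro equalityI subsetI)
    fix b assume b: "b \<in> Range X - Range ?Y"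
    then obtain a where a: "(a, b) \<in> X" by auto
    have "b \<notin> g ` S" using b by (auto simp: patch_def)
    moreover have "a \<in> S"
    proof (rule ccontr)
      assume "a \<notin> S"
      then have "(a, b) \<in> ?Y" using a \<open>b \<notin> g ` S\<close> by (auto simp: patch_def)
      then show False using b by auto
    qed
    ultimately show "b \<in> snd ` {e \<in> X. fst e \<in> S \<and> snd e \<notin> g ` S}" using a by force
  next
    fix b assume "b \<in> snd ` {e \<in> X. fst e \<in> S \<and> snd e \<notin> g ` S}"
    then obtain a where "(a, b) \<in> X" "a \<in> S" "b \<notin> g ` S" by auto
    then show "b \<in> Range X - Range ?Y" using mtD(3)[OF X] by (fastforce simp: patch_def)
  qed
  then have 3: "card (Range X - Range ?Y) = card {e \<in> X. fst e \<in> S \<and> snd e \<notin> g ` S}"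
    using card_image[OF inj_on_subset[OF inj_on_snd_mt[OF X]]] by simp
  show ?thesis using score_eq[OF X mt_patch] 1 2 3 by simp
qed

lemma pop_patch:
  assumes "pop X"
  shows "(\<Sum>a\<in>S. wt X a (g a)) \<le> int (card {e \<in> X. fst e \<notin> S \<and> snd e \<in> g ` S})
     + int (card {e \<in> X. fst e \<in> S \<and> snd e \<notin> g ` S})"
proof -
  have "score (patch S g X) X \<le> 0" using assms mt_patch by (simp add: pop_def)
  then show ?thesis using score_patch by simp
qed

end

section \<open>Alternating walks\<close>

text \<open>One step of an alternating walk that avoids edges both of whose ends prefer \<open>X\<close>.\<close>

definition alt :: "('a \<times> 'b) set \<Rightarrow> ('a \<times> 'a) set" where
  "alt X = {(x, y). \<exists>b. E x b \<and> (x, b) \<notin> X \<and> wt X x b \<ge> 0 \<and> (y, b) \<in> X}"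

text \<open>Switching along a shortest walk and adding a blocking edge at its end would gain at
  least 2, because the edges of the walk do not have negative weight, while at most one node loses
  its partner.\<close>

lemma no_blocking_edge_reachable:
  assumes X: "pop X" and s: "s \<notin> Domain X" and reach: "(s, a) \<in> (alt X)\<^sup>*" and E: "E a b"
  shows "wt X a b \<le> 0"
proof (rule ccontr)
  assume neg: "\<not> wt X a b \<le> 0"
  have mt: "mt X" using X by (simp add: pop_def)
  have w2: "wt X a b = 2" using wt_cases[OF mt E] neg by auto
  \<comment> \<open>A walk of minimal length has no repeated nodes, so it can be switched.\<close>
  define n where "n = (LEAST n. (s, a) \<in> alt X ^^ n)"
  have n: "(s, a) \<in> alt X ^^ n"
    unfolding n_def using reach by (auto simp: rtrancl_power intro: LeastI)
  have least: "n \<le> m" if "(s, a) \<in> alt X ^^ m" for m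
    unfolding n_def using that by (rule Least_le)
  from n obtain x where x: "x 0 = s" "x n = a" "\<And>i. i < n \<Longrightarrow> (x i, x (Suc i)) \<in> alt X"
    by (auto simp: relpow_fun_conv)
  have "\<forall>i. \<exists>b. i < n \<longrightarrow> E (x i) b \<and> (x i, b) \<notin> X \<and> wt X (x i) b \<ge> 0 \<and> (x (Suc i), b) \<in> X"
    using x(3) by (auto simp: alt_def)
  then obtain y where y: "\<And>i. i < n \<Longrightarrow> E (x i) (y i)" "\<And>i. i < n \<Longrightarrow> wt X (x i) (y i) \<ge> 0"
    "\<And>i. i < n \<Longrightarrow> (x (Suc i), y i) \<in> X" by metis
  have walk: "(x i, x j) \<in> alt X ^^ (j - i)" if "i \<le> j" "j \<le> n" for i j
    using that x(3) unfolding relpow_fun_conv by (intro exI[of _ "\<lambda>k. x (i + k)"]) auto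
  have inj: "inj_on x {..n}"
  proof (rule linorder_inj_onI)
    fix i j assume ij: "i < j" "i \<in> {..n}" "j \<in> {..n}"
    show "x i \<noteq> x j"
    proof
      assume eq: "x i = x j"
      have "(s, a) \<in> alt X ^^ (i + (n - j))"
        using walk[of 0 i] walk[of j n] ij eq x(1,2) unfolding relpow_add by auto
      from least[OF this] show False using ij by simp
    qed
  qed auto
  have injy: "i = j" if "y i = y j" "i < n" "j < n" for i j
  proof -
    have "x (Suc i) = x (Suc j)" using y(3)[of i] y(3)[of j] that mtD(3)[OF mt] by auto
    then show ?thesis using inj_onD[OF inj, of "Suc i" "Suc j"] that by simp
  qed
  define y' where "y' = y(n := b)"
  \<comment> \<open>If \<open>b\<close> already lies on the walk, the blocking edge closes a cycle
    and only this cycle is switched; otherwise the whole walk from the unmatched \<open>s\<close>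
    is. The switched part starts at index \<open>m\<close>.\<close>
  define m where "m = (if \<exists>j<n. y j = b then Suc (THE j. j < n \<and> y j = b) else 0)"
  have mcase: "(m = 0 \<and> (\<forall>j<n. y j \<noteq> b)) \<or> (\<exists>j<n. m = Suc j \<and> y j = b)"
  proof (cases "\<exists>j<n. y j = b")
    case True
    then obtain j where j: "j < n" "y j = b" by auto
    then have "(THE j. j < n \<and> y j = b) = j" using injy by (intro the_equality) auto
    then show ?thesis using j by (auto simp: m_def)
  qed (auto simp: m_def)
  then have mn: "m \<le> n" by auto
  define S where "S = x ` {m..n}"
  define g where "g = (\<lambda>a. y' (THE i. i \<le> n \<and> x i = a))"
  have the: "(THE k. k \<le> n \<and> x k = x i) = i" if "i \<le> n" for i
    using that inj by (intro the_equality) (auto simp: inj_on_def)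
  have g: "g (x i) = y' i" if "i \<le> n" for i
    using the[OF that] by (simp add: g_def)
  have gS: "g ` S = y' ` {m..n}" unfolding S_def image_image using g by (intro image_cong) auto
  have injy': "inj_on y' {m..n}"
  proof (rule linorder_inj_onI)
    fix i j assume ij: "i < j" "i \<in> {m..n}" "j \<in> {m..n}"
    then show "y' i \<noteq> y' j"
      using injy[of i j] injy[of "m - 1" i] mcase by (cases "j = n") (auto simp: y'_def)
  qed auto
  have injg: "inj_on g S"
  proof (rule inj_onI)
    fix u v assume "u \<in> S" "v \<in> S" "g u = g v"
    then obtain i j where ij: "u = x i" "v = x j" "i \<in> {m..n}" "j \<in> {m..n}" "y' i = y' j"
      using g unfolding S_def by fastforce
    with injy' have "i = j" by (meson inj_onD)
    with ij show "u = v" by simp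
  qed
  have Eg: "E a' (g a')" if "a' \<in> S" for a'
    using that g y(1) x(2) E unfolding S_def by (auto simp: y'_def)
  have "(\<Sum>a\<in>S. wt X a (g a)) = (\<Sum>i\<in>{m..n}. wt X (x i) (y' i))"
    unfolding S_def by (subst sum.reindex) (use inj g in \<open>auto simp: inj_on_def\<close>)
  also have "\<dots> \<ge> (\<Sum>i\<in>{n}. wt X (x i) (y' i))"
    using mn y(2) by (intro sum_mono2) (auto simp: y'_def)
  finally have ge: "2 \<le> (\<Sum>a\<in>S. wt X a (g a))" using w2 x(2) by (simp add: y'_def)
  have lost: "{e \<in> X. fst e \<in> S \<and> snd e \<notin> g ` S} = {}"
  proof -
    have False if e: "(u, v) \<in> X" "u \<in> S" "v \<notin> g ` S" for u v
    proof -
      from e obtain i where i: "u = x i" "m \<le> i" "i \<le> n" by (auto simp: S_def)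
      show False
      proof (cases i)
        case 0
        then show False using e i s x(1) by auto
      next
        case (Suc j)
        then have v: "v = y j" using y(3)[of j] e i mtD(2)[OF mt] by auto
        show False
        proof (cases "m \<le> j")
          case True
          then have "y' j \<in> g ` S" unfolding gS using i Suc by auto
          then show False using v e i Suc by (auto simp: y'_def split: if_splits)
        next
          case False
          then have "m = Suc j" using i Suc by auto
          then have "v = b" using mcase v by auto
          moreover have "y' n \<in> g ` S" unfolding gS using mn by auto
          ultimately show False using e by (simp add: y'_def)
        qed
      qed
    qed
    then show ?thesis by auto
  qed
  \<comment> \<open>The only node that can be left alone is the former partner of
    \<open>b\<close>.\<close>
  have taken: "card {e \<in> X. fst e \<notin> S \<and> snd e \<in> g ` S} \<le> 1"
  proof -
    have "snd e = b" if e: "e \<in> X" "fst e \<notin> S" "snd e \<in> g ` S" for e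
    proof (rule ccontr)
      assume "snd e \<noteq> b"
      then obtain i where i: "m \<le> i" "i < n" "snd e = y i"
        using e(3) unfolding gS by (auto simp: y'_def split: if_splits)
      then have "fst e = x (Suc i)" using y(3)[of i] e mtD(3)[OF mt] by (metis prod.collapse)
      then show False using e i by (auto simp: S_def)
    qed
    then have "snd ` {e \<in> X. fst e \<notin> S \<and> snd e \<in> g ` S} \<subseteq> {b}" by auto
    then have "card (snd ` {e \<in> X. fst e \<notin> S \<and> snd e \<in> g ` S}) \<le> 1"
      using card_mono[of "{b}"] by fastforce
    then show ?thesis
      by (subst (asm) card_image[OF inj_on_subset[OF inj_on_snd_mt[OF mt]]]) auto
  qed
  have "finite S" by (simp add: S_def)
  have "(\<Sum>a\<in>S. wt X a (g a)) \<le> int (card {e \<in> X. fst e \<notin> S \<and> snd e \<in> g ` S})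
     + int (card {e \<in> X. fst e \<in> S \<and> snd e \<notin> g ` S})"
    by (rule pop_patch[OF mt \<open>finite S\<close> injg Eg X])
  then show False using ge taken unfolding lost card.empty by linarith
qed

text \<open>The alternating path from \<open>s\<close> along \<open>X\<close> and \<open>Y\<close> that ends outside of \<open>X\<close> has weight 0.
  By popularity its prefixes and its suffixes have weight at most 0, so all weights are 0.\<close>

lemma augmenting_alt_walk:
  assumes X: "pop X" and Y: "mt Y" and card: "card Y > card X" and score: "score Y X \<ge> 0"
  shows "\<exists>s a t. s \<notin> Domain X \<and> s \<in> Domain Y \<and> t \<notin> Range X \<and> (s, a) \<in> (alt X)\<^sup>* \<and> E a t"
proof -
  have mt: "mt X" using X by (simp add: pop_def)
  define F where "F = {(a, a'). \<exists>b. (a, b) \<in> Y \<and> (a', b) \<in> X}"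
  have F_sv: "(a, c) \<in> F \<Longrightarrow> (a, d) \<in> F \<Longrightarrow> c = d" for a c d
    unfolding F_def using mtD[OF mt] mtD[OF Y] by blast
  have F_inj: "(c, a) \<in> F \<Longrightarrow> (d, a) \<in> F \<Longrightarrow> c = d" for a c d
    unfolding F_def using mtD[OF mt] mtD[OF Y] by blast
  have fin: "finite (Domain X)" "finite (Domain Y)"
    using mt_finite[OF mt] mt_finite[OF Y] by (simp_all add: finite_Domain)
  define C where "C = F\<^sup>* `` (Domain Y - Domain X)"
  \<comment> \<open>Otherwise every node of \<open>Y\<close> in \<open>C\<close> has a successor
    under \<open>F\<close>. The successor map is injective, and outside of \<open>C\<close> each
    node of \<open>Y\<close> is matched by \<open>X\<close> as well, so \<open>Y\<close> would not
    have more edges than \<open>X\<close>.\<close>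
  have "\<exists>a\<in>C. \<exists>t. (a, t) \<in> Y \<and> t \<notin> Range X"
  proof (rule ccontr)
    assume "\<not> ?thesis"
    then have "\<forall>a\<in>Domain Y \<inter> C. \<exists>a'. (a, a') \<in> F" unfolding F_def by blast
    then obtain f where f: "\<And>a. a \<in> Domain Y \<inter> C \<Longrightarrow> (a, f a) \<in> F" by metis
    have "inj_on f (Domain Y \<inter> C)"
    proof (rule inj_onI)
      fix u v assume "u \<in> Domain Y \<inter> C" "v \<in> Domain Y \<inter> C" "f u = f v"
      then show "u = v" using f[of u] f[of v] F_inj by simp
    qed
    moreover have "f ` (Domain Y \<inter> C) \<subseteq> Domain X \<inter> C"
    proof
      fix v assume "v \<in> f ` (Domain Y \<inter> C)"
      then obtain u where u: "u \<in> Domain Y \<inter> C" "v = f u" by auto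
      from f[OF u(1)] u have uv: "(u, v) \<in> F" by simp
      then have "v \<in> Domain X" by (auto simp: F_def)
      moreover have "v \<in> C" using u uv unfolding C_def by (meson IntD2 ImageE ImageI rtrancl.rtrancl_into_rtrancl)
      ultimately show "v \<in> Domain X \<inter> C" by simp
    qed
    ultimately have 1: "card (Domain Y \<inter> C) \<le> card (Domain X \<inter> C)"
      using fin by (intro card_inj_on_le) auto
    have "Domain Y - C \<subseteq> Domain X - C" unfolding C_def by auto
    then have 2: "card (Domain Y - C) \<le> card (Domain X - C)" using fin by (intro card_mono) auto
    have "card (Domain Z) = card (Domain Z \<inter> C) + card (Domain Z - C)" if "finite (Domain Z)" for Z :: "('a \<times> 'b) set"
      using card_Int_Diff[OF that, of C] .
    with 1 2 fin have "card (Domain Y) \<le> card (Domain X)" by (metis add_mono)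
    moreover have "card (Domain Z) = card Z" if "mt Z" for Z
      unfolding Domain_fst by (rule card_image) (rule inj_on_fst_mt[OF that])
    ultimately show False using card mt Y by simp
  qed
  then obtain s a t where sat: "s \<in> Domain Y" "s \<notin> Domain X" "(s, a) \<in> F\<^sup>*" "(a, t) \<in> Y" "t \<notin> Range X"
    by (auto simp: C_def)
  then obtain k where "(s, a) \<in> F ^^ k" by (auto simp: rtrancl_power)
  then obtain x where x: "x 0 = s" "x k = a" "\<And>i. i < k \<Longrightarrow> (x i, x (Suc i)) \<in> F"
    by (auto simp: relpow_fun_conv)
  have "\<forall>i. \<exists>b. i < k \<longrightarrow> (x i, b) \<in> Y \<and> (x (Suc i), b) \<in> X"
    using x(3) by (auto simp: F_def)
  then obtain y' where y': "\<And>i. i < k \<Longrightarrow> (x i, y' i) \<in> Y \<and> (x (Suc i), y' i) \<in> X" by metis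
  define y where "y = y'(k := t)"
  have yY: "(x i, y i) \<in> Y" if "i \<le> k" for i using that y' x(2) sat(4) by (auto simp: y_def)
  have yX: "(x (Suc i), y i) \<in> X" if "i < k" for i using that y' by (auto simp: y_def)
  have yk: "y k \<notin> Range X" using sat by (simp add: y_def)
  have neq: "x i \<noteq> x (i + d)" if "d > 0" "i + d \<le> k" for i d
    using that
  proof (induction i)
    case 0
    then have "(x d, y (d - 1)) \<in> X" using yX[of "d - 1"] by simp
    then have "x d \<in> Domain X" by (rule DomainI)
    then show ?case using sat(2) x(1) by (metis add_0)
  next
    case (Suc i)
    show ?case
    proof
      assume eq: "x (Suc i) = x (Suc i + d)"
      have "(x i, x (Suc i)) \<in> F" "(x (i + d), x (Suc (i + d))) \<in> F"
        using x(3)[of i] x(3)[of "i + d"] Suc.prems by simp_all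
      then have "x i = x (i + d)" using eq F_inj[of "x i" "x (Suc i)" "x (i + d)"] by simp
      then show False using Suc by simp
    qed
  qed
  have inj: "inj_on x {..k}"
  proof (rule linorder_inj_onI)
    fix i j assume "i < j" "i \<in> {..k}" "j \<in> {..k}"
    then show "x i \<noteq> x j" using neq[of "j - i" i] by simp
  qed auto
  define w where "w i = wt X (x i) (y i)" for i
  have E: "E (x i) (y i)" if "i \<le> k" for i using mtD(1)[OF Y yY[OF that]] .
  have notX: "(x i, y i) \<notin> X" if "i \<le> k" for i
  proof (cases "i = k")
    case True
    then show ?thesis using yk by auto
  next
    case False
    then show ?thesis using yX[of i] mtD(3)[OF mt, of "x i" "y i" "x (Suc i)"] neq[of 1 i] that by auto
  qed
  \<comment> \<open>Parity replaces the bound 1, which a single lost partner gives, by 0.\<close>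
  have even: "even (w i)" if "i \<le> k" for i
    using wt_cases[OF mt E[OF that]] by (auto simp: w_def)
  define g where "g a = (THE b. (a, b) \<in> Y)" for a
  have g: "g a = b" if "(a, b) \<in> Y" for a b
    unfolding g_def using that mtD(2)[OF Y] by blast
  have gY: "(a, g a) \<in> Y" if "a \<in> Domain Y" for a using that g by auto
  have injg: "inj_on g (Domain Y)"
    using gY mtD(3)[OF Y] by (intro inj_onI) metis
  have gx: "g (x i) = y i" if "i \<le> k" for i using g[OF yY[OF that]] .
  have xY: "x ` I \<subseteq> Domain Y" if "I \<subseteq> {..k}" for I using that yY by blast
  have test: "(\<Sum>a\<in>S. wt X a (g a)) \<le> int (card {e \<in> X. fst e \<notin> S \<and> snd e \<in> g ` S})
     + int (card {e \<in> X. fst e \<in> S \<and> snd e \<notin> g ` S})" if "S \<subseteq> Domain Y" for S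
    using finite_subset[OF that fin(2)] inj_on_subset[OF injg that] mtD(1)[OF Y] gY that
    by (intro pop_patch[OF mt _ _ _ X]) blast+
  have sumw: "(\<Sum>a\<in>x ` I. wt X a (g a)) = sum w I" if "I \<subseteq> {..k}" for I
  proof -
    have "(\<Sum>a\<in>x ` I. wt X a (g a)) = (\<Sum>i\<in>I. wt X (x i) (g (x i)))"
      by (subst sum.reindex[OF inj_on_subset[OF inj that]]) simp
    also have "\<dots> = sum w I" using that gx by (intro sum.cong) (auto simp: w_def)
    finally show ?thesis .
  qed
  have gim: "g ` x ` I = y ` I" if "I \<subseteq> {..k}" for I
    unfolding image_image using that gx by (intro image_cong) auto
  have part: "(a, y i) \<in> X \<Longrightarrow> i < k \<Longrightarrow> a = x (Suc i)" for a i
    using yX mtD(3)[OF mt] by blast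
  have part': "(x (Suc i), b) \<in> X \<Longrightarrow> i < k \<Longrightarrow> b = y i" for b i
    using yX mtD(2)[OF mt] by blast
  have x0: "(x 0, b) \<notin> X" for b using sat x(1) by auto
  have le1: "card A \<le> 1" if "A \<subseteq> {e}" for A and e :: "'a \<times> 'b"
    using card_mono[OF _ that] by simp
  \<comment> \<open>Switching the first \<open>j\<close> edges breaks only the edge of
    \<open>X\<close> at \<open>y (j - 1)\<close>, whose other end \<open>x j\<close> is outside. The
    start of the path is unmatched in \<open>X\<close> and loses nothing.\<close>
  have prefix: "sum w {..<j} \<le> 0" if j: "j \<le> k" for j
  proof -
    let ?I = "{..<j}"
    have I: "?I \<subseteq> {..k}" using j by auto
    have "{e \<in> X. fst e \<notin> x ` ?I \<and> snd e \<in> y ` ?I} \<subseteq> {(x j, y (j - 1))}"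
    proof clarsimp
      fix a i assume a: "(a, y i) \<in> X" "a \<notin> x ` {..<j}" "i < j"
      then have "a = x (Suc i)" using part j by simp
      moreover from this have "Suc i = j" using a by (metis Suc_lessI imageI lessThan_iff)
      ultimately show "a = x j \<and> y i = y (j - Suc 0)" by auto
    qed
    moreover have "{e \<in> X. fst e \<in> x ` ?I \<and> snd e \<notin> y ` ?I} = {}"
    proof -
      have False if "(x i, b) \<in> X" "i < j" "b \<notin> y ` ?I" for i b
        using that x0 part'[of "i - 1" b] j by (cases i) auto
      then show ?thesis by auto
    qed
    ultimately have "sum w ?I \<le> 1"
      using test[OF xY[OF I]] le1 unfolding sumw[OF I] gim[OF I] by (smt (verit) card.empty of_nat_0 of_nat_le_1_iff)
    moreover have "even (sum w ?I)" by (rule dvd_sum) (use even j in auto)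
    ultimately show ?thesis by presburger
  qed
  have suffix: "sum w {j..k} \<le> 0" if j: "j \<le> k" for j
  proof -
    let ?I = "{j..k}"
    have I: "?I \<subseteq> {..k}" by auto
    have "{e \<in> X. fst e \<in> x ` ?I \<and> snd e \<notin> y ` ?I} \<subseteq> {(x j, y (j - 1))}"
    proof clarsimp
      fix i b assume a: "(x i, b) \<in> X" "b \<notin> y ` {j..k}" "j \<le> i" "i \<le> k"
      then obtain i' where i': "i = Suc i'" using x0 by (cases i) auto
      then have b: "b = y i'" using part' a by simp
      then have "i' < j" using a i' by (metis Suc_leD atLeastAtMost_iff imageI not_less)
      then have "i = j" using a i' by simp
      then show "x i = x j \<and> b = y (j - Suc 0)" using b i' by auto
    qed
    moreover have "{e \<in> X. fst e \<notin> x ` ?I \<and> snd e \<in> y ` ?I} = {}"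
    proof -
      have False if a: "(a, y i) \<in> X" "j \<le> i" "i \<le> k" "a \<notin> x ` ?I" for i a
      proof (cases "i = k")
        case True
        then show False using a yk by auto
      next
        case False
        then have "a = x (Suc i)" "Suc i \<in> ?I" using part a by auto
        then show False using a by auto
      qed
      then show ?thesis by auto
    qed
    ultimately have "sum w ?I \<le> 1"
      using test[OF xY[OF I]] le1 unfolding sumw[OF I] gim[OF I] by (smt (verit) card.empty of_nat_0 of_nat_le_1_iff)
    moreover have "even (sum w ?I)" by (rule dvd_sum) (use even in auto)
    ultimately show ?thesis by presburger
  qed
  \<comment> \<open>The edges of \<open>Y\<close> off the path form a patch too. The bound on their
    weight by popularity is subtracted from the nonnegative score of \<open>Y\<close>, which leaves
    the path.\<close>
  have total: "sum w {..k} \<ge> 0"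
  proof -
    let ?S = "Domain Y - x ` {..k}"
    have gS: "g ` ?S = Range Y - y ` {..k}"
    proof (intro equalityI subsetI)
      fix b assume "b \<in> g ` ?S"
      then obtain a where a: "a \<in> Domain Y" "a \<notin> x ` {..k}" "b = g a" by auto
      then have ab: "(a, b) \<in> Y" using gY by simp
      moreover have "b \<noteq> y i" if "i \<le> k" for i
        using yY[OF that] ab a(2) that mtD(3)[OF Y] by blast
      ultimately show "b \<in> Range Y - y ` {..k}" by auto
    next
      fix b assume b: "b \<in> Range Y - y ` {..k}"
      then obtain a where a: "(a, b) \<in> Y" by auto
      have "a \<noteq> x i" if "i \<le> k" for i
        using yY[OF that] a b that mtD(2)[OF Y] by blast
      then show "b \<in> g ` ?S" using a g by blast
    qed
    have finX: "finite X" using mt_finite[OF mt] .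
    have "{e \<in> X. fst e \<notin> ?S \<and> snd e \<in> g ` ?S} \<subseteq> {e \<in> X. fst e \<notin> Domain Y}"
    proof -
      have False if a: "(x i, b) \<in> X" "i \<le> k" "b \<notin> y ` {..k}" for i b
        using that x0 part'[of "i - 1" b] by (cases i) auto
      then show ?thesis unfolding gS by auto
    qed
    then have 1: "card {e \<in> X. fst e \<notin> ?S \<and> snd e \<in> g ` ?S} \<le> card (Domain X - Domain Y)"
      using finX inj_on_subset[OF inj_on_fst_mt[OF mt]] fin
      by (intro card_inj_on_le[of fst]) auto
    have "{e \<in> X. fst e \<in> ?S \<and> snd e \<notin> g ` ?S} \<subseteq> {e \<in> X. snd e \<notin> Range Y}"
    proof -
      have False if a: "(a, y i) \<in> X" "i \<le> k" "a \<notin> x ` {..k}" for i a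
        using a yk part[of a i] by (cases "i = k") auto
      then show ?thesis unfolding gS by auto
    qed
    then have 2: "card {e \<in> X. fst e \<in> ?S \<and> snd e \<notin> g ` ?S} \<le> card (Range X - Range Y)"
      using finX inj_on_subset[OF inj_on_snd_mt[OF mt]]
      by (intro card_inj_on_le[of snd]) (auto simp: finite_Range)
    have "(\<Sum>(a, b)\<in>Y. wt X a b) = (\<Sum>a\<in>Domain Y. wt X a (g a))"
      unfolding Domain_fst
      by (subst sum.reindex[OF inj_on_fst_mt[OF Y]]) (auto intro!: sum.cong simp: g)
    also have "\<dots> = (\<Sum>a\<in>?S. wt X a (g a)) + (\<Sum>a\<in>x ` {..k}. wt X a (g a))"
      using sum.subset_diff[OF xY[of "{..k}"] fin(2)] by simp
    finally show ?thesis
      using score score_eq[OF mt Y] 1 2 test[of ?S] sumw[of "{..k}"] by force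
  qed
  have split: "sum w {..<j} + sum w {j..k} = sum w {..k}" if "j \<le> k" for j
  proof -
    have "{..k} = {..<j} \<union> {j..k}" using that by auto
    then show ?thesis by (simp add: sum.union_disjoint ivl_disj_int)
  qed
  have zero: "sum w {..<j} = 0" if "j \<le> k" for j
    using split[OF that] prefix[OF that] suffix[OF that] total by linarith
  have w0: "w i = 0" if "i < k" for i
    using zero[of i] zero[of "Suc i"] that by simp
  have "(s, x i) \<in> (alt X)\<^sup>*" if "i \<le> k" for i
    using that
  proof (induction i)
    case 0
    then show ?case using x(1) by simp
  next
    case (Suc i)
    have "(x i, x (Suc i)) \<in> alt X"
      unfolding alt_def using E[of i] notX[of i] w0[of i] yX[of i] Suc.prems by (auto simp: w_def)
    then show ?case using Suc by (meson Suc_leD rtrancl.rtrancl_into_rtrancl)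
  qed
  then have "(s, a) \<in> (alt X)\<^sup>*" using x(2) by blast
  then show ?thesis using sat mtD(1)[OF Y] by blast
qed

end


section \<open>Witnesses of popularity\<close>

lemma sum_le_sum_plus_card_diff:
  fixes u :: "'c \<Rightarrow> int"
  assumes that: "finite A" "finite B" "\<And>x. u x \<ge> -1" "\<And>x. x \<notin> A \<Longrightarrow> u x = 0"
  shows "sum u B \<le> sum u A + int (card (A - B))"
    proof -
    have "sum u (A \<union> B) = sum u A + sum u (B - A)"
      using that by (subst sum.union_disjoint[symmetric]) (auto intro: sum.cong)
    also have "sum u (B - A) = 0" using that(4) by (intro sum.neutral) auto
    finally have "sum u A = sum u (B \<union> A)" by (simp add: Un_commute)
    also have "\<dots> = sum u B + sum u (A - B)"
      using that by (subst sum.union_disjoint[symmetric]) (auto intro: sum.cong)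
    finally have "sum u B = sum u A - sum u (A - B)" by simp
    moreover have "(\<Sum>x\<in>A - B. -1) \<le> sum u (A - B)" using that(3) by (intro sum_mono) auto
    ultimately show ?thesis by simp
  qed

context prefs
begin

text \<open>Weak linear programming duality: \<open>f\<close> and \<open>h\<close> form a dual
  solution of value 0. The lower bound -1 accounts for nodes of \<open>X\<close> that
  \<open>Y\<close> leaves unmatched, each of which votes for \<open>X\<close>.\<close>

lemma pop_certificate:
  fixes f :: "'a \<Rightarrow> int" and h :: "'b \<Rightarrow> int"
  assumes X: "mt X" and ge: "\<And>a b. E a b \<Longrightarrow> wt X a b \<le> f a + h b"
    and f: "\<And>a. f a \<ge> -1" "\<And>a. a \<notin> Domain X \<Longrightarrow> f a = 0"
    and h: "\<And>b. h b \<ge> -1" "\<And>b. b \<notin> Range X \<Longrightarrow> h b = 0"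
    and eq: "\<And>a b. (a, b) \<in> X \<Longrightarrow> f a + h b = 0"
  shows "pop X"
proof -
  have "score Y X \<le> 0" if Y: "mt Y" for Y
  proof -
    have fin: "finite (Domain X)" "finite (Domain Y)" "finite (Range X)" "finite (Range Y)"
      using mt_finite[OF X] mt_finite[OF Y] by (simp_all add: finite_Domain finite_Range)
    have dom: "(\<Sum>(a, b)\<in>Z. f a + h b) = sum f (Domain Z) + sum h (Range Z)" if "mt Z" for Z
      unfolding Domain_fst Range_snd sum.reindex[OF inj_on_fst_mt[OF that]]
        sum.reindex[OF inj_on_snd_mt[OF that]]
      by (simp add: sum.distrib case_prod_unfold)
    have "(\<Sum>(a, b)\<in>Y. wt X a b) \<le> (\<Sum>(a, b)\<in>Y. f a + h b)"
      using ge mtD(1)[OF Y] by (intro sum_mono) auto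
    moreover have "(\<Sum>(a, b)\<in>X. f a + h b) = 0"
      using eq by (intro sum.neutral) auto
    moreover have "sum f (Domain Y) \<le> sum f (Domain X) + int (card (Domain X - Domain Y))"
      using fin f by (intro sum_le_sum_plus_card_diff) auto
    moreover have "sum h (Range Y) \<le> sum h (Range X) + int (card (Range X - Range Y))"
      using fin h by (intro sum_le_sum_plus_card_diff) auto
    ultimately show ?thesis
      using score_eq[OF X Y] dom[OF X] dom[OF Y] by linarith
  qed
  then show ?thesis using X by (simp add: pop_def)
qed

end

section \<open>Transfer to the preference graph\<close>

locale pref_link = prefs E ka kb
  for E :: "'a \<Rightarrow> 'b \<Rightarrow> bool" and ka kb +
  fixes G :: "'v pref_graph" and na :: "'a \<Rightarrow> 'v" and nb :: "'b \<Rightarrow> 'v"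
  assumes na_inj: "E a b \<Longrightarrow> E a' b' \<Longrightarrow> na a = na a' \<Longrightarrow> a = a'"
    and nb_inj: "E a b \<Longrightarrow> E a' b' \<Longrightarrow> nb b = nb b' \<Longrightarrow> b = b'"
    and na_nb: "E a b \<Longrightarrow> E a' b' \<Longrightarrow> na a \<noteq> nb b'"
    and edges_eq: "edges G = {{na a, nb b} | a b. E a b}"
    and nodes: "E a b \<Longrightarrow> na a \<in> nodes G" "E a b \<Longrightarrow> nb b \<in> nodes G"
    and pref_a: "E a b \<Longrightarrow> E a b' \<Longrightarrow> (nb b, nb b') \<in> pref G (na a) \<longleftrightarrow> ka a b < ka a b'"
    and pref_b: "E a b \<Longrightarrow> E a' b \<Longrightarrow> (na a, na a') \<in> pref G (nb b) \<longleftrightarrow> kb b a < kb b a'"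
begin

definition mk :: "('a \<times> 'b) set \<Rightarrow> 'v set set" where
  "mk X = (\<lambda>(a, b). {na a, nb b}) ` X"

lemma edge_eq: "E a b \<Longrightarrow> E a' b' \<Longrightarrow> {na a, nb b} = {na a', nb b'} \<longleftrightarrow> a = a' \<and> b = b'"
  using na_inj nb_inj na_nb by (auto simp: doubleton_eq_iff)

lemma in_mk: "mt X \<Longrightarrow> E a b \<Longrightarrow> {na a, nb b} \<in> mk X \<longleftrightarrow> (a, b) \<in> X"
  unfolding mk_def using mtD(1)[of X] edge_eq by (auto simp: image_iff)

lemma card_mk: "mt X \<Longrightarrow> card (mk X) = card X"
  unfolding mk_def
proof (rule card_image, rule inj_onI, clarify)
  fix a b a' b' assume "mt X" "(a, b) \<in> X" "(a', b') \<in> X" "{na a, nb b} = {na a', nb b'}"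
  then show "a = a' \<and> b = b'" using edge_eq mtD(1)[of X] by blast
qed

lemma matching_mk:
  assumes "mt X"
  shows "matching G (mk X)"
  unfolding matching_def
proof
  show "mk X \<subseteq> edges G" using mtD(1)[OF assms] by (auto simp: mk_def edges_eq)
  show "pairwise disjnt (mk X)"
  proof (rule pairwiseI)
    fix e e' assume "e \<in> mk X" "e' \<in> mk X" "e \<noteq> e'"
    then obtain a b a' b' where *: "(a, b) \<in> X" "e = {na a, nb b}" "(a', b') \<in> X" "e' = {na a', nb b'}"
      by (auto simp: mk_def)
    then have "E a b" "E a' b'" using mtD(1)[OF assms] by blast+
    moreover have "a \<noteq> a'" "b \<noteq> b'"
      using *(1,3) \<open>e \<noteq> e'\<close> mtD(2,3)[OF assms] unfolding *(2,4) by blast+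
    ultimately have "na a \<noteq> na a'" "nb b \<noteq> nb b'" "na a \<noteq> nb b'" "na a' \<noteq> nb b"
      using na_inj[of a b a' b'] nb_inj[of a b a' b'] na_nb[of a b a' b'] na_nb[of a' b' a b] by auto
    then show "disjnt e e'" unfolding *(2,4) disjnt_def by simp
  qed
qed

lemma matching_ex_mk:
  assumes "matching G M"
  shows "\<exists>X. mt X \<and> M = mk X"
proof -
  let ?X = "{(a, b). E a b \<and> {na a, nb b} \<in> M}"
  have sub: "M \<subseteq> edges G" and dis: "pairwise disjnt M" using assms by (auto simp: matching_def)
  have "M = mk ?X" using sub by (auto simp: mk_def edges_eq image_iff)
  moreover have same: "e = e'" if "e \<in> M" "e' \<in> M" "v \<in> e" "v \<in> e'" for e e' v
    using dis that by (auto simp: pairwise_def disjnt_def)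
  have "mt ?X"
    unfolding mt_def
  proof (intro conjI allI impI; clarsimp)
    fix a b b' assume "E a b" "{na a, nb b} \<in> M" "E a b'" "{na a, nb b'} \<in> M"
    then show "b = b'" using same[of "{na a, nb b}" "{na a, nb b'}" "na a"] edge_eq by auto
  next
    fix a a' b assume "E a b" "{na a, nb b} \<in> M" "E a' b" "{na a', nb b} \<in> M"
    then show "a = a'" using same[of "{na a, nb b}" "{na a', nb b}" "nb b"] edge_eq by auto
  qed
  ultimately show ?thesis by blast
qed

lemma matched_a:
  assumes "mt X" "E a b"
  shows "matched (mk X) (na a) \<longleftrightarrow> a \<in> Domain X"
proof
  assume "matched (mk X) (na a)"
  then obtain a' b' where *: "(a', b') \<in> X" "na a \<in> {na a', nb b'}" by (auto simp: matched_def mk_def)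
  then have "E a' b'" using mtD(1)[OF assms(1)] by blast
  then have "a = a'" using * na_inj[OF assms(2)] na_nb[OF assms(2)] by blast
  then show "a \<in> Domain X" using * by blast
qed (auto simp: matched_def mk_def)

lemma matched_b:
  assumes "mt X" "E a b"
  shows "matched (mk X) (nb b) \<longleftrightarrow> b \<in> Range X"
proof
  assume "matched (mk X) (nb b)"
  then obtain a' b' where *: "(a', b') \<in> X" "nb b \<in> {na a', nb b'}" by (auto simp: matched_def mk_def)
  then have "E a' b'" using mtD(1)[OF assms(1)] by blast
  then have "b = b'" using * nb_inj[OF assms(2)] na_nb[OF _ assms(2)] by (metis insertE singletonD)
  then show "b \<in> Range X" using * by blast
qed (force simp: matched_def mk_def)

lemma matched_cases:
  assumes "matched (mk X) u" "mt X"
  obtains (A) a b where "(a, b) \<in> X" "u = na a" | (B) a b where "(a, b) \<in> X" "u = nb b"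
  using assms by (auto simp: matched_def mk_def)

lemma partner_a:
  assumes X: "mt X" and ab: "(a, b) \<in> X"
  shows "partner (mk X) (na a) = nb b"
  unfolding partner_def
proof (rule the_equality)
  show "{na a, nb b} \<in> mk X" using ab by (auto simp: mk_def)
  fix v assume "{na a, v} \<in> mk X"
  then obtain a' b' where *: "{na a, v} = {na a', nb b'}" "(a', b') \<in> X" by (auto simp: mk_def)
  then have "na a = na a' \<and> v = nb b'"
    using na_nb[OF mtD(1)[OF X ab] mtD(1)[OF X *(2)]] unfolding doubleton_eq_iff by metis
  then show "v = nb b" using na_inj[OF mtD(1)[OF X ab] mtD(1)[OF X *(2)]] *(2) ab mtD(2)[OF X] by metis
qed

lemma partner_b:
  assumes X: "mt X" and ab: "(a, b) \<in> X"
  shows "partner (mk X) (nb b) = na a"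
  unfolding partner_def
proof (rule the_equality)
  show "{nb b, na a} \<in> mk X" using ab by (auto simp: mk_def insert_commute)
  fix v assume "{nb b, v} \<in> mk X"
  then obtain a' b' where *: "{nb b, v} = {na a', nb b'}" "(a', b') \<in> X" by (auto simp: mk_def)
  then have "nb b = nb b' \<and> v = na a'"
    using na_nb[OF mtD(1)[OF X *(2)] mtD(1)[OF X ab]] unfolding doubleton_eq_iff by metis
  then show "v = na a" using nb_inj[OF mtD(1)[OF X ab] mtD(1)[OF X *(2)]] *(2) ab mtD(3)[OF X] by metis
qed

lemma prefers_a:
  assumes X: "mt X" and Y: "mt Y" and E: "E a b"
  shows "prefers_matching G (na a) (mk Y) (mk X) \<longleftrightarrow> vote (ka a) (pa Y a) (pa X a) = 1"
proof (cases "a \<in> Domain Y")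
  case True
  then obtain c where c: "(a, c) \<in> Y" by auto
  show ?thesis
  proof (cases "a \<in> Domain X")
    case True
    then obtain d where d: "(a, d) \<in> X" by auto
    show ?thesis
      using c d pref_a[OF mtD(1)[OF Y c] mtD(1)[OF X d]]
      by (auto simp: prefers_matching_def matched_a[OF X E] matched_a[OF Y E] partner_a[OF X d]
          partner_a[OF Y c] pa_eq[OF X d] pa_eq[OF Y c] sgn_if)
  qed (use c in \<open>auto simp: prefers_matching_def matched_a[OF X E] matched_a[OF Y E] pa_eq[OF Y c] pa_None\<close>)
next
  case False
  then show ?thesis
    by (cases "pa X a") (auto simp: prefers_matching_def matched_a[OF Y E] pa_None)
qed

lemma prefers_b:
  assumes X: "mt X" and Y: "mt Y" and E: "E a b"
  shows "prefers_matching G (nb b) (mk Y) (mk X) \<longleftrightarrow> vote (kb b) (pb Y b) (pb X b) = 1"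
proof (cases "b \<in> Range Y")
  case True
  then obtain c where c: "(c, b) \<in> Y" by auto
  show ?thesis
  proof (cases "b \<in> Range X")
    case True
    then obtain d where d: "(d, b) \<in> X" by auto
    show ?thesis
      using c d pref_b[OF mtD(1)[OF Y c] mtD(1)[OF X d]]
      by (auto simp: prefers_matching_def matched_b[OF X E] matched_b[OF Y E] partner_b[OF X d]
          partner_b[OF Y c] pb_eq[OF X d] pb_eq[OF Y c] sgn_if)
  qed (use c in \<open>auto simp: prefers_matching_def matched_b[OF X E] matched_b[OF Y E] pb_eq[OF Y c] pb_None\<close>)
next
  case False
  then show ?thesis
    by (cases "pb X b") (auto simp: prefers_matching_def matched_b[OF Y E] pb_None)
qed

text \<open>A node that prefers \<open>mk Y\<close> is matched by it and hence the end of an edge,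
  so isolated nodes of the graph are never counted.\<close>

lemma phi_mk:
  assumes X: "mt X" and Y: "mt Y"
  shows "phi G (mk Y) (mk X) =
     card {a \<in> Domain X \<union> Domain Y. vote (ka a) (pa Y a) (pa X a) = 1} +
     card {b \<in> Range X \<union> Range Y. vote (kb b) (pb Y b) (pb X b) = 1}" (is "_ = card ?A + card ?B")
proof -
  have EA: "\<exists>b. E a b" if "a \<in> Domain X \<union> Domain Y" for a
    using that mtD(1)[OF X] mtD(1)[OF Y] by blast
  have EB: "\<exists>a. E a b" if "b \<in> Range X \<union> Range Y" for b
    using that mtD(1)[OF X] mtD(1)[OF Y] by blast
  have "{u \<in> nodes G. prefers_matching G u (mk Y) (mk X)} = na ` ?A \<union> nb ` ?B"
  proof (intro equalityI subsetI)
    fix u assume u: "u \<in> {u \<in> nodes G. prefers_matching G u (mk Y) (mk X)}"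
    then have "matched (mk Y) u" by (auto simp: prefers_matching_def)
    then show "u \<in> na ` ?A \<union> nb ` ?B"
    proof (rule matched_cases[OF _ Y], goal_cases)
      case A: (1 a b)
      then show ?thesis using u prefers_a[OF X Y mtD(1)[OF Y A(1)]] by blast
    next
      case B: (2 a b)
      then show ?thesis using u prefers_b[OF X Y mtD(1)[OF Y B(1)]] by blast
    qed
  next
    fix u assume "u \<in> na ` ?A \<union> nb ` ?B"
    then show "u \<in> {u \<in> nodes G. prefers_matching G u (mk Y) (mk X)}"
      using EA EB prefers_a[OF X Y] prefers_b[OF X Y] nodes by blast
  qed
  moreover have "finite ?A" "finite ?B"
    using mt_finite[OF X] mt_finite[OF Y] by (simp_all add: finite_Domain finite_Range)
  moreover have "na ` ?A \<inter> nb ` ?B = {}" using EA EB na_nb by blast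
  moreover have "card (na ` ?A) = card ?A" using EA na_inj by (intro card_image inj_onI) blast
  moreover have "card (nb ` ?B) = card ?B" using EB nb_inj by (intro card_image inj_onI) blast
  ultimately show ?thesis by (simp add: phi_def card_Un_disjoint)
qed

lemma sum_sign: "finite A \<Longrightarrow> (\<And>x. x \<in> A \<Longrightarrow> f x \<in> {-1, 0, 1}) \<Longrightarrow>
  sum f A = int (card {x \<in> A. f x = 1}) - int (card {x \<in> A. - f x = (1::int)})"
proof (induction A rule: finite_induct)
  case (insert x F)
  have "{y \<in> insert x F. f y = 1} = (if f x = 1 then insert x {y \<in> F. f y = 1} else {y \<in> F. f y = 1})"
    "{y \<in> insert x F. - f y = 1} = (if - f x = 1 then insert x {y \<in> F. - f y = 1} else {y \<in> F. - f y = 1})"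
    by auto
  moreover have "f x \<in> {-1, 0, 1}" using insert.prems by blast
  ultimately show ?case using insert by auto
qed simp

lemma Delta_mk:
  assumes X: "mt X" and Y: "mt Y"
  shows "Delta G (mk Y) (mk X) = score Y X"
proof -
  have fin: "finite (Domain X \<union> Domain Y)" "finite (Range X \<union> Range Y)"
    using mt_finite[OF X] mt_finite[OF Y] by (simp_all add: finite_Domain finite_Range)
  have swap: "{a \<in> Domain Y \<union> Domain X. vote (ka a) (pa X a) (pa Y a) = 1} =
     {a \<in> Domain X \<union> Domain Y. - vote (ka a) (pa Y a) (pa X a) = 1}"
    "{b \<in> Range Y \<union> Range X. vote (kb b) (pb X b) (pb Y b) = 1} =
     {b \<in> Range X \<union> Range Y. - vote (kb b) (pb Y b) (pb X b) = 1}"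
    using vote_swap by (metis Un_commute)+
  show ?thesis
    unfolding Delta_def phi_mk[OF X Y] phi_mk[OF Y X] swap score_def
      sum_sign[OF fin(1) vote_cases] sum_sign[OF fin(2) vote_cases]
    by simp
qed

lemma popular_mk: "mt X \<Longrightarrow> popular G (mk X) \<longleftrightarrow> pop X"
proof
  assume X: "mt X" and "popular G (mk X)"
  then have "score X Y \<ge> 0" if "mt Y" for Y
    using matching_mk[OF that] Delta_mk[OF that X] by (auto simp: popular_def)
  then show "pop X" using X score_swap unfolding pop_def by (metis neg_0_le_iff_le)
next
  assume X: "mt X" and pop: "pop X"
  have "Delta G (mk X) N \<ge> 0" if N: "matching G N" for N
  proof -
    obtain Y where "mt Y" "N = mk Y" using matching_ex_mk[OF N] by blast
    then show ?thesis using pop Delta_mk[OF _ X] score_swap[of X Y] by (simp add: pop_def)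
  qed
  then show "popular G (mk X)" using matching_mk[OF X] by (simp add: popular_def)
qed

lemma not_stable_mk:
  assumes X: "mt X" and E: "E a b" and w: "wt X a b = 2"
  shows "\<not> stable G (mk X)"
proof
  assume st: "stable G (mk X)"
  have notX: "(a, b) \<notin> X" using w wt_in[OF X, of a b] by auto
  have v: "vote (ka a) (Some b) (pa X a) = 1" "vote (kb b) (Some a) (pb X b) = 1"
    using w vote_cases[of "ka a" "Some b" "pa X a"] vote_cases[of "kb b" "Some a" "pb X b"]
    by (auto simp: wt_def)
  have "prefers_to_situation G (mk X) (na a) (nb b)"
  proof (cases "a \<in> Domain X")
    case True
    then obtain c where c: "(a, c) \<in> X" by auto
    then show ?thesis
      using v(1) pref_a[OF E mtD(1)[OF X c]]
      by (auto simp: prefers_to_situation_def partner_a[OF X c] pa_eq[OF X c] sgn_if split: if_splits)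
  qed (simp add: prefers_to_situation_def matched_a[OF X E])
  moreover have "prefers_to_situation G (mk X) (nb b) (na a)"
  proof (cases "b \<in> Range X")
    case True
    then obtain c where c: "(c, b) \<in> X" by auto
    then show ?thesis
      using v(2) pref_b[OF E mtD(1)[OF X c]]
      by (auto simp: prefers_to_situation_def partner_b[OF X c] pb_eq[OF X c] sgn_if split: if_splits)
  qed (simp add: prefers_to_situation_def matched_b[OF X E])
  moreover have "{na a, nb b} \<in> edges G" "{na a, nb b} \<notin> mk X"
    using E in_mk[OF X E] notX by (auto simp: edges_eq)
  ultimately show False using st by (auto simp: stable_def)
qed

lemma not_dominant_mk: "mt X \<Longrightarrow> mt Y \<Longrightarrow> card Y > card X \<Longrightarrow> score Y X \<ge> 0 \<Longrightarrow> \<not> dominant G (mk X)"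
  using matching_mk[of Y] card_mk[of X] card_mk[of Y] Delta_mk[of Y X] score_swap[of X Y]
  unfolding dominant_def by fastforce

lemma popular_not_dominant:
  assumes "popular G M" "\<not> dominant G M"
  shows "\<exists>X Y. pop X \<and> mt Y \<and> card Y > card X \<and> score Y X \<ge> 0"
proof -
  obtain N where N: "matching G N" "card N > card M" "\<not> Delta G M N > 0"
    using assms by (auto simp: dominant_def)
  obtain X Y where XY: "mt X" "M = mk X" "mt Y" "N = mk Y"
    using matching_ex_mk[OF N(1)] matching_ex_mk[of M] assms(1) by (auto simp: popular_def)
  then have "pop X" "score Y X \<ge> 0" "card Y > card X"
    using assms(1) popular_mk N Delta_mk[of Y X] score_swap[of X Y] card_mk by auto
  then show ?thesis using XY by blast
qed

end


section \<open>The gadget graph\<close>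


text \<open>\<open>PA L\<close> and \<open>QB L\<close> form the stage in front of layer
  \<open>L\<close>, with a last stage for \<open>L = 2 * n\<close>; \<open>A1\<close>,
  \<open>A2\<close>, \<open>B1\<close>, \<open>B2\<close> are the cycle of an item, and
  \<open>KA\<close>, \<open>KB\<close> make up the separate component. An augmenting path goes from
  \<open>SA\<close> to \<open>QB 0\<close>, crosses a layer by \<open>PA L\<close>, the node
  \<open>B1\<close> (first copy) or \<open>B2\<close> (second copy) of an open item, its partner
  \<open>A1\<close> and \<open>QB (Suc L)\<close>, and ends with \<open>PA (2 * n)\<close> and
  \<open>TB\<close>.\<close>

datatype 'd anode = SA | PA nat | A1 nat 'd | A2 nat 'd | KA bool
datatype 'd bnode = TB | QB nat | B1 nat 'd | B2 nat 'd | KB bool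

text \<open>For adjacent nodes the value is the rank class of the second node in the list of the first one
  and the rank class of the first node in the list of the second one.\<close>

fun adj :: "nat \<Rightarrow> 'd set \<Rightarrow> (nat \<Rightarrow> 'd \<Rightarrow> nat \<Rightarrow> 'd \<Rightarrow> bool) \<Rightarrow> 'd anode \<Rightarrow> 'd bnode \<Rightarrow> (nat \<times> nat) option"
where
  "adj n D C SA (QB L) = (if L = 0 then Some (0, 1) else None)"
| "adj n D C (PA L) (QB L') = (if L = L' \<and> L \<le> 2 * n then Some (0, 0) else None)"
| "adj n D C (PA L) TB = (if L = 2 * n then Some (1, 0) else None)"
| "adj n D C (PA L) (B1 L' d) = (if L = L' \<and> L < n \<and> d \<in> D then Some (1, 2) else None)"
| "adj n D C (PA L) (B2 L' d) = (if L = L' \<and> n \<le> L \<and> L < 2 * n \<and> d \<in> D then Some (1, 0) else None)"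
| "adj n D C (A1 L d) (QB L') =
     (if L' = Suc L \<and> L < 2 * n \<and> d \<in> D then Some (if L < n then 0 else 2, 1) else None)"
| "adj n D C (A1 L d) (B1 L' d') =
     (if L = L' \<and> d = d' \<and> L < 2 * n \<and> d \<in> D then Some (if L < n then 1 else 0, 3)
      else if L' < n \<and> n \<le> L \<and> L < 2 * n \<and> d \<in> D \<and> d' \<in> D \<and> C L' d' (L - n) d then Some (1, 1)
      else None)"
| "adj n D C (A1 L d) (B2 L' d') =
     (if L = L' \<and> d = d' \<and> L < 2 * n \<and> d \<in> D then Some (3, 1) else None)"
| "adj n D C (A2 L d) (B1 L' d') =
     (if L = L' \<and> d = d' \<and> L < 2 * n \<and> d \<in> D then Some (1, 0) else None)"
| "adj n D C (A2 L d) (B2 L' d') =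
     (if L = L' \<and> d = d' \<and> L < 2 * n \<and> d \<in> D then Some (0, 2) else None)"
| "adj n D C (KA i) (KB j) = Some (if j then 0 else 1, if i then 0 else 1)"
| "adj n D C _ _ = None"

lemma vote_le_1: "vote k x y \<le> 1"
  using vote_cases[of k x y] by auto

text \<open>For both of its ends, the edge between incompatible items is in a better class than the
  edge by which a path crosses the layer. A vote for the latter is therefore a vote for the
  former.\<close>

lemma vote_better: "k x < k y \<Longrightarrow> vote k (Some y) p = 1 \<Longrightarrow> vote k (Some x) p = 1"
  by (cases p) (auto simp: sgn_if split: if_splits)

text \<open>\<open>ka\<close> and \<open>kb\<close> refine the rank classes of \<open>adj\<close> to
  strict orders. How ties within a class are broken is left open.\<close>

locale layered =
  fixes n :: nat and D :: "'d set" and C :: "nat \<Rightarrow> 'd \<Rightarrow> nat \<Rightarrow> 'd \<Rightarrow> bool"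
    and ka :: "'d anode \<Rightarrow> 'd bnode \<Rightarrow> nat" and kb :: "'d bnode \<Rightarrow> 'd anode \<Rightarrow> nat"
  assumes finite_D: "finite D"
    and ka_class: "adj n D C a b = Some (i, j) \<Longrightarrow> adj n D C a b' = Some (i', j') \<Longrightarrow> i < i' \<Longrightarrow> ka a b < ka a b'"
    and kb_class: "adj n D C a b = Some (i, j) \<Longrightarrow> adj n D C a' b = Some (i', j') \<Longrightarrow> j < j' \<Longrightarrow> kb b a < kb b a'"
    and ka_inj': "adj n D C a b \<noteq> None \<Longrightarrow> adj n D C a b' \<noteq> None \<Longrightarrow> ka a b = ka a b' \<Longrightarrow> b = b'"
    and kb_inj': "adj n D C a b \<noteq> None \<Longrightarrow> adj n D C a' b \<noteq> None \<Longrightarrow> kb b a = kb b a' \<Longrightarrow> a = a'"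
begin

definition E :: "'d anode \<Rightarrow> 'd bnode \<Rightarrow> bool" where
  "E a b \<longleftrightarrow> adj n D C a b \<noteq> None"

lemma E_iff: "E a b \<longleftrightarrow> (\<exists>i j. adj n D C a b = Some (i, j))"
  by (auto simp: E_def)

lemma finite_edges: "finite {(a, b). E a b}"
proof -
  let ?LD = "{..2 * n} \<times> D"
  let ?A = "{SA} \<union> PA ` {..2 * n} \<union> case_prod A1 ` ?LD \<union> case_prod A2 ` ?LD \<union> range KA"
  let ?B = "{TB} \<union> QB ` {..2 * n} \<union> case_prod B1 ` ?LD \<union> case_prod B2 ` ?LD \<union> range KB"
  have "a \<in> ?A \<and> b \<in> ?B" if "E a b" for a b
    using that by (cases a; cases b) (auto simp: E_def image_iff split: if_splits)
  then have "{(a, b). E a b} \<subseteq> ?A \<times> ?B" by blast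
  moreover have "finite (?A \<times> ?B)" using finite_D by simp
  ultimately show ?thesis by (rule finite_subset)
qed

sublocale prefs E ka kb
  by unfold_locales (use finite_edges ka_inj' kb_inj' in \<open>auto simp: E_def\<close>)

lemma vote_a_better:
  assumes "mt X" "(a, c) \<in> X" "adj n D C a b = Some (i, j)" "adj n D C a c = Some (i', j')"
  shows "i < i' \<Longrightarrow> vote (ka a) (Some b) (pa X a) = 1" "i > i' \<Longrightarrow> vote (ka a) (Some b) (pa X a) = -1"
  using pa_eq[OF assms(1,2)] ka_class[OF assms(3,4)] ka_class[OF assms(4,3)] by (auto simp: sgn_if)

lemma vote_b_better:
  assumes "mt X" "(c, b) \<in> X" "adj n D C a b = Some (i, j)" "adj n D C c b = Some (i', j')"
  shows "j < j' \<Longrightarrow> vote (kb b) (Some a) (pb X b) = 1" "j > j' \<Longrightarrow> vote (kb b) (Some a) (pb X b) = -1"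
  using pb_eq[OF assms(1,2)] kb_class[OF assms(3,4)] kb_class[OF assms(4,3)] by (auto simp: sgn_if)

text \<open>Each item is in one of two states, given by \<open>q\<close>.\<close>

definition base :: "(nat \<Rightarrow> 'd \<Rightarrow> bool) \<Rightarrow> (bool \<Rightarrow> bool) \<Rightarrow> ('d anode \<times> 'd bnode) set" where
  "base q f = {(a, b). case a of SA \<Rightarrow> False | PA L \<Rightarrow> L \<le> 2 * n \<and> b = QB L
     | A1 L d \<Rightarrow> L < 2 * n \<and> d \<in> D \<and> b = (if q L d then B1 L d else B2 L d)
     | A2 L d \<Rightarrow> L < 2 * n \<and> d \<in> D \<and> b = (if q L d then B2 L d else B1 L d)
     | KA i \<Rightarrow> b = KB (f i)}"

lemma base_simps:
  "(SA, b) \<notin> base q f"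
  "(PA L, b) \<in> base q f \<longleftrightarrow> L \<le> 2 * n \<and> b = QB L"
  "(A1 L d, b) \<in> base q f \<longleftrightarrow> L < 2 * n \<and> d \<in> D \<and> b = (if q L d then B1 L d else B2 L d)"
  "(A2 L d, b) \<in> base q f \<longleftrightarrow> L < 2 * n \<and> d \<in> D \<and> b = (if q L d then B2 L d else B1 L d)"
  "(KA i, b) \<in> base q f \<longleftrightarrow> b = KB (f i)"
  by (auto simp: base_def)

lemma mt_base: "inj f \<Longrightarrow> mt (base q f)"
  unfolding mt_def
proof (intro conjI allI impI)
  fix a b assume "(a, b) \<in> base q f"
  then show "E a b" by (cases a) (auto simp: base_simps E_def)
next
  fix a b b' assume "(a, b) \<in> base q f" "(a, b') \<in> base q f"
  then show "b = b'" by (cases a) (auto simp: base_simps)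
next
  fix a a' b assume "inj f" "(a, b) \<in> base q f" "(a', b) \<in> base q f"
  then show "a = a'"
    by (cases a; cases a') (auto simp: base_simps inj_def split: if_splits)
qed

text \<open>\<open>q\<close> means open in the first copy and closed in the second one, so the
  hypothesis on \<open>C\<close> prevents an edge between incompatible items from joining two open
  ones. Every other unmatched edge outside of the component has an end that prefers its
  partner.\<close>

lemma wt_base_le:
  assumes f: "inj f" and E: "E a b" and K: "\<And>i. a \<noteq> KA i"
    and C: "\<And>L d t d'. L < n \<Longrightarrow> t < n \<Longrightarrow> d \<in> D \<Longrightarrow> d' \<in> D \<Longrightarrow> C L d t d' \<Longrightarrow> q L d \<Longrightarrow> q (n + t) d'"
  shows "wt (base q f) a b \<le> 0"
proof -
  let ?X = "base q f"
  note mt = mt_base[OF f, of q]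
  have le: "wt ?X a b \<le> 0" if "vote (ka a) (Some b) (pa ?X a) = -1 \<or> vote (kb b) (Some a) (pb ?X b) = -1"
    using that vote_le_1[of "ka a" "Some b" "pa ?X a"] vote_le_1[of "kb b" "Some a" "pb ?X b"]
    by (auto simp: wt_def)
  have leA: "wt ?X a b \<le> 0" if "(a, c) \<in> ?X" "adj n D C a b = Some (i, j)" "adj n D C a c = Some (i', j')" "i > i'"
    for c i j i' j' using vote_a_better(2)[OF mt that(1-3)] that(4) le by simp
  have leB: "wt ?X a b \<le> 0" if "(c, b) \<in> ?X" "adj n D C a b = Some (i, j)" "adj n D C c b = Some (i', j')" "j > j'"
    for c i j i' j' using vote_b_better(2)[OF mt that(1-3)] that(4) le by simp
  show ?thesis
  proof (cases "(a, b) \<in> ?X")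
    case True
    then show ?thesis using wt_in[OF mt] by simp
  next
    case False
    show ?thesis
    proof (cases a)
      case SA
      then show ?thesis using E leB[of "PA 0"] by (cases b) (auto simp: E_def base_simps split: if_splits)
    next
      case (PA L)
      then show ?thesis using E False leA[of "QB L"] by (cases b) (auto simp: E_def base_simps split: if_splits)
    next
      case (A2 L d)
      then show ?thesis using E False leA[of "B2 L d"] leB[of "A1 L d"]
        by (cases b) (auto simp: E_def base_simps split: if_splits)
    next
      case (KA i)
      then show ?thesis using K by blast
    next
      case (A1 L d)
      show ?thesis
      proof (cases b)
        case TB then show ?thesis using E A1 by (simp add: E_def)
      next
        case (QB M)
        then show ?thesis using E A1 leB[of "PA M"] by (auto simp: E_def base_simps split: if_splits)
      next
        case (B2 M d')
        then show ?thesis using E A1 False leA[of "B1 L d"] by (auto simp: E_def base_simps split: if_splits)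
      next
        case (KB i) then show ?thesis using E A1 by (simp add: E_def)
      next
        case (B1 M d')
        show ?thesis
        proof (cases "M = L \<and> d' = d")
          case True
          then show ?thesis using E A1 B1 False leB[of "A2 L d"] by (auto simp: E_def base_simps split: if_splits)
        next
          case neq: False
          then have *: "M < n" "n \<le> L" "L < 2 * n" "d \<in> D" "d' \<in> D" "C M d' (L - n) d"
            using E A1 B1 by (auto simp: E_def split: if_splits)
          then have "\<not> q M d' \<or> q L d" using C[of M "L - n" d' d] by auto
          then show ?thesis
          proof
            assume "\<not> q M d'"
            then show ?thesis using A1 B1 neq * leB[of "A2 M d'"] by (auto simp: base_simps)
          next
            assume "q L d"
            then show ?thesis using A1 B1 neq * leA[of "B1 L d"] by (auto simp: base_simps)
          qed
        qed
      qed
    qed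
  qed
qed

text \<open>Pairing \<open>A1\<close> with \<open>B1\<close> everywhere closes all items of the
  second copy, so no edge between incompatible items blocks. In the component \<open>KA True\<close>
  and \<open>KB True\<close> are each other's first choice.\<close>

lemma wt_base_id_le:
  assumes "E a b"
  shows "wt (base (\<lambda>_ _. True) id) a b \<le> 0"
proof (cases "\<exists>i. a = KA i")
  case False
  then show ?thesis by (intro wt_base_le[OF inj_on_id assms]) auto
next
  case True
  let ?X = "base (\<lambda>_ _. True) id"
  have mt: "mt ?X" by (rule mt_base) simp
  from True assms obtain i j where ij: "a = KA i" "b = KB j" by (cases b) (auto simp: E_def)
  have K: "(KA i, KB i) \<in> ?X" for i by (simp add: base_simps)
  consider "i = j" | "i" "\<not> j" | "\<not> i" "j" by blast
  then show ?thesis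
  proof cases
    case 1
    then show ?thesis using wt_in[OF mt K[of i]] ij by simp
  next
    case 2
    then show ?thesis
      using vote_a_better(2)[OF mt K[of True], of "KB False"] ij vote_le_1[of "kb b" "Some a" "pb ?X b"]
      by (simp add: wt_def)
  next
    case 3
    then show ?thesis
      using vote_b_better(2)[OF mt K[of True], of "KA False"] ij vote_le_1[of "ka a" "Some b" "pa ?X a"]
      by (simp add: wt_def)
  qed
qed

text \<open>With the stable matching of this shape, every popular matching must cover all ends of
  edges except possibly \<open>SA\<close> and \<open>TB\<close>.\<close>

lemma covered:
  assumes "E a b"
  shows "a \<noteq> SA \<Longrightarrow> a \<in> Domain (base q id)" "b \<noteq> TB \<Longrightarrow> b \<in> Range (base q id)"
proof -
  assume "a \<noteq> SA"
  then show "a \<in> Domain (base q id)"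
    using assms by (cases a; cases b) (auto simp: E_def base_simps Domain.simps split: if_splits)
next
  have r: "a' \<in> A \<Longrightarrow> (a', b) \<in> base q id \<Longrightarrow> b \<in> Range (base q id)" for a' A by auto
  assume "b \<noteq> TB"
  then show "b \<in> Range (base q id)"
  proof (cases b)
    case (QB L)
    then show ?thesis using assms by (intro RangeI[of "PA L"]; cases a) (auto simp: E_def base_simps split: if_splits)
  next
    case (B1 L d)
    then show ?thesis using assms
      by (intro RangeI[of "if q L d then A1 L d else A2 L d"]; cases a) (auto simp: E_def base_simps split: if_splits)
  next
    case (B2 L d)
    then show ?thesis using assms
      by (intro RangeI[of "if q L d then A2 L d else A1 L d"]; cases a) (auto simp: E_def base_simps split: if_splits)
  next
    case (KB i)
    then show ?thesis by (intro RangeI[of "KA i"]) (simp add: base_simps)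
  qed auto
qed

text \<open>The argument does not follow the augmenting path itself. An invariant holds for all
  nodes reachable from \<open>SA\<close>, and its instance at \<open>PA (2 * n)\<close> supplies an
  open item for each layer.\<close>

lemma choice_of_popular:
  assumes X: "pop X" and Y: "mt Y" "card Y > card X" "score Y X \<ge> 0"
  shows "\<exists>ch ch'. (\<forall>t<n. ch t \<in> D \<and> ch' t \<in> D) \<and> (\<forall>t<n. \<forall>t'<n. \<not> C t (ch t) t' (ch' t'))"
proof -
  let ?S = "base (\<lambda>_ _. True) id"
  have mt: "mt X" using X by (simp add: pop_def)
  have "Domain ?S \<subseteq> Domain X" "Range ?S \<subseteq> Range X"
    using pop_covers_stable[OF mt_base[OF inj_on_id] wt_base_id_le X] by auto
  then have domX: "\<And>a b. E a b \<Longrightarrow> a \<noteq> SA \<Longrightarrow> a \<in> Domain X"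
    and ranX: "\<And>a b. E a b \<Longrightarrow> b \<noteq> TB \<Longrightarrow> b \<in> Range X"
    using covered by blast+
  define R where "R = (alt X)\<^sup>* `` {SA}"
  obtain s a t where sat: "s \<notin> Domain X" "s \<in> Domain Y" "t \<notin> Range X" "(s, a) \<in> (alt X)\<^sup>*" "E a t"
    using augmenting_alt_walk[OF X Y] by blast
  have s: "s = SA" using sat(1,2) domX mtD(1)[OF Y(1)] by blast
  have t: "t = TB" using sat(3,5) ranX by blast
  have "a = PA (2 * n)" using sat(5) t by (cases a) (auto simp: E_def split: if_splits)
  with sat s have endR: "PA (2 * n) \<in> R" by (simp add: R_def)
  have noblock: "wt X x b \<le> 0" if "x \<in> R" "E x b" for x b
    using no_blocking_edge_reachable[OF X _ _ that(2), of SA] that(1) sat(1) s by (simp add: R_def)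
  have step: "y \<in> R" if "x \<in> R" "(x, y) \<in> alt X" for x y
    using that by (auto simp: R_def)
  \<comment> \<open>\<open>PA L\<close> and \<open>QB L\<close> are each other's first choice, so
    outside of \<open>X\<close> their edge would block at a reachable node.\<close>
  have stage: "(PA L, QB L) \<in> X" if R: "PA L \<in> R" and L: "L \<le> 2 * n" for L
  proof (rule ccontr)
    assume not: "(PA L, QB L) \<notin> X"
    have E: "E (PA L) (QB L)" using L by (simp add: E_def)
    then obtain c where c: "(PA L, c) \<in> X" using domX by blast
    then have "adj n D C (PA L) c = Some (1, snd (the (adj n D C (PA L) c)))"
      using not mtD(1)[OF mt c] by (cases c) (auto simp: E_def split: if_splits)
    then have 1: "vote (ka (PA L)) (Some (QB L)) (pa X (PA L)) = 1"
      using vote_a_better(1)[OF mt c] L by (metis adj.simps(2) zero_less_one)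
    obtain c' where c': "(c', QB L) \<in> X" using E ranX by blast
    then have "adj n D C c' (QB L) = Some (fst (the (adj n D C c' (QB L))), 1)"
      using not mtD(1)[OF mt c'] by (cases c') (auto simp: E_def split: if_splits)
    then have 2: "vote (kb (QB L)) (Some (PA L)) (pb X (QB L)) = 1"
      using vote_b_better(1)[OF mt c'] L by (metis adj.simps(2) zero_less_one)
    show False using noblock[OF R E] 1 2 by (simp add: wt_def)
  qed
  \<comment> \<open>If a reachable \<open>A1\<close> of the second copy were matched to an
    incompatible item, a walk could continue through its own cycle to \<open>PA L\<close>, which
    would be matched to \<open>B2 L d\<close>, contrary to \<open>stage\<close>.\<close>
  have conflict: "L' = L \<and> d' = d"
    if R: "A1 L d \<in> R" and L: "n \<le> L" "L < 2 * n" "d \<in> D" and in_X: "(A1 L d, B1 L' d') \<in> X" for L d L' d'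
  proof (rule ccontr)
    assume neq: "\<not> ?thesis"
    then have adj1: "adj n D C (A1 L d) (B1 L' d') = Some (1, 1)"
      using mtD(1)[OF mt in_X] by (auto simp: E_def split: if_splits)
    have E1: "E (A1 L d) (B1 L d)" using L by (simp add: E_def)
    have v1: "vote (ka (A1 L d)) (Some (B1 L d)) (pa X (A1 L d)) = 1"
      using vote_a_better(1)[OF mt in_X _ adj1, of "B1 L d"] L by simp
    obtain c where c: "(c, B1 L d) \<in> X" using ranX[OF E1] by blast
    have "c = A1 L d \<or> c = A2 L d"
      using mtD(1)[OF mt c] L by (cases c) (auto simp: E_def split: if_splits)
    moreover have "c \<noteq> A1 L d" using mtD(2)[OF mt in_X, of "B1 L d"] c neq by auto
    ultimately have c: "(A2 L d, B1 L d) \<in> X" using c by auto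
    have "vote (kb (B1 L d)) (Some (A1 L d)) (pb X (B1 L d)) = -1"
      using vote_b_better(2)[OF mt c, of "A1 L d"] L by simp
    then have "(A1 L d, A2 L d) \<in> alt X"
      using E1 v1 c mtD(3)[OF mt c, of "A1 L d"] unfolding alt_def by (auto simp: wt_def)
    then have R2: "A2 L d \<in> R" using step R by blast
    have E2: "E (A2 L d) (B2 L d)" using L by (simp add: E_def)
    obtain e where e: "(e, B2 L d) \<in> X" using ranX[OF E2] by blast
    have "e = A1 L d \<or> e = A2 L d \<or> e = PA L"
      using mtD(1)[OF mt e] L by (cases e) (auto simp: E_def split: if_splits)
    moreover have "e \<noteq> A1 L d" using mtD(2)[OF mt in_X, of "B2 L d"] e by auto
    moreover have "e \<noteq> A2 L d" using mtD(2)[OF mt c, of "B2 L d"] e by auto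
    ultimately have e: "(PA L, B2 L d) \<in> X" using e by auto
    have "vote (kb (B2 L d)) (Some (A2 L d)) (pb X (B2 L d)) = -1"
      using vote_b_better(2)[OF mt e, of "A2 L d"] L by simp
    moreover have "vote (ka (A2 L d)) (Some (B2 L d)) (pa X (A2 L d)) = 1"
      using vote_a_better(1)[OF mt c, of "B2 L d"] L by simp
    ultimately have "(A2 L d, PA L) \<in> alt X"
      using E2 e mtD(3)[OF mt e, of "A2 L d"] unfolding alt_def by (auto simp: wt_def)
    then have "(PA L, QB L) \<in> X" using step R2 stage L by auto
    then show False using mtD(2)[OF mt e] by blast
  qed
  \<comment> \<open>In the first copy openness lets a walk enter from \<open>PA L\<close> with
    weight 0; in the second one it lets a walk leave towards the next stage.\<close>
  define op where "op L d \<longleftrightarrow> d \<in> D \<and>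
     (if L < n then vote (kb (B1 L d)) (Some (PA L)) (pb X (B1 L d)) = 1
      else A1 L d \<in> R \<and> vote (ka (A1 L d)) (Some (QB (Suc L))) (pa X (A1 L d)) = 1)" for L d
  define OK where "OK L \<longleftrightarrow> (\<forall>L'<L. \<exists>d. op L' d)" for L
  have OK_mono: "OK L \<Longrightarrow> L' \<le> L \<Longrightarrow> OK L'" for L L' by (auto simp: OK_def)
  have OK_Suc: "OK L \<Longrightarrow> op L d \<Longrightarrow> OK (Suc L)" for L d by (auto simp: OK_def less_Suc_eq)
  \<comment> \<open>In the first copy openness is tested on entering an item, so inside of it the
    layer already counts. In the second copy it is tested on leaving, so the layer counts only from
    the next stage on.\<close>
  define inv where "inv x = (case x of SA \<Rightarrow> True | PA L \<Rightarrow> OK L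
     | A1 L d \<Rightarrow> OK (if L < n then Suc L else L) | A2 L d \<Rightarrow> OK (if L < n then Suc L else L)
     | KA i \<Rightarrow> False)" for x :: "'d anode"
  have inv: "inv x" if "x \<in> R" for x
  proof -
    have "(SA, x) \<in> (alt X)\<^sup>*" using that by (simp add: R_def)
    then show ?thesis
    proof (induction rule: rtrancl_induct)
      case base
      then show ?case by (simp add: inv_def)
    next
      case (step x y)
      have xR: "x \<in> R" using step.hyps by (simp add: R_def)
      have yR: "y \<in> R" using step.hyps by (auto simp: R_def)
      obtain b where b: "E x b" "(x, b) \<notin> X" "wt X x b \<ge> 0" "(y, b) \<in> X"
        using step.hyps by (auto simp: alt_def)
      have wt0: "wt X x b = 0" using b noblock[OF xR b(1)] by simp
      have Ey: "E y b" using mtD(1)[OF mt b(4)] .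
      have ySA: "y \<noteq> SA" using b(4) sat(1) s by auto
      show ?case
      proof (cases b)
        case TB
        then show ?thesis using b(4) sat(3) t by auto
      next
        case (KB i)
        then show ?thesis using b(1) step.IH by (cases x) (auto simp: E_def inv_def)
      next
        case (B2 L d)
        then show ?thesis using b(1) Ey step.IH
          by (cases x; cases y) (auto simp: E_def inv_def split: if_splits)
      next
        case (QB M)
        have x: "x = SA \<and> M = 0 \<or> (\<exists>L d. x = A1 L d \<and> M = Suc L \<and> L < 2 * n \<and> d \<in> D)"
          using QB b(1,2) stage xR by (cases x) (auto simp: E_def split: if_splits)
        have y: "y = PA M \<or> (\<exists>L d. y = A1 L d \<and> M = Suc L)"
          using QB Ey ySA by (cases y) (auto simp: E_def split: if_splits)
        show ?thesis
        proof (cases "x = SA")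
          case True
          then show ?thesis using x y by (auto simp: inv_def OK_def)
        next
          case False
          then obtain L d where x: "x = A1 L d" "M = Suc L" "L < 2 * n" "d \<in> D" using x by auto
          show ?thesis
          proof (cases "y = PA M")
            case False
            then show ?thesis using x y step.IH by (auto simp: inv_def)
          next
            case yP: True
            have "OK (Suc L)"
            proof (cases "L < n")
              case True
              then show ?thesis using step.IH x by (simp add: inv_def)
            next
              case False
              have "vote (kb (QB M)) (Some x) (pb X (QB M)) = -1"
                using vote_b_better(2)[OF mt, of "PA M" "QB M" x] b(4) yP QB x by auto
              then have "vote (ka (A1 L d)) (Some (QB (Suc L))) (pa X (A1 L d)) = 1"
                using wt0 QB x by (simp add: wt_def)
              then have "op L d" using x False xR by (simp add: op_def)
              then show ?thesis using OK_Suc step.IH x False by (simp add: inv_def)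
            qed
            then show ?thesis using yP x by (simp add: inv_def)
          qed
        qed
      next
        case (B1 L d)
        show ?thesis
        proof (cases "L < n")
          case False
          then show ?thesis using B1 b(1) Ey step.IH
            by (cases x; cases y) (auto simp: E_def inv_def split: if_splits)
        next
          case L: True
          have x: "x = PA L \<or> x = A1 L d \<or> x = A2 L d \<or> (\<exists>M e. x = A1 M e \<and> n \<le> M)"
            and d: "d \<in> D"
            using B1 L b(1) by (cases x; auto simp: E_def split: if_splits)+
          have "y = PA L \<or> y = A1 L d \<or> y = A2 L d"
          proof (rule ccontr)
            assume "\<not> ?thesis"
            then obtain M e where "y = A1 M e" "n \<le> M" "M < 2 * n" "e \<in> D"
              using B1 L Ey by (cases y) (auto simp: E_def split: if_splits)
            then show False using conflict[of M e L d] yR b(4) B1 L by auto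
          qed
          \<comment> \<open>An edge between incompatible items starts in the second copy, where all
            layers of the first copy have been passed, so going back is harmless by
            monotonicity.\<close>
          moreover have "OK (Suc L)" if "x \<noteq> PA L"
            using x that step.IH L OK_mono by (auto simp: inv_def)
          moreover have "OK (Suc L)" if xP: "x = PA L"
          proof -
            have "(PA L, QB L) \<in> X" using stage xR xP L by auto
            then have "vote (ka x) (Some b) (pa X x) = -1"
              using vote_a_better(2)[OF mt, of x "QB L" b] xP B1 L d by auto
            then have "vote (kb b) (Some x) (pb X b) = 1" using wt0 by (simp add: wt_def)
            then have "op L d" using B1 xP L d by (simp add: op_def)
            then show ?thesis using OK_Suc step.IH xP by (simp add: inv_def)
          qed
          ultimately have "OK (Suc L)" and "y = PA L \<or> y = A1 L d \<or> y = A2 L d" by blast+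
          then show ?thesis using OK_mono[of "Suc L" L] L by (auto simp: inv_def)
        qed
      qed
    qed
  qed
  have "OK (2 * n)" using inv[OF endR] by (simp add: inv_def)
  then obtain ch where ch: "\<And>L. L < 2 * n \<Longrightarrow> op L (ch L)" unfolding OK_def by metis
  have "\<not> C L (ch L) t (ch (n + t))" if "L < n" "t < n" for L t
  proof
    assume C: "C L (ch L) t (ch (n + t))"
    let ?a = "A1 (n + t) (ch (n + t))" and ?b = "B1 L (ch L)"
    have 1: "ch L \<in> D" "vote (kb ?b) (Some (PA L)) (pb X ?b) = 1"
      using ch[of L] that by (auto simp: op_def)
    have 2: "ch (n + t) \<in> D" "?a \<in> R" "vote (ka ?a) (Some (QB (Suc (n + t)))) (pa X ?a) = 1"
      using ch[of "n + t"] that by (auto simp: op_def)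
    have adj: "adj n D C ?a ?b = Some (1, 1)" using C 1 2 that by simp
    have "vote (kb ?b) (Some ?a) (pb X ?b) = 1"
      by (rule vote_better[OF kb_class[OF adj] 1(2)]) (use that 1 in auto)
    moreover have "vote (ka ?a) (Some ?b) (pa X ?a) = 1"
      by (rule vote_better[OF ka_class[OF adj] 2(3)]) (use that 2 in auto)
    ultimately show False using noblock[OF 2(2), of ?b] adj by (simp add: wt_def E_def)
  qed
  then show ?thesis
    using ch unfolding op_def by (intro exI[of _ ch] exI[of _ "\<lambda>t. ch (n + t)"]) auto
qed

lemma popular_of_choice:
  assumes D: "\<And>t. t < n \<Longrightarrow> ch t \<in> D \<and> ch' t \<in> D"
    and C: "\<And>t t'. t < n \<Longrightarrow> t' < n \<Longrightarrow> \<not> C t (ch t) t' (ch' t')"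
  shows "\<exists>X Y. pop X \<and> E (KA True) (KB True) \<and> wt X (KA True) (KB True) = 2 \<and> mt Y \<and>
    card Y > card X \<and> score Y X \<ge> 0"
proof -
  define c where "c L = (if L < n then ch L else ch' (L - n))" for L
  have cD: "c L \<in> D" if "L < 2 * n" for L
    using D[of L] D[of "L - n"] that by (auto simp: c_def)
  \<comment> \<open>Exactly the chosen items are open: their \<open>A1\<close> is matched to
    \<open>B1\<close> in the first copy and to \<open>B2\<close> in the second one.\<close>
  define q where "q L d = (if L < n then d = c L else d \<noteq> c L)" for L d
  let ?X = "base q Not"
  have inj: "inj Not" by (auto simp: inj_def)
  note mt = mt_base[OF inj, of q]
  \<comment> \<open>The witness is nonzero only in the component. The value 1 at both ends of the
    blocking edge pays for its weight 2, and their partners get -1.\<close>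
  define f :: "'d anode \<Rightarrow> int" where "f a = (case a of KA i \<Rightarrow> if i then 1 else -1 | _ \<Rightarrow> 0)" for a
  define h :: "'d bnode \<Rightarrow> int" where "h b = (case b of KB i \<Rightarrow> if i then 1 else -1 | _ \<Rightarrow> 0)" for b
  have K: "(KA i, KB (\<not> i)) \<in> ?X" for i by (simp add: base_simps)
  have K': "(KA (\<not> i), KB i) \<in> ?X" for i by (simp add: base_simps)
  have wtK: "wt ?X (KA i) (KB j) \<le> (if i then 1 else -1) + (if j then 1 else -1)" for i j
  proof -
    have "wt ?X (KA False) (KB False) = -2"
      using vote_a_better(2)[OF mt K[of False], of "KB False"] vote_b_better(2)[OF mt K'[of False], of "KA False"]
      by (simp add: wt_def)
    moreover have "wt ?X (KA True) (KB True) \<le> 2"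
      using wt_cases[OF mt, of "KA True" "KB True"] by (auto simp: E_def)
    moreover have "wt ?X (KA i) (KB (\<not> i)) = 0" for i using wt_in[OF mt K] .
    ultimately show ?thesis by (cases i; cases j) (use \<open>\<And>i. wt ?X (KA i) (KB (\<not> i)) = 0\<close>[of i] in auto)
  qed
  have pop: "pop ?X"
  proof (rule pop_certificate[OF mt, where f = f and h = h])
    fix a b assume E: "E a b"
    show "wt ?X a b \<le> f a + h b"
    proof (cases "\<exists>i. a = KA i")
      case True
      then obtain i j where "a = KA i" "b = KB j" using E by (cases b) (auto simp: E_def)
      then show ?thesis using wtK[of i j] by (simp add: f_def h_def)
    next
      case False
      have "wt ?X a b \<le> 0"
      proof (rule wt_base_le[OF inj E])
        fix L d t d' assume "L < n" "t < n" "C L d t d'" "q L d"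
        then show "q (n + t) d'" using C[of L t] by (auto simp: q_def c_def)
      qed (use False in blast)
      moreover have "f a = 0" "h b = 0"
        using False E by (cases a; cases b; simp add: f_def h_def E_def)+
      ultimately show ?thesis by simp
    qed
  next
    fix a assume "a \<notin> Domain ?X"
    then show "f a = 0" using K by (cases a) (auto simp: f_def)
  next
    fix b assume "b \<notin> Range ?X"
    then show "h b = 0" using K' by (cases b) (auto simp: h_def)
  next
    fix a b assume "(a, b) \<in> ?X"
    then show "f a + h b = 0" by (cases a) (auto simp: f_def h_def base_simps split: if_splits)
  qed (auto simp: f_def h_def split: anode.split bnode.split)
  have block: "wt ?X (KA True) (KB True) = 2"
    using vote_a_better(1)[OF mt K[of True], of "KB True"] vote_b_better(1)[OF mt K'[of True], of "KA True"]
    by (simp add: wt_def)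
  \<comment> \<open>\<open>S\<close> consists of the nodes in \<open>A\<close> on the augmenting
    path, and \<open>g\<close> maps each of them to the next node, so the patch switches the whole
    path.\<close>
  define S where "S = {SA} \<union> PA ` {..2 * n} \<union> (\<lambda>L. A1 L (c L)) ` {..<2 * n}"
  define g where "g a = (case a of SA \<Rightarrow> QB 0
      | PA L \<Rightarrow> if L < n then B1 L (c L) else if L < 2 * n then B2 L (c L) else TB
      | A1 L d \<Rightarrow> QB (Suc L) | A2 L d \<Rightarrow> TB | KA i \<Rightarrow> TB)" for a :: "'d anode"
  have finS: "finite S" by (simp add: S_def)
  have injg: "inj_on g S"
    by (rule inj_onI) (auto simp: S_def g_def split: if_splits)
  have Eg: "E a (g a)" if "a \<in> S" for a
    using that cD by (auto simp: S_def g_def E_def)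
  have w: "wt ?X a (g a) \<ge> 0" if a: "a \<in> S" for a
  proof -
    have ge: "wt ?X a (g a) \<ge> 0"
      if "vote (ka a) (Some (g a)) (pa ?X a) = 1 \<or> vote (kb (g a)) (Some a) (pb ?X (g a)) = 1"
      using that vote_cases[of "ka a" "Some (g a)" "pa ?X a"] vote_cases[of "kb (g a)" "Some a" "pb ?X (g a)"]
      by (auto simp: wt_def)
    consider "a = SA" | L where "a = PA L" "L < n" | L where "a = PA L" "n \<le> L" "L < 2 * n" | "a = PA (2 * n)"
      | L where "a = A1 L (c L)" "L < 2 * n"
      using a unfolding S_def by (auto simp: le_less) (metis less_linear)
    then show ?thesis
    proof cases
      case 1
      then have "a \<notin> Domain ?X" by (auto simp: base_simps)
      then show ?thesis using pa_None by (intro ge) auto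
    next
      case (2 L)
      then have "(A1 L (c L), B1 L (c L)) \<in> ?X" using cD by (auto simp: base_simps q_def)
      from vote_b_better(1)[OF mt this, of a] show ?thesis using 2 cD by (intro ge) (auto simp: g_def)
    next
      case (3 L)
      then have "(A1 L (c L), B2 L (c L)) \<in> ?X" using cD by (auto simp: base_simps q_def)
      from vote_b_better(1)[OF mt this, of a] show ?thesis using 3 cD by (intro ge) (auto simp: g_def)
    next
      case 4
      have "TB \<notin> Range ?X"
      proof
        assume "TB \<in> Range ?X"
        then obtain a' where "(a', TB) \<in> ?X" by auto
        then show False by (cases a') (auto simp: base_simps split: if_splits)
      qed
      then show ?thesis using pb_None 4 by (intro ge) (auto simp: g_def)
    next
      case (5 L)
      then have "(A1 L (c L), if L < n then B1 L (c L) else B2 L (c L)) \<in> ?X"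
        using cD by (auto simp: base_simps q_def)
      from vote_a_better(1)[OF mt this, of "QB (Suc L)"] show ?thesis
        using 5 cD by (intro ge; cases "L < n"; simp add: g_def)
    qed
  qed
  have img: "QB L \<in> g ` S" if "L \<le> 2 * n" for L
  proof (cases L)
    case 0
    then show ?thesis by (intro image_eqI[of _ _ SA]) (auto simp: g_def S_def)
  next
    case (Suc M)
    then show ?thesis using that by (intro image_eqI[of _ _ "A1 M (c M)"]) (auto simp: g_def S_def)
  qed
  have img': "L < n \<Longrightarrow> B1 L (c L) \<in> g ` S" "n \<le> L \<Longrightarrow> L < 2 * n \<Longrightarrow> B2 L (c L) \<in> g ` S" for L
    by (intro image_eqI[of _ _ "PA L"]; simp add: g_def S_def)+
  \<comment> \<open>A matching edge that meets the path has both ends on it, so nobody loses a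
    partner.\<close>
  have "{e \<in> ?X. fst e \<in> S \<and> snd e \<notin> g ` S} = {}"
  proof -
    have False if "(a, b) \<in> ?X" "a \<in> S" "b \<notin> g ` S" for a b
      using that img img' by (cases a) (auto simp: base_simps S_def q_def not_less split: if_splits)
    then show ?thesis by auto
  qed
  moreover have "{e \<in> ?X. fst e \<notin> S \<and> snd e \<in> g ` S} = {}"
  proof -
    have False if "(a, b) \<in> ?X" "a \<notin> S" "b \<in> g ` S" for a b
      using that by (cases a) (auto simp: base_simps S_def g_def q_def image_iff split: if_splits)
    then show ?thesis by auto
  qed
  ultimately have "score (patch S g ?X) ?X = (\<Sum>a\<in>S. wt ?X a (g a))"
    using score_patch[OF mt finS injg Eg] by (simp only: card.empty of_nat_0 diff_zero)
  also have "\<dots> \<ge> 0" by (rule sum_nonneg) (rule w)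
  finally have score: "score (patch S g ?X) ?X \<ge> 0" .
  have fin: "finite ?X" using mt_finite[OF mt] .
  have "card ?X = card {e \<in> ?X. fst e \<in> S} + card {e \<in> ?X. fst e \<notin> S}"
    using fin by (subst card_Un_disjoint[symmetric]) (auto intro: arg_cong[where f = card])
  also have "card {e \<in> ?X. fst e \<in> S} \<le> card (S - {SA})"
    using finS inj_on_subset[OF inj_on_fst_mt[OF mt]] base_simps(1)
    by (intro card_inj_on_le[of fst]) auto
  \<comment> \<open>The strict step: \<open>SA\<close> belongs to \<open>S\<close> but is unmatched
    before the exchange.\<close>
  also have "\<dots> < card S" using finS by (intro psubset_card_mono) (auto simp: S_def)
  also have "{e \<in> ?X. fst e \<notin> S} = {e \<in> ?X. fst e \<notin> S \<and> snd e \<notin> g ` S}"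
    using \<open>{e \<in> ?X. fst e \<notin> S \<and> snd e \<in> g ` S} = {}\<close> by blast
  also have "card S = card ((\<lambda>a. (a, g a)) ` S)" by (rule card_image[symmetric]) (auto simp: inj_on_def)
  also have "\<dots> + card {e \<in> ?X. fst e \<notin> S \<and> snd e \<notin> g ` S} = card (patch S g ?X)"
    unfolding patch_def using fin finS by (intro card_Un_disjoint[symmetric]) auto
  finally have "card ?X < card (patch S g ?X)" by simp
  then show ?thesis
    using pop block mt_patch[OF mt finS injg Eg] score
    by (intro exI[of _ ?X] exI[of _ "patch S g ?X"]) (auto simp: E_def)
qed

end

locale layered_link = layered n D C ka kb + pref_link "layered.E n D C" ka kb G na nb
  for n and D :: "'d set" and C ka kb and G :: "'v pref_graph" and na :: "'d anode \<Rightarrow> 'v" and nb :: "'d bnode \<Rightarrow> 'v"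
begin

theorem popular_neither_iff_choice:
  "(\<exists>M. popular G M \<and> \<not> stable G M \<and> \<not> dominant G M) \<longleftrightarrow>
   (\<exists>ch ch'. (\<forall>t<n. ch t \<in> D \<and> ch' t \<in> D) \<and> (\<forall>t<n. \<forall>t'<n. \<not> C t (ch t) t' (ch' t')))"
proof
  assume "\<exists>M. popular G M \<and> \<not> stable G M \<and> \<not> dominant G M"
  then show "\<exists>ch ch'. (\<forall>t<n. ch t \<in> D \<and> ch' t \<in> D) \<and> (\<forall>t<n. \<forall>t'<n. \<not> C t (ch t) t' (ch' t'))"
    using popular_not_dominant choice_of_popular by blast
next
  assume "\<exists>ch ch'. (\<forall>t<n. ch t \<in> D \<and> ch' t \<in> D) \<and> (\<forall>t<n. \<forall>t'<n. \<not> C t (ch t) t' (ch' t'))"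
  then obtain X Y where XY: "pop X" "E (KA True) (KB True)" "wt X (KA True) (KB True) = 2"
    "mt Y" "card Y > card X" "score Y X \<ge> 0"
    using popular_of_choice by blast
  then have "mt X" by (simp add: pop_def)
  then show "\<exists>M. popular G M \<and> \<not> stable G M \<and> \<not> dominant G M"
    using XY popular_mk not_stable_mk not_dominant_mk by (intro exI[of _ "mk X"]) blast
qed

end


section \<open>A command language\<close>


datatype cmd =
    Skip
  | Emit bool
  | App nat bool
  | Clear nat
  | Seq cmd cmd
  | Cond nat nat bool "nat set" cmd cmd
  | While nat nat bool "nat set" cmd

text \<open>The last argument is an upper bound for the number of steps of the Turing machine.\<close>

inductive big_step :: "cmd \<Rightarrow> store \<Rightarrow> bool list \<Rightarrow> store \<Rightarrow> nat \<Rightarrow> bool" where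
  big_step_Skip: "big_step Skip \<sigma> [] \<sigma> t"
| big_step_Emit: "1 \<le> t \<Longrightarrow> big_step (Emit b) \<sigma> [b] \<sigma> t"
| big_step_App: "3 * length (\<sigma> r) + 10 \<le> t \<Longrightarrow> big_step (App r b) \<sigma> [] (\<sigma>(r := \<sigma> r @ [b])) t"
| big_step_Clear: "3 * length (\<sigma> r) + 10 \<le> t \<Longrightarrow> big_step (Clear r) \<sigma> [] (\<sigma>(r := [])) t"
| big_step_Seq: "big_step c \<sigma> o1 \<sigma>1 t1 \<Longrightarrow> big_step d \<sigma>1 o2 \<sigma>2 t2 \<Longrightarrow> t1 + t2 \<le> t \<Longrightarrow> big_step (Seq c d) \<sigma> (o1 @ o2) \<sigma>2 t"
| big_step_CondT: "test r s b A \<sigma> \<Longrightarrow> big_step c \<sigma> o1 \<sigma>1 t1 \<Longrightarrow> t1 + 3 * length (\<sigma> r) + 12 \<le> t \<Longrightarrow>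
    big_step (Cond r s b A c d) \<sigma> o1 \<sigma>1 t"
| big_step_CondF: "\<not> test r s b A \<sigma> \<Longrightarrow> big_step d \<sigma> o1 \<sigma>1 t1 \<Longrightarrow> t1 + 3 * length (\<sigma> r) + 12 \<le> t \<Longrightarrow>
    big_step (Cond r s b A c d) \<sigma> o1 \<sigma>1 t"
| big_step_WhileF: "\<not> test r s b A \<sigma> \<Longrightarrow> 3 * length (\<sigma> r) + 12 \<le> t \<Longrightarrow> big_step (While r s b A c) \<sigma> [] \<sigma> t"
| big_step_WhileT: "test r s b A \<sigma> \<Longrightarrow> big_step c \<sigma> o1 \<sigma>1 t1 \<Longrightarrow> big_step (While r s b A c) \<sigma>1 o2 \<sigma>2 t2 \<Longrightarrow>
    t1 + t2 + 3 * length (\<sigma> r) + 12 \<le> t \<Longrightarrow> big_step (While r s b A c) \<sigma> (o1 @ o2) \<sigma>2 t"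

lemma big_step_mono: "big_step c \<sigma> o1 \<sigma>' t \<Longrightarrow> t \<le> t' \<Longrightarrow> big_step c \<sigma> o1 \<sigma>' t'"
  by (erule big_step.cases) (auto intro: big_step.intros order_trans)

fun code_size :: "cmd \<Rightarrow> nat" where
  "code_size Skip = 0"
| "code_size (Seq c d) = code_size c + code_size d"
| "code_size (Cond r s b A c d) = code_size d + code_size c + 2"
| "code_size (While r s b A c) = code_size c + 3"
| "code_size _ = 1"

text \<open>A test jumps if it holds. So the else branch comes directly behind it, and in a loop the
  instruction behind the test is the exit.\<close>

fun compile :: "cmd \<Rightarrow> nat \<Rightarrow> instr list" where
  "compile Skip i = []"
| "compile (Emit b) i = [IEmit b]"
| "compile (App r b) i = [IApp r b]"
| "compile (Clear r) i = [IClear r]"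
| "compile (Seq c d) i = compile c i @ compile d (i + code_size c)"
| "compile (Cond r s b A c d) i =
     ITest r s b A (i + code_size d + 2) # compile d (i + 1) @
     IJmp (i + code_size d + code_size c + 2) # compile c (i + code_size d + 2)"
| "compile (While r s b A c) i =
     ITest r s b A (i + 2) # IJmp (i + code_size c + 3) # compile c (i + 2) @ [IJmp i]"

lemma length_compile [simp]: "length (compile c i) = code_size c"
  by (induction c i rule: compile.induct) auto

fun regs_below :: "nat \<Rightarrow> cmd \<Rightarrow> bool" where
  "regs_below K (App r b) \<longleftrightarrow> r < K"
| "regs_below K (Clear r) \<longleftrightarrow> r < K"
| "regs_below K (Seq c d) \<longleftrightarrow> regs_below K c \<and> regs_below K d"
| "regs_below K (Cond r s b A c d) \<longleftrightarrow> r < K \<and> s < K \<and> regs_below K c \<and> regs_below K d"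
| "regs_below K (While r s b A c) \<longleftrightarrow> r < K \<and> s < K \<and> regs_below K c"
| "regs_below K _ \<longleftrightarrow> True"

fun tests_ok :: "cmd \<Rightarrow> bool" where
  "tests_ok (Seq c d) \<longleftrightarrow> tests_ok c \<and> tests_ok d"
| "tests_ok (Cond r s b A c d) \<longleftrightarrow> r \<noteq> s \<and> tests_ok c \<and> tests_ok d"
| "tests_ok (While r s b A c) \<longleftrightarrow> r \<noteq> s \<and> tests_ok c"
| "tests_ok _ \<longleftrightarrow> True"

lemma regs_below_mono: "regs_below K c \<Longrightarrow> K \<le> K' \<Longrightarrow> regs_below K' c"
  by (induction c) auto

lemma ex_regs_below: "\<exists>K. regs_below K c"
proof (induction c)
  case (App r b) then show ?case by (auto intro: exI[of _ "Suc r"])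
next
  case (Clear r) then show ?case by (auto intro: exI[of _ "Suc r"])
next
  case (Seq c d)
  then obtain K K' where "regs_below K c" "regs_below K' d" by auto
  then show ?case by (intro exI[of _ "K + K'"]) (auto elim: regs_below_mono)
next
  case (Cond r s b A c d)
  then obtain K K' where "regs_below K c" "regs_below K' d" by auto
  then show ?case by (intro exI[of _ "K + K' + Suc r + Suc s"]) (auto elim: regs_below_mono)
next
  case (While r s b A c)
  then obtain K where "regs_below K c" by auto
  then show ?case by (intro exI[of _ "K + Suc r + Suc s"]) (auto elim: regs_below_mono)
qed auto

definition code_at :: "instr list \<Rightarrow> nat \<Rightarrow> instr list \<Rightarrow> bool" where
  "code_at P i xs \<longleftrightarrow> (\<exists>ys zs. P = ys @ xs @ zs \<and> length ys = i)"

lemma code_at_append: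
  "code_at P i (xs @ ys) \<Longrightarrow> code_at P i xs \<and> code_at P (i + length xs) ys"
proof -
  assume "code_at P i (xs @ ys)"
  then obtain us zs where "P = us @ (xs @ ys) @ zs" "length us = i" by (auto simp: code_at_def)
  then show ?thesis
    unfolding code_at_def
    by (intro conjI exI[of _ us] exI[of _ "ys @ zs"] exI[of _ "us @ xs"] exI[of _ zs]) simp_all
qed

lemma code_at_Cons:
  "code_at P i (x # xs) \<Longrightarrow> i < length P \<and> P ! i = x \<and> code_at P (Suc i) xs"
proof -
  assume "code_at P i (x # xs)"
  then obtain ys zs where P: "P = ys @ x # xs @ zs" "length ys = i" by (auto simp: code_at_def)
  then have "P = (ys @ [x]) @ xs @ zs" "length (ys @ [x]) = Suc i" by simp_all
  then have "code_at P (Suc i) xs" unfolding code_at_def by blast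
  then show ?thesis using P by (auto simp: nth_append)
qed

lemma code_at_length: "code_at P i xs \<Longrightarrow> i + length xs \<le> length P"
  by (auto simp: code_at_def)

theorem compile_correct:
  assumes "big_step c \<sigma> o1 \<sigma>' t" "code_at P i (compile c i)" "regs_below K c" "tests_ok c"
  shows "reach (tm_of P K) t (rcfg K i 0 \<sigma> (\<lambda>_. 0) out)
           (rcfg K (i + code_size c) 0 \<sigma>' (\<lambda>_. 0) (out @ o1))"
  using assms
proof (induction arbitrary: i out rule: big_step.induct)
  case (big_step_Skip \<sigma> t)
  then show ?case by (auto intro: reach_mono[OF reach_refl])
next
  case (big_step_Emit t b \<sigma>)
  then show ?case
    using exec_IEmit[of i P b K \<sigma> out] by (auto dest!: code_at_Cons elim!: reach_mono)
next
  case (big_step_App \<sigma> r t b)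
  then show ?case
    using exec_IApp[of i P r b K \<sigma> out] by (auto dest!: code_at_Cons elim!: reach_mono)
next
  case (big_step_Clear \<sigma> r t)
  then show ?case
    using exec_IClear[of i P r K \<sigma> out] by (auto dest!: code_at_Cons elim!: reach_mono)
next
  case (big_step_Seq c \<sigma> o1 \<sigma>1 t1 d o2 \<sigma>2 t2 t)
  from big_step_Seq.prems have "code_at P i (compile c i)" "code_at P (i + code_size c) (compile d (i + code_size c))"
    by (auto dest!: code_at_append)
  with reach_mono[OF reach_trans[OF big_step_Seq.IH(1)[of i out] big_step_Seq.IH(2)[of "i + code_size c" "out @ o1"]]]
    big_step_Seq.prems big_step_Seq.hyps
  show ?case by (simp add: add.assoc)
next
  case (big_step_CondT r s b A \<sigma> c o1 \<sigma>1 t1 t d)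
  let ?j = "i + code_size d + 2"
  from code_at_length[OF big_step_CondT.prems(1)] have j: "?j \<le> length P" by simp
  from big_step_CondT.prems(1) have 1: "i < length P" "P ! i = ITest r s b A ?j" "code_at P ?j (compile c ?j)"
    by (auto dest!: code_at_Cons code_at_append simp: add.assoc)
  from exec_ITest[OF 1(1,2) _ _ _ j, of K \<sigma> out] big_step_CondT.hyps(1) big_step_CondT.prems
  have 2: "reach (tm_of P K) (3 * length (\<sigma> r) + 10) (rcfg K i 0 \<sigma> (\<lambda>_. 0) out) (rcfg K ?j 0 \<sigma> (\<lambda>_. 0) out)"
    by simp
  have 3: "reach (tm_of P K) t1 (rcfg K ?j 0 \<sigma> (\<lambda>_. 0) out)
      (rcfg K (?j + code_size c) 0 \<sigma>1 (\<lambda>_. 0) (out @ o1))"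
    using big_step_CondT.IH[OF 1(3)] big_step_CondT.prems by simp
  have e: "?j + code_size c = i + code_size (Cond r s b A c d)" by simp
  show ?case
    using reach_mono[OF reach_trans[OF 2 3]] big_step_CondT.hyps unfolding e by simp
next
  case (big_step_CondF r s b A \<sigma> d o1 \<sigma>1 t1 t c)
  let ?j = "i + code_size d + 2" and ?k = "i + 1 + code_size d"
  from code_at_length[OF big_step_CondF.prems(1)] have j: "?j \<le> length P" by simp
  from big_step_CondF.prems(1) have 1: "i < length P" "P ! i = ITest r s b A ?j"
    "code_at P (i + 1) (compile d (i + 1))" "?k < length P" "P ! ?k = IJmp (i + code_size d + code_size c + 2)"
    by (auto dest!: code_at_Cons code_at_append simp: add.assoc)
  from exec_ITest[OF 1(1,2) _ _ _ j, of K \<sigma> out] big_step_CondF.hyps(1) big_step_CondF.prems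
  have 2: "reach (tm_of P K) (3 * length (\<sigma> r) + 10) (rcfg K i 0 \<sigma> (\<lambda>_. 0) out) (rcfg K (i + 1) 0 \<sigma> (\<lambda>_. 0) out)"
    by simp
  have 3: "reach (tm_of P K) 1 (rcfg K ?k 0 \<sigma>1 (\<lambda>_. 0) (out @ o1))
      (rcfg K (i + code_size d + code_size c + 2) 0 \<sigma>1 (\<lambda>_. 0) (out @ o1))"
    by (rule exec_IJmp[OF 1(4,5)]) (use code_at_length[OF big_step_CondF.prems(1)] in simp)
  show ?case
    using reach_mono[OF reach_trans[OF 2 reach_trans[OF big_step_CondF.IH[OF 1(3)] 3]], of t] big_step_CondF.hyps big_step_CondF.prems
    by (simp add: ac_simps)
next
  case (big_step_WhileF r s b A \<sigma> t c)
  let ?e = "i + code_size c + 3"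
  from code_at_length[OF big_step_WhileF.prems(1)] have j: "i + 2 \<le> length P" "?e \<le> length P" by simp_all
  from big_step_WhileF.prems(1) have 1: "i < length P" "P ! i = ITest r s b A (i + 2)"
    "i + 1 < length P" "P ! (i + 1) = IJmp ?e"
    by (auto dest!: code_at_Cons)
  from exec_ITest[OF 1(1,2) _ _ _ j(1), of K \<sigma> out] big_step_WhileF.hyps(1) big_step_WhileF.prems
  have 2: "reach (tm_of P K) (3 * length (\<sigma> r) + 10) (rcfg K i 0 \<sigma> (\<lambda>_. 0) out) (rcfg K (i + 1) 0 \<sigma> (\<lambda>_. 0) out)"
    by simp
  show ?case
    using reach_mono[OF reach_trans[OF 2 exec_IJmp[OF 1(3,4) j(2)]], of t] big_step_WhileF.hyps
    by (simp add: ac_simps)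
next
  case (big_step_WhileT r s b A \<sigma> c o1 \<sigma>1 t1 o2 \<sigma>2 t2 t)
  let ?e = "i + 2 + code_size c"
  from code_at_length[OF big_step_WhileT.prems(1)] have j: "i + 2 \<le> length P" "i \<le> length P" by simp_all
  from big_step_WhileT.prems(1) have 1: "i < length P" "P ! i = ITest r s b A (i + 2)"
    "code_at P (i + 2) (compile c (i + 2))" "?e < length P" "P ! ?e = IJmp i"
    by (auto dest!: code_at_Cons code_at_append)
  from exec_ITest[OF 1(1,2) _ _ _ j(1), of K \<sigma> out] big_step_WhileT.hyps(1) big_step_WhileT.prems
  have 2: "reach (tm_of P K) (3 * length (\<sigma> r) + 10) (rcfg K i 0 \<sigma> (\<lambda>_. 0) out) (rcfg K (i + 2) 0 \<sigma> (\<lambda>_. 0) out)"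
    by simp
  note 3 = exec_IJmp[OF 1(4,5) j(2), of K \<sigma>1 "out @ o1"]
  show ?case
    using reach_mono[OF reach_trans[OF 2 reach_trans[OF big_step_WhileT.IH(1)[OF 1(3)]
      reach_trans[OF 3 big_step_WhileT.IH(2)[OF big_step_WhileT.prems(1)]]]], of t] big_step_WhileT.hyps big_step_WhileT.prems
    by (simp add: ac_simps)
qed

theorem polytime_computable_big_step:
  assumes "\<And>x. \<exists>\<sigma>'. big_step c ((\<lambda>_. [])(0 := x)) (f x) \<sigma>' (poly p (length x))" "tests_ok c"
  shows "polytime_computable f"
proof -
  obtain K' where "regs_below K' c" using ex_regs_below by auto
  then have K: "regs_below (Suc K') c" by (auto elim: regs_below_mono)
  let ?K = "Suc K'" and ?P = "compile c 0"
  let ?M = "tm_of ?P ?K"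
  have at: "code_at ?P 0 ?P" unfolding code_at_def by (intro exI[of _ "[]"]) simp
  \<comment> \<open>The two additional steps leave the start state and enter the halting
    state.\<close>
  have "computes_within ?M x (f x) (poly (p + [:2:]) (length x))" for x
  proof -
    let ?\<sigma> = "(\<lambda>_. [])(0 := x)"
    obtain \<sigma>' where big_step: "big_step c ?\<sigma> (f x) \<sigma>' (poly p (length x))" using assms(1) by blast
    have init: "tm_init ?M x = (0, map (\<lambda>r. (word_tape (?\<sigma> r), 0)) [0..<?K] @ [(word_tape [], 0)])"
      unfolding tm_init_def
      by (simp add: tm_of_def replicate_append_same map_replicate_const upt_conv_Cons map_Suc_upt[symmetric] comp_def
        del: upt_Suc map_Suc_upt)
    let ?ss = "map (\<lambda>(t, h). t h) (map (\<lambda>r. (word_tape (?\<sigma> r), 0::nat)) [0..<?K] @ [(word_tape [], 0)])"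
    have ss: "?ss ! r = word_tape (?\<sigma> r) 0" if "r < ?K" for r
      using that by (simp add: nth_append del: upt_Suc)
    have ssK: "?ss ! ?K = word_tape [] 0"
      by (simp add: nth_append del: upt_Suc)
    have d: "delta ?M 0 ?ss = (st 0 0, map (\<lambda>r. (word_tape (?\<sigma> r) 0, Stay)) [0..<?K] @ [(word_tape [] 0, Go_Right)])"
      using ss ssK by (simp add: tm_of_def tm_delta_def stay_def del: upt_Suc)
    have "tm_step ?M (tm_init ?M x) = rcfg ?K 0 0 ?\<sigma> (\<lambda>_. 0) []"
      unfolding init tm_step_def fst_conv snd_conv d Let_def prod.case map2_act_snoc
      by (simp add: cfg_def act_def del: upt_Suc)
    moreover have "tm_step ?M (rcfg ?K (code_size c) 0 \<sigma>' (\<lambda>_. 0) (f x)) =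
        cfg ?K 1 (\<lambda>r. word_tape (\<sigma>' r)) (\<lambda>_. 0) (f x)"
      by (subst tm_step_cfg[where pc = "code_size c" and ph = 0])
        (auto simp: action_of_def stay_def intro!: cfg_cong)
    ultimately have "reach ?M (poly p (length x) + 2) (tm_init ?M x)
        (cfg ?K 1 (\<lambda>r. word_tape (\<sigma>' r)) (\<lambda>_. 0) (f x))"
      using reach_mono[OF reach_step'[OF _ reach_trans[OF compile_correct[OF big_step at K assms(2), of "[]"] reach_step]],
          of "tm_init ?M x"]
      by simp
    then obtain t where "t \<le> poly p (length x) + 2"
      "(tm_step ?M ^^ t) (tm_init ?M x) = cfg ?K 1 (\<lambda>r. word_tape (\<sigma>' r)) (\<lambda>_. 0) (f x)"
      by (auto simp: reach_def)
    moreover have "has_output (cfg ?K 1 (\<lambda>r. word_tape (\<sigma>' r)) (\<lambda>_. 0) (f x)) (f x)"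
      by (simp add: has_output_def cfg_def word_tape_def)
    ultimately show ?thesis
      unfolding computes_within_def by (intro exI[of _ t]) (simp add: cfg_def)
  qed
  then show ?thesis
    unfolding polytime_computable_def using wf_tm_of by blast
qed


section \<open>Counting loops and conditions\<close>

abbreviation unary :: "nat \<Rightarrow> bool list" where "unary n \<equiv> replicate n True"

abbreviation nonblank :: "nat set" where "nonblank \<equiv> {2, 3}"

definition For :: "nat \<Rightarrow> nat \<Rightarrow> cmd \<Rightarrow> cmd" where
  "For i r c = Seq (While i r False nonblank (Seq c (App i True))) (Clear i)"

lemma test_less: "test r s False nonblank \<sigma> \<longleftrightarrow> length (\<sigma> r) < length (\<sigma> s)"
  using bit_symbol_range by (auto simp: test_def word_tape_def)

lemma test_Suc_less: "test r s True nonblank \<sigma> \<longleftrightarrow> Suc (length (\<sigma> r)) < length (\<sigma> s)"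
  using bit_symbol_range by (auto simp: test_def word_tape_def)

text \<open>The stores \<open>s v\<close> describe all registers except the counter, which admits
  bodies that accumulate something in another register. A round costs the body,
  \<open>3 * n + 10\<close> for the increment and \<open>3 * n + 12\<close> for the test; one more
  such round pays for the last test and for clearing the counter.\<close>

lemma big_step_For:
  assumes i: "i \<noteq> r" and len: "\<And>v. v \<le> n \<Longrightarrow> length (s v r) = n"
    and body: "\<And>v. v < n \<Longrightarrow> big_step c ((s v)(i := unary v)) (out v) ((s (Suc v))(i := unary v)) t"
  shows "big_step (For i r c) ((s 0)(i := [])) (concat (map out [0..<n])) ((s n)(i := []))
           ((n + 1) * (t + 6 * n + 22))"
proof -
  let ?w = "While i r False nonblank (Seq c (App i True))"
  have loop: "big_step ?w ((s (n - m))(i := unary (n - m))) (concat (map out [n - m..<n])) ((s n)(i := unary n))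
      (m * (t + 6 * n + 22) + 3 * n + 12)" if "m \<le> n" for m
    using that
  proof (induction m)
    case 0
    then show ?case using i len[of n] by (auto intro!: big_step_WhileF simp: test_less)
  next
    case (Suc m)
    let ?v = "n - Suc m"
    let ?\<sigma> = "(s ?v)(i := unary ?v)"
    have v: "?v < n" "n - m = Suc ?v" "?v \<le> n" using Suc.prems by auto
    have "big_step (App i True) ((s (Suc ?v))(i := unary ?v)) []
        (((s (Suc ?v))(i := unary ?v))(i := ((s (Suc ?v))(i := unary ?v)) i @ [True])) (3 * n + 10)"
      by (rule big_step_App) (use v in simp)
    then have "big_step (App i True) ((s (Suc ?v))(i := unary ?v)) [] ((s (Suc ?v))(i := unary (Suc ?v))) (3 * n + 10)"
      by (simp add: replicate_append_same)
    from big_step_Seq[OF body[OF v(1)] this order_refl]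
    have 1: "big_step (Seq c (App i True)) ?\<sigma> (out ?v) ((s (Suc ?v))(i := unary (Suc ?v))) (t + (3 * n + 10))" by simp
    have 2: "test i r False nonblank ?\<sigma>" using i len[OF v(3)] v(1) by (simp add: test_less)
    have IH: "big_step ?w ((s (Suc ?v))(i := unary (Suc ?v))) (concat (map out [Suc ?v..<n])) ((s n)(i := unary n))
        (m * (t + 6 * n + 22) + 3 * n + 12)"
      using Suc.IH[OF Suc_leD[OF Suc.prems]] unfolding v(2) .
    have "big_step ?w ?\<sigma> (out ?v @ concat (map out [Suc ?v..<n])) ((s n)(i := unary n))
      (Suc m * (t + 6 * n + 22) + 3 * n + 12)"
    proof (rule big_step_WhileT[OF 2 1 IH])
      have "length (?\<sigma> i) \<le> n" by simp
      then show "t + (3 * n + 10) + (m * (t + 6 * n + 22) + 3 * n + 12) + 3 * length (?\<sigma> i) + 12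
          \<le> Suc m * (t + 6 * n + 22) + 3 * n + 12"
        unfolding mult_Suc by linarith
    qed
    moreover have "[?v..<n] = ?v # [Suc ?v..<n]" using v by (simp add: upt_conv_Cons)
    ultimately show ?case by (simp only: list.map concat.simps)
  qed
  have "big_step (Clear i) ((s n)(i := unary n)) [] (((s n)(i := unary n))(i := [])) (3 * n + 10)"
    by (rule big_step_Clear) simp
  from big_step_Seq[OF loop[of n] this order_refl] show ?thesis
    unfolding For_def by (auto intro: big_step_mono simp: algebra_simps)
qed

datatype fm = Test nat nat bool "nat set" | Truth | Neg fm | Conj fm fm | Disj fm fm

fun holds :: "store \<Rightarrow> fm \<Rightarrow> bool" where
  "holds \<sigma> (Test r s c A) \<longleftrightarrow> test r s c A \<sigma>"
| "holds \<sigma> Truth \<longleftrightarrow> True"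
| "holds \<sigma> (Neg f) \<longleftrightarrow> \<not> holds \<sigma> f"
| "holds \<sigma> (Conj f g) \<longleftrightarrow> holds \<sigma> f \<and> holds \<sigma> g"
| "holds \<sigma> (Disj f g) \<longleftrightarrow> holds \<sigma> f \<or> holds \<sigma> g"

fun fm_ok :: "fm \<Rightarrow> bool" where
  "fm_ok (Test r s c A) \<longleftrightarrow> r \<noteq> s"
| "fm_ok Truth \<longleftrightarrow> True"
| "fm_ok (Neg f) \<longleftrightarrow> fm_ok f"
| "fm_ok (Conj f g) \<longleftrightarrow> fm_ok f \<and> fm_ok g"
| "fm_ok (Disj f g) \<longleftrightarrow> fm_ok f \<and> fm_ok g"

fun tests :: "fm \<Rightarrow> nat" where
  "tests (Test r s c A) = 1"
| "tests Truth = 0"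
| "tests (Neg f) = tests f"
| "tests (Conj f g) = tests f + tests g"
| "tests (Disj f g) = tests f + tests g"

text \<open>Short-circuit evaluation duplicates the branches in the code. The code is fixed, so this
  costs nothing in the time bound, which is linear in the number of tests.\<close>

fun cond :: "fm \<Rightarrow> cmd \<Rightarrow> cmd \<Rightarrow> cmd" where
  "cond (Test r s b A) c d = Cond r s b A c d"
| "cond Truth c d = c"
| "cond (Neg f) c d = cond f d c"
| "cond (Conj f g) c d = cond f (cond g c d) d"
| "cond (Disj f g) c d = cond f c (cond g c d)"

lemma tests_ok_cond: "fm_ok f \<Longrightarrow> tests_ok c \<Longrightarrow> tests_ok d \<Longrightarrow> tests_ok (cond f c d)"
  by (induction f arbitrary: c d) auto

lemma big_step_cond:
  assumes "\<And>r. length (\<sigma> r) \<le> b" "big_step (if holds \<sigma> f then c else d) \<sigma> out \<sigma>' t"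
  shows "big_step (cond f c d) \<sigma> out \<sigma>' (t + tests f * (3 * b + 12))"
  using assms(2)
proof (induction f arbitrary: c d t)
  case (Test r s x A)
  then show ?case using assms(1)[of r] by (cases "test r s x A \<sigma>") (auto intro: big_step_CondT big_step_CondF)
next
  case (Neg f)
  show ?case using Neg.IH[of d c t] Neg.prems by (auto split: if_splits)
next
  case (Conj f g)
  have "big_step (if holds \<sigma> f then cond g c d else d) \<sigma> out \<sigma>' (t + tests g * (3 * b + 12))"
    using Conj.IH(2)[of c d t] Conj.prems by (auto split: if_splits intro: big_step_mono)
  from Conj.IH(1)[OF this] show ?case by (simp add: algebra_simps)
next
  case (Disj f g)
  have "big_step (if holds \<sigma> f then c else cond g c d) \<sigma> out \<sigma>' (t + tests g * (3 * b + 12))"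
    using Disj.IH(2)[of c d t] Disj.prems by (auto split: if_splits intro: big_step_mono)
  from Disj.IH(1)[OF this] show ?case by (simp add: algebra_simps)
qed auto

text \<open>The command leaves the store unchanged, provided that the registers in \<open>X\<close>, which it uses for
  loops, are empty at the beginning.\<close>

definition emits :: "cmd \<Rightarrow> nat set \<Rightarrow> (store \<Rightarrow> bool list) \<Rightarrow> bool" where
  "emits c X f \<longleftrightarrow> tests_ok c \<and>
     (\<exists>p :: nat poly. \<forall>\<sigma> b. (\<forall>r. length (\<sigma> r) \<le> b) \<longrightarrow> (\<forall>i\<in>X. \<sigma> i = []) \<longrightarrow> big_step c \<sigma> (f \<sigma>) \<sigma> (poly p b))"

lemma emitsI:
  fixes p :: "nat poly"
  assumes "tests_ok c"
    "\<And>\<sigma> b. \<forall>r. length (\<sigma> r) \<le> b \<Longrightarrow> \<forall>i\<in>X. \<sigma> i = [] \<Longrightarrow> big_step c \<sigma> (f \<sigma>) \<sigma> (poly p b)"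
  shows "emits c X f"
  unfolding emits_def using assms by (intro conjI exI[of _ p]) blast+

lemma emits_Skip: "emits Skip {} (\<lambda>_. [])"
  by (auto simp: emits_def intro: big_step_Skip)

lemma emits_Emit: "emits (Emit b) {} (\<lambda>_. [b])"
  by (auto simp: emits_def intro!: big_step_Emit exI[of _ 1])

lemma emits_mono: "emits c X f \<Longrightarrow> X \<subseteq> Y \<Longrightarrow> emits c Y f"
  unfolding emits_def by (meson subsetD)

lemma emits_Seq:
  assumes "emits c X f" "emits d Y g"
  shows "emits (Seq c d) (X \<union> Y) (\<lambda>\<sigma>. f \<sigma> @ g \<sigma>)"
proof -
  from assms obtain p q :: "nat poly" where
    "\<And>\<sigma> b. (\<forall>r. length (\<sigma> r) \<le> b) \<Longrightarrow> (\<forall>i\<in>X. \<sigma> i = []) \<Longrightarrow> big_step c \<sigma> (f \<sigma>) \<sigma> (poly p b)"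
    "\<And>\<sigma> b. (\<forall>r. length (\<sigma> r) \<le> b) \<Longrightarrow> (\<forall>i\<in>Y. \<sigma> i = []) \<Longrightarrow> big_step d \<sigma> (g \<sigma>) \<sigma> (poly q b)"
    unfolding emits_def by blast
  then have "big_step (Seq c d) \<sigma> (f \<sigma> @ g \<sigma>) \<sigma> (poly (p + q) b)"
    if "\<forall>r. length (\<sigma> r) \<le> b" "\<forall>i\<in>X \<union> Y. \<sigma> i = []" for \<sigma> b
    using that by (intro big_step_Seq[where ?\<sigma>1.0 = \<sigma>]) auto
  moreover have "tests_ok (Seq c d)" using assms by (simp add: emits_def)
  ultimately show ?thesis by (intro emitsI[of _ _ _ "p + q"])
qed

lemma emits_cond:
  assumes "emits c X f" "emits d Y g" "fm_ok \<phi>"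
  shows "emits (cond \<phi> c d) (X \<union> Y) (\<lambda>\<sigma>. if holds \<sigma> \<phi> then f \<sigma> else g \<sigma>)"
proof -
  from assms obtain p q :: "nat poly" where
    p: "\<And>\<sigma> b. (\<forall>r. length (\<sigma> r) \<le> b) \<Longrightarrow> (\<forall>i\<in>X. \<sigma> i = []) \<Longrightarrow> big_step c \<sigma> (f \<sigma>) \<sigma> (poly p b)" and
    q: "\<And>\<sigma> b. (\<forall>r. length (\<sigma> r) \<le> b) \<Longrightarrow> (\<forall>i\<in>Y. \<sigma> i = []) \<Longrightarrow> big_step d \<sigma> (g \<sigma>) \<sigma> (poly q b)"
    unfolding emits_def by blast
  let ?p = "p + q + of_nat (tests \<phi>) * [:12, 3:]"
  have "big_step (cond \<phi> c d) \<sigma> (if holds \<sigma> \<phi> then f \<sigma> else g \<sigma>) \<sigma> (poly ?p b)"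
    if b: "\<forall>r. length (\<sigma> r) \<le> b" and X: "\<forall>i\<in>X \<union> Y. \<sigma> i = []" for \<sigma> b
  proof -
    have "big_step (if holds \<sigma> \<phi> then c else d) \<sigma> (if holds \<sigma> \<phi> then f \<sigma> else g \<sigma>) \<sigma> (poly p b + poly q b)"
      using big_step_mono[OF p[OF b]] big_step_mono[OF q[OF b]] X by auto
    from big_step_cond[OF _ this] b show ?thesis by (simp add: algebra_simps)
  qed
  moreover have "tests_ok (cond \<phi> c d)" using assms tests_ok_cond by (simp add: emits_def)
  ultimately show ?thesis by (intro emitsI[of _ _ _ ?p])
qed

lemma emits_For:
  assumes c: "emits c X f" and i: "i \<notin> X" "i \<noteq> r"
  shows "emits (For i r c) (insert i X) (\<lambda>\<sigma>. concat (map (\<lambda>v. f (\<sigma>(i := unary v))) [0..<length (\<sigma> r)]))"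
proof -
  from c obtain p :: "nat poly" where
    p: "\<And>\<sigma> b. (\<forall>r. length (\<sigma> r) \<le> b) \<Longrightarrow> (\<forall>i\<in>X. \<sigma> i = []) \<Longrightarrow> big_step c \<sigma> (f \<sigma>) \<sigma> (poly p b)"
    unfolding emits_def by blast
  let ?p = "[:1, 1:] * (p + [:22, 6:])"
  have "big_step (For i r c) \<sigma> (concat (map (\<lambda>v. f (\<sigma>(i := unary v))) [0..<length (\<sigma> r)])) \<sigma> (poly ?p b)"
    if b: "\<forall>r. length (\<sigma> r) \<le> b" and X: "\<forall>j\<in>insert i X. \<sigma> j = []" for \<sigma> b
  proof -
    let ?n = "length (\<sigma> r)"
    have n: "?n \<le> b" using b by blast
    have main: "big_step (For i r c) (\<sigma>(i := [])) (concat (map (\<lambda>v. f (\<sigma>(i := unary v))) [0..<?n])) (\<sigma>(i := []))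
        ((?n + 1) * (poly p b + 6 * ?n + 22))"
    proof (rule big_step_For[OF i(2), where s = "\<lambda>_. \<sigma>"])
      fix v assume v: "v < ?n"
      have "v \<le> b" using v n by simp
      then show "big_step c (\<sigma>(i := unary v)) (f (\<sigma>(i := unary v))) (\<sigma>(i := unary v)) (poly p b)"
        by (intro p) (use b X i in auto)
    qed simp
    have same: "\<sigma>(i := []) = \<sigma>" using X by auto
    have le: "(?n + 1) * (poly p b + 6 * ?n + 22) \<le> poly ?p b"
      using mult_mono[of "?n + 1" "b + 1" "poly p b + 6 * ?n + 22" "poly p b + 6 * b + 22"] n
      by (simp add: algebra_simps)
    show ?thesis using big_step_mono[OF main le] unfolding same .
  qed
  moreover have "tests_ok (For i r c)" using c i(2) by (simp add: emits_def For_def)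
  ultimately show ?thesis by (intro emitsI[of _ _ _ ?p])
qed

section \<open>Loops over vectors\<close>

lemma concat_concat: "concat (concat xss) = concat (map concat xss)"
  by (induction xss) auto

fun For_vec :: "nat \<Rightarrow> nat list \<Rightarrow> cmd \<Rightarrow> cmd" where
  "For_vec r [] c = c"
| "For_vec r (i # is) c = For i r (For_vec r is c)"

text \<open>The lexicographic order of this list is the order in which the nested loops of
  \<open>For_vec\<close> run, and positions in it become node numbers.\<close>

fun vecs :: "nat \<Rightarrow> nat \<Rightarrow> nat list list" where
  "vecs 0 B = [[]]"
| "vecs (Suc w) B = concat (map (\<lambda>a. map ((#) a) (vecs w B)) [0..<B])"

fun load :: "store \<Rightarrow> nat list \<Rightarrow> nat list \<Rightarrow> store" where
  "load \<sigma> (i # is) (a # as) = load (\<sigma>(i := unary a)) is as"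
| "load \<sigma> _ _ = \<sigma>"

lemma load_other: "r \<notin> set is \<Longrightarrow> load \<sigma> is as r = \<sigma> r"
  by (induction \<sigma> "is" as rule: load.induct) auto

lemma load_same:
  "distinct is \<Longrightarrow> length as = length is \<Longrightarrow> map (\<lambda>r. length (load \<sigma> is as r)) is = as"
  by (induction \<sigma> "is" as rule: load.induct) (auto simp: load_other)

lemma emits_For_vec:
  assumes "emits c X f" "distinct is" "set is \<inter> X = {}" "r \<notin> set is"
  shows "emits (For_vec r is c) (set is \<union> X)
    (\<lambda>\<sigma>. concat (map (\<lambda>v. f (load \<sigma> is v)) (vecs (length is) (length (\<sigma> r)))))"
  using assms(2-)
proof (induction "is")
  case Nil
  then show ?case using assms(1) by simp
next
  case (Cons i "is")
  then have "emits (For_vec r is c) (set is \<union> X)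
    (\<lambda>\<sigma>. concat (map (\<lambda>v. f (load \<sigma> is v)) (vecs (length is) (length (\<sigma> r)))))" by simp
  from emits_For[OF this, of i r] Cons.prems show ?case
    by (simp add: map_concat comp_def concat_concat)
qed

lemma set_vecs: "set (vecs w B) = {v. length v = w \<and> set v \<subseteq> {..<B}}"
proof (induction w)
  case (Suc w)
  show ?case
  proof (intro equalityI subsetI)
    fix v assume "v \<in> {v. length v = Suc w \<and> set v \<subseteq> {..<B}}"
    then obtain a v' where "v = a # v'" "a < B" "length v' = w" "set v' \<subseteq> {..<B}"
      by (cases v) auto
    then show "v \<in> set (vecs (Suc w) B)" using Suc by auto
  qed (use Suc in auto)
qed auto

fun lexless :: "nat list \<Rightarrow> nat list \<Rightarrow> bool" where
  "lexless (x # xs) (y # ys) \<longleftrightarrow> x < y \<or> x = y \<and> lexless xs ys"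
| "lexless _ _ \<longleftrightarrow> False"

lemma lexless_trans: "lexless u v \<Longrightarrow> lexless v w \<Longrightarrow> lexless u w"
proof (induction u v arbitrary: w rule: lexless.induct)
  case (1 x xs y ys)
  then show ?case by (cases w) auto
qed auto

lemma lexless_irrefl: "\<not> lexless u u"
  by (induction u) auto

lemma sorted_concat_map:
  assumes "sorted_wrt R xs" "\<And>x. x \<in> set xs \<Longrightarrow> sorted_wrt Q (f x)"
    "\<And>x y u v. R x y \<Longrightarrow> u \<in> set (f x) \<Longrightarrow> v \<in> set (f y) \<Longrightarrow> Q u v"
  shows "sorted_wrt Q (concat (map f xs))"
  using assms(1,2) by (induction xs) (auto simp: sorted_wrt_append intro: assms(3))

lemma sorted_vecs: "sorted_wrt lexless (vecs w B)"
proof (induction w)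
  case (Suc w)
  show ?case
    unfolding vecs.simps
  proof (rule sorted_concat_map[of "(<)"])
    fix a
    show "sorted_wrt lexless (map ((#) a) (vecs w B))"
      using Suc by (simp add: sorted_wrt_map)
  qed (auto simp: sorted_wrt_less_sum_mono_lowerbound)
qed simp

lemma sorted_wrt_nth_iff:
  assumes "sorted_wrt R xs" "\<And>x. \<not> R x x" "\<And>x y z. R x y \<Longrightarrow> R y z \<Longrightarrow> R x z" "i < length xs" "j < length xs"
  shows "R (xs ! i) (xs ! j) \<longleftrightarrow> i < j"
  using sorted_wrt_nth_less[OF assms(1), of i j] sorted_wrt_nth_less[OF assms(1), of j i] assms(2-)
  by (metis linorder_neqE_nat)

text \<open>In a sorted list the position of an element is the number of smaller ones. A loop can
  write this number in unary without any arithmetic.\<close>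

lemma length_filter_sorted:
  assumes "sorted_wrt R xs" "\<And>x. \<not> R x x" "\<And>x y z. R x y \<Longrightarrow> R y z \<Longrightarrow> R x z" "i < length xs"
  shows "length (filter (\<lambda>z. R z (xs ! i)) xs) = i"
proof -
  have "{j. j < length xs \<and> R (xs ! j) (xs ! i)} = {..<i}"
    using sorted_wrt_nth_iff[OF assms(1-3)] assms(4) by auto
  then show ?thesis by (simp add: length_filter_conv_card)
qed

section \<open>Computing polynomials in unary\<close>

definition adds :: "cmd \<Rightarrow> nat \<Rightarrow> (nat \<Rightarrow> nat) \<Rightarrow> nat set \<Rightarrow> bool" where
  "adds c r k X \<longleftrightarrow> tests_ok c \<and> finite X \<and>
     (\<exists>q :: nat poly. \<forall>\<sigma> m n b. length (\<sigma> 0) = n \<longrightarrow> (\<forall>i\<in>X. \<sigma> i = []) \<longrightarrow> n \<le> b \<longrightarrow> m + k n \<le> b \<longrightarrow>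
        big_step c (\<sigma>(r := unary m)) [] (\<sigma>(r := unary (m + k n))) (poly q b))"

lemma addsI:
  fixes q :: "nat poly"
  assumes "tests_ok c" "finite X"
    "\<And>\<sigma> m n b. length (\<sigma> 0) = n \<Longrightarrow> \<forall>i\<in>X. \<sigma> i = [] \<Longrightarrow> n \<le> b \<Longrightarrow> m + k n \<le> b \<Longrightarrow>
       big_step c (\<sigma>(r := unary m)) [] (\<sigma>(r := unary (m + k n))) (poly q b)"
  shows "adds c r k X"
  unfolding adds_def using assms by (intro conjI exI[of _ q]) blast+

lemma adds_Skip: "adds Skip r (\<lambda>_. 0) {}"
  by (auto simp: adds_def intro: big_step_Skip)

lemma adds_App: "adds (App r True) r (\<lambda>_. 1) {}"
proof -
  have "big_step (App r True) (\<sigma>(r := unary m)) [] (\<sigma>(r := unary (m + 1))) (poly [:10, 3:] b)" if "m + 1 \<le> b" for \<sigma> m b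
    using big_step_App[of "\<sigma>(r := unary m)" r "poly [:10, 3:] b" True] that by (simp add: replicate_append_same)
  then show ?thesis unfolding adds_def by (intro conjI exI[of _ "[:10, 3:]"]) auto
qed

lemma adds_Seq:
  assumes "adds c r k X" "adds d r l Y" "r \<notin> X \<union> Y" "r \<noteq> 0"
  shows "adds (Seq c d) r (\<lambda>n. k n + l n) (X \<union> Y)"
proof -
  from assms obtain p q :: "nat poly" where
    p: "\<And>\<sigma> m n b. length (\<sigma> 0) = n \<Longrightarrow> (\<forall>i\<in>X. \<sigma> i = []) \<Longrightarrow> n \<le> b \<Longrightarrow> m + k n \<le> b \<Longrightarrow>
        big_step c (\<sigma>(r := unary m)) [] (\<sigma>(r := unary (m + k n))) (poly p b)" and
    q: "\<And>\<sigma> m n b. length (\<sigma> 0) = n \<Longrightarrow> (\<forall>i\<in>Y. \<sigma> i = []) \<Longrightarrow> n \<le> b \<Longrightarrow> m + l n \<le> b \<Longrightarrow>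
        big_step d (\<sigma>(r := unary m)) [] (\<sigma>(r := unary (m + l n))) (poly q b)"
    unfolding adds_def by blast
  have "big_step (Seq c d) (\<sigma>(r := unary m)) [] (\<sigma>(r := unary (m + (k n + l n)))) (poly (p + q) b)"
    if "length (\<sigma> 0) = n" "\<forall>i\<in>X \<union> Y. \<sigma> i = []" "n \<le> b" "m + (k n + l n) \<le> b" for \<sigma> m n b
    using big_step_Seq[OF p[of \<sigma> n b m] q[of \<sigma> n b "m + k n"] order_refl] that by (simp add: add.assoc)
  moreover have "tests_ok (Seq c d)" "finite (X \<union> Y)" using assms by (auto simp: adds_def)
  ultimately show ?thesis by (intro addsI[of _ _ "\<lambda>n. k n + l n" r "p + q"])
qed

text \<open>The final value bounds all intermediate values \<open>m + v * k n\<close>, so the same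
  \<open>b\<close>, and with it the same time bound for the body, serves all rounds.\<close>

lemma adds_For:
  assumes c: "adds c r k X" and i: "i \<notin> X" "i \<noteq> 0" "i \<noteq> r" and r: "r \<notin> X" "r \<noteq> 0"
  shows "adds (For i 0 c) r (\<lambda>n. n * k n) (insert i X)"
proof -
  from c obtain q :: "nat poly" where
    q: "\<And>\<sigma> m n b. length (\<sigma> 0) = n \<Longrightarrow> (\<forall>i\<in>X. \<sigma> i = []) \<Longrightarrow> n \<le> b \<Longrightarrow> m + k n \<le> b \<Longrightarrow>
        big_step c (\<sigma>(r := unary m)) [] (\<sigma>(r := unary (m + k n))) (poly q b)"
    unfolding adds_def by blast
  let ?p = "[:1, 1:] * (q + [:22, 6:])"
  have "big_step (For i 0 c) (\<sigma>(r := unary m)) [] (\<sigma>(r := unary (m + n * k n))) (poly ?p b)"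
    if h: "length (\<sigma> 0) = n" "\<forall>j\<in>insert i X. \<sigma> j = []" "n \<le> b" "m + n * k n \<le> b" for \<sigma> m n b
  proof -
    let ?s = "\<lambda>v. \<sigma>(r := unary (m + v * k n))"
    have main: "big_step (For i 0 c) ((?s 0)(i := [])) (concat (map (\<lambda>_. []) [0..<n])) ((?s n)(i := []))
        ((n + 1) * (poly q b + 6 * n + 22))"
    proof (rule big_step_For[OF i(2)])
      fix v assume v: "v < n"
      have "m + v * k n + k n \<le> b" using h(4) mult_le_mono1[of "Suc v" n "k n"] v by simp
      from q[of "\<sigma>(i := unary v)" n b "m + v * k n", OF _ _ h(3) this] h i
      show "big_step c ((?s v)(i := unary v)) [] ((?s (Suc v))(i := unary v)) (poly q b)"
        by (auto simp: fun_upd_twist[of i r] add.assoc add.commute[of "k n"])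
    qed (use h(1) r in simp)
    have same: "(?s v)(i := []) = ?s v" for v using h(2) i by auto
    have nil: "concat (map (\<lambda>_. []) [0..<n]) = ([] :: bool list)" by simp
    have le: "(n + 1) * (poly q b + 6 * n + 22) \<le> poly ?p b"
      using mult_mono[of "n + 1" "b + 1" "poly q b + 6 * n + 22" "poly q b + 6 * b + 22"] h(3)
      by (simp add: algebra_simps)
    show ?thesis using big_step_mono[OF main[unfolded same nil] le] by simp
  qed
  moreover have "tests_ok (For i 0 c)" "finite (insert i X)" using c i by (auto simp: adds_def For_def)
  ultimately show ?thesis by (intro addsI[of _ _ "\<lambda>n. n * k n" r ?p])
qed

lemma ex_adds_const: "r \<noteq> 0 \<Longrightarrow> \<exists>c. adds c r (\<lambda>_. a) {}"
proof (induction a)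
  case 0
  then show ?case using adds_Skip by blast
next
  case (Suc a)
  then obtain c where "adds c r (\<lambda>_. a) {}" by blast
  from adds_Seq[OF this adds_App] Suc.prems show ?case by auto
qed

text \<open>Horner's scheme: the value of \<open>pCons a p\<close> is \<open>a\<close> plus
  \<open>n\<close> rounds of adding the value of \<open>p\<close>. Every coefficient brings a loop
  with a fresh counter; \<open>F\<close> collects the registers that counters must avoid.\<close>

lemma ex_adds_poly:
  assumes "r \<noteq> 0" "finite F"
  shows "\<exists>c X. X \<inter> F = {} \<and> 0 \<notin> X \<and> r \<notin> X \<and> adds c r (poly p) X"
proof (induction p)
  case 0
  have "poly 0 = (\<lambda>_. 0 :: nat)" by (simp add: fun_eq_iff)
  then show ?case using adds_Skip by (intro exI[of _ Skip] exI[of _ "{}"]) simp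
next
  case (pCons a p)
  then obtain c X where c: "X \<inter> F = {}" "0 \<notin> X" "r \<notin> X" "adds c r (poly p) X" by blast
  then have "finite (X \<union> F \<union> {0, r})" using assms by (auto simp: adds_def)
  then obtain i where i: "i \<notin> X \<union> F \<union> {0, r}" using ex_new_if_finite[OF infinite_UNIV_nat, of "X \<union> F \<union> {0, r}"] by blast
  obtain d where d: "adds d r (\<lambda>_. a) {}" using ex_adds_const[OF assms(1)] by blast
  have "adds (For i 0 c) r (\<lambda>n. n * poly p n) (insert i X)"
    by (rule adds_For[OF c(4)]) (use i c assms in auto)
  from adds_Seq[OF d this] have "adds (Seq d (For i 0 c)) r (\<lambda>n. a + n * poly p n) (insert i X)"
    using i c assms by auto
  moreover have "(\<lambda>n. a + n * poly p n) = poly (pCons a p)" by (simp add: fun_eq_iff)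
  ultimately have "adds (Seq d (For i 0 c)) r (poly (pCons a p)) (insert i X)" by simp
  then show ?case using i c by (intro exI[of _ "Seq d (For i 0 c)"] exI[of _ "insert i X"]) (auto simp del: poly_pCons)
qed

definition set_regs :: "(nat \<times> nat poly) list \<Rightarrow> store \<Rightarrow> store" where
  "set_regs prs \<sigma> r = (case map_of prs r of None \<Rightarrow> \<sigma> r | Some p \<Rightarrow> unary (poly p (length (\<sigma> 0))))"

lemma ex_set_regs:
  assumes "distinct (map fst prs)" "0 \<notin> fst ` set prs" "finite F"
  shows "\<exists>c X q. X \<inter> F = {} \<and> 0 \<notin> X \<and> X \<inter> fst ` set prs = {} \<and> tests_ok c \<and> finite X \<and>
    (\<forall>\<sigma>. (\<forall>i\<in>X \<union> fst ` set prs. \<sigma> i = []) \<longrightarrow>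
       big_step c \<sigma> [] (set_regs prs \<sigma>) (poly (q :: nat poly) (length (\<sigma> 0))))"
  using assms
proof (induction prs arbitrary: F)
  case Nil
  have "set_regs [] \<sigma> = \<sigma>" for \<sigma> by (simp add: set_regs_def[abs_def])
  then show ?case by (intro exI[of _ Skip] exI[of _ "{}"]) (auto intro: big_step_Skip)
next
  case (Cons rp prs)
  obtain r p where rp: "rp = (r, p)" by fastforce
  have r: "r \<noteq> 0" "r \<notin> fst ` set prs" using Cons.prems by (auto simp: rp)
  from Cons.IH[of "insert r F"] Cons.prems obtain c X and q :: "nat poly" where
    c: "X \<inter> insert r F = {}" "0 \<notin> X" "X \<inter> fst ` set prs = {}" "tests_ok c" "finite X"
    "\<And>\<sigma>. \<forall>i\<in>X \<union> fst ` set prs. \<sigma> i = [] \<Longrightarrow> big_step c \<sigma> [] (set_regs prs \<sigma>) (poly q (length (\<sigma> 0)))"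
    by auto
  have "finite (F \<union> fst ` set prs)" using Cons.prems by simp
  from ex_adds_poly[OF r(1) this, of p] obtain d Y where
    d: "Y \<inter> (F \<union> fst ` set prs) = {}" "0 \<notin> Y" "r \<notin> Y" "adds d r (poly p) Y"
    by blast
  from d(4) obtain q' :: "nat poly" where
    q': "\<And>\<sigma> m n b. length (\<sigma> 0) = n \<Longrightarrow> (\<forall>i\<in>Y. \<sigma> i = []) \<Longrightarrow> n \<le> b \<Longrightarrow> m + poly p n \<le> b \<Longrightarrow>
        big_step d (\<sigma>(r := unary m)) [] (\<sigma>(r := unary (m + poly p n))) (poly q' b)" and ok: "tests_ok d" "finite Y"
    unfolding adds_def by blast
  \<comment> \<open>The time of \<open>d\<close> is bounded in terms of the input length and the
    final value of the register together, hence the composition.\<close>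
  let ?q = "pcompose q' ([:0, 1:] + p) + q"
  have "big_step (Seq d c) \<sigma> [] (set_regs (rp # prs) \<sigma>) (poly ?q (length (\<sigma> 0)))"
    if \<sigma>: "\<forall>i\<in>X \<union> Y \<union> fst ` set (rp # prs). \<sigma> i = []" for \<sigma>
  proof -
    let ?n = "length (\<sigma> 0)"
    let ?\<sigma> = "\<sigma>(r := unary (poly p ?n))"
    have "\<sigma>(r := unary 0) = \<sigma>" using \<sigma> rp by auto
    with q'[of \<sigma> ?n "?n + poly p ?n" 0] \<sigma> have 1: "big_step d \<sigma> [] ?\<sigma> (poly q' (?n + poly p ?n))" by simp
    have "\<forall>i\<in>X \<union> fst ` set prs. ?\<sigma> i = []"
    proof
      fix i assume "i \<in> X \<union> fst ` set prs"
      then have "i \<noteq> r" "\<sigma> i = []" using \<sigma> r c(1) by auto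
      then show "?\<sigma> i = []" by simp
    qed
    from c(6)[of ?\<sigma>, OF this] have 2: "big_step c ?\<sigma> [] (set_regs prs ?\<sigma>) (poly q ?n)" using r by simp
    have "set_regs prs ?\<sigma> = set_regs (rp # prs) \<sigma>"
    proof
      fix x
      have "map_of prs r = None" using r(2) by (simp add: map_of_eq_None_iff)
      then show "set_regs prs ?\<sigma> x = set_regs (rp # prs) \<sigma> x"
        using r(1) by (auto simp: set_regs_def rp split: option.split)
    qed
    then show ?thesis using big_step_Seq[OF 1 2 order_refl] by (simp add: poly_pcompose)
  qed
  then show ?case
    using c(1-5) d(1-3) ok rp
    by (intro exI[of _ "Seq d c"] exI[of _ "X \<union> Y"] exI[of _ ?q]) auto
qed


section \<open>Coding the nodes\<close>


definition index :: "nat list list \<Rightarrow> nat list \<Rightarrow> nat" where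
  "index vs v = length (filter (\<lambda>z. lexless z v) vs)"

text \<open>A preference list: the rank classes of \<open>adj\<close>, which go from 0 to 3, one
  after the other, and within a class the order of \<open>vs\<close>.\<close>

definition row :: "nat list list \<Rightarrow> (nat \<Rightarrow> nat list \<Rightarrow> nat list \<Rightarrow> bool) \<Rightarrow> nat list \<Rightarrow> nat list list" where
  "row vs Q u = concat (map (\<lambda>r. filter (Q r u) vs) [0..<4])"

text \<open>Every vector becomes a node on both sides. A vector with an empty row is an isolated
  node; keeping it makes node numbers mere positions in \<open>vs\<close>, with the offset
  \<open>length vs\<close> on side \<open>B\<close>.\<close>

definition inst ::
  "nat list list \<Rightarrow> (nat \<Rightarrow> nat list \<Rightarrow> nat list \<Rightarrow> bool) \<Rightarrow> (nat \<Rightarrow> nat list \<Rightarrow> nat list \<Rightarrow> bool) \<Rightarrow> pref_lists" where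
  "inst vs RA RB = (length vs,
     map (\<lambda>u. map (\<lambda>w. length vs + index vs w) (row vs RA u)) vs @
     map (\<lambda>u. map (index vs) (row vs RB u)) vs)"

lemma sorted_lexless_index:
  assumes "sorted_wrt lexless vs" "v \<in> set vs"
  shows "index vs v < length vs" "vs ! index vs v = v"
proof -
  obtain i where i: "i < length vs" "vs ! i = v" using assms(2) by (auto simp: in_set_conv_nth)
  have "index vs v = i"
    using length_filter_sorted[OF assms(1) lexless_irrefl lexless_trans i(1)] i(2) by (simp add: index_def)
  then show "index vs v < length vs" "vs ! index vs v = v" using i by simp_all
qed

lemma pairs_of_sorted:
  assumes "sorted_wrt Q xs" "\<And>x. \<not> Q x x" "\<And>x y z. Q x y \<Longrightarrow> Q y z \<Longrightarrow> Q x z"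
    and f: "inj_on f (set xs)" and xy: "x \<in> set xs" "y \<in> set xs"
  shows "(f x, f y) \<in> {(map f xs ! i, map f xs ! j) | i j. i < j \<and> j < length (map f xs)} \<longleftrightarrow> Q x y"
proof
  assume "(f x, f y) \<in> {(map f xs ! i, map f xs ! j) | i j. i < j \<and> j < length (map f xs)}"
  then obtain i j where ij: "f x = f (xs ! i)" "f y = f (xs ! j)" "i < j" "j < length xs" by auto
  then have "x = xs ! i" "y = xs ! j" using f xy by (auto simp: inj_on_def)
  then show "Q x y" using sorted_wrt_nth_less[OF assms(1) ij(3,4)] by simp
next
  assume Q: "Q x y"
  obtain i j where ij: "x = xs ! i" "y = xs ! j" "i < length xs" "j < length xs"
    using xy by (metis in_set_conv_nth)
  then have "i < j" using sorted_wrt_nth_iff[OF assms(1-3) ij(3,4)] Q by simp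
  then show "(f x, f y) \<in> {(map f xs ! i, map f xs ! j) | i j. i < j \<and> j < length (map f xs)}"
    using ij by (intro CollectI exI[of _ i] exI[of _ j]) simp
qed

locale sorted_vecs =
  fixes vs :: "nat list list"
  assumes sorted: "sorted_wrt lexless vs"
begin

text \<open>A number with the rank class as leading digit to the base \<open>length vs\<close>; the
  index breaks ties within a class.\<close>

definition key :: "(nat \<Rightarrow> nat list \<Rightarrow> nat list \<Rightarrow> bool) \<Rightarrow> nat list \<Rightarrow> nat list \<Rightarrow> nat" where
  "key Q u v = (LEAST r. Q r u v) * length vs + index vs v"

lemma index_less: "v \<in> set vs \<Longrightarrow> index vs v < length vs"
  and nth_index: "v \<in> set vs \<Longrightarrow> vs ! index vs v = v"
  using sorted_lexless_index[OF sorted] by auto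

lemma inj_index: "u \<in> set vs \<Longrightarrow> v \<in> set vs \<Longrightarrow> index vs u = index vs v \<Longrightarrow> u = v"
  using nth_index by metis

lemma nth_inst:
  assumes "u \<in> set vs"
  shows "snd (inst vs RA RB) ! index vs u = map (\<lambda>w. length vs + index vs w) (row vs RA u)"
    "snd (inst vs RA RB) ! (length vs + index vs u) = map (index vs) (row vs RB u)"
  using index_less[OF assms] nth_index[OF assms] by (simp_all add: inst_def nth_append)

lemma set_row: "set (row vs Q u) = {v \<in> set vs. \<exists>r<4. Q r u v}"
  by (auto simp: row_def)

context
  fixes Q :: "nat \<Rightarrow> nat list \<Rightarrow> nat list \<Rightarrow> bool"
  assumes Q: "\<And>r r' u v. Q r u v \<Longrightarrow> Q r' u v \<Longrightarrow> r = r'"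
begin

lemma key_eq: "Q r u v \<Longrightarrow> key Q u v = r * length vs + index vs v"
  using Q unfolding key_def by (metis LeastI)

lemma key_less:
  assumes "v \<in> set vs" "Q r u v" "Q r' u v'" "r < r'"
  shows "key Q u v < key Q u v'"
proof -
  have "key Q u v < Suc r * length vs" using key_eq[OF assms(2)] index_less[OF assms(1)] by simp
  also have "\<dots> \<le> r' * length vs" using assms(4) by (intro mult_right_mono) auto
  also have "\<dots> \<le> key Q u v'" using key_eq[OF assms(3)] by simp
  finally show ?thesis .
qed

lemma sorted_row: "sorted_wrt (\<lambda>x y. key Q u x < key Q u y) (row vs Q u)"
  unfolding row_def
proof (rule sorted_concat_map[of "(<)"])
  fix r
  have "sorted_wrt (\<lambda>x y. lexless x y \<and> index vs x < index vs y) vs"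
  proof (subst sorted_wrt_iff_nth_less, intro allI impI)
    fix i j assume ij: "i < j" "j < length vs"
    have "index vs (vs ! i) = i" "index vs (vs ! j) = j"
      using ij by (simp_all add: index_def length_filter_sorted[OF sorted lexless_irrefl lexless_trans])
    then show "lexless (vs ! i) (vs ! j) \<and> index vs (vs ! i) < index vs (vs ! j)"
      using sorted_wrt_nth_less[OF sorted ij] ij by simp
  qed
  from sorted_wrt_filter[OF this, of "Q r u"]
  show "sorted_wrt (\<lambda>x y. key Q u x < key Q u y) (filter (Q r u) vs)"
    by (rule sorted_wrt_mono_rel[rotated]) (auto simp: key_eq)
qed (auto intro: key_less)

lemma pairs_row:
  assumes "inj_on f (set vs)" "v \<in> set (row vs Q u)" "v' \<in> set (row vs Q u)"
  shows "(f v, f v') \<in> {(map f (row vs Q u) ! i, map f (row vs Q u) ! j) | i j.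
     i < j \<and> j < length (map f (row vs Q u))} \<longleftrightarrow> key Q u v < key Q u v'"
  by (rule pairs_of_sorted[OF sorted_row _ _ inj_on_subset[OF assms(1)] assms(2,3)]) (auto simp: set_row)

lemma distinct_row: "inj_on f (set vs) \<Longrightarrow> distinct (map f (row vs Q u))"
proof -
  assume f: "inj_on f (set vs)"
  have "distinct (row vs Q u)"
    unfolding distinct_conv_nth using sorted_wrt_nth_less[OF sorted_row[of u]]
    by (metis less_irrefl linorder_neqE_nat)
  then show ?thesis using inj_on_subset[OF f] set_row by (auto simp: distinct_map)
qed

end

end

locale coded_layered = sorted_vecs vs for vs +
  fixes n :: nat and D :: "'d set" and C :: "nat \<Rightarrow> 'd \<Rightarrow> nat \<Rightarrow> 'd \<Rightarrow> bool"
    and ea :: "'d anode \<Rightarrow> nat list" and eb :: "'d bnode \<Rightarrow> nat list"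
  assumes finite_D: "finite D" and inj_ea: "inj ea" and inj_eb: "inj eb"
    and coded: "adj n D C a b \<noteq> None \<Longrightarrow> ea a \<in> set vs \<and> eb b \<in> set vs"
begin

definition RA :: "nat \<Rightarrow> nat list \<Rightarrow> nat list \<Rightarrow> bool" where
  "RA r u v \<longleftrightarrow> (\<exists>a b j. u = ea a \<and> v = eb b \<and> adj n D C a b = Some (r, j))"

definition RB :: "nat \<Rightarrow> nat list \<Rightarrow> nat list \<Rightarrow> bool" where
  "RB r v u \<longleftrightarrow> (\<exists>a b i. u = ea a \<and> v = eb b \<and> adj n D C a b = Some (i, r))"

lemma RA_iff: "RA r (ea a) (eb b) \<longleftrightarrow> (\<exists>j. adj n D C a b = Some (r, j))"
  unfolding RA_def using inj_ea inj_eb by (auto dest: injD)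

lemma RB_iff: "RB r (eb b) (ea a) \<longleftrightarrow> (\<exists>i. adj n D C a b = Some (i, r))"
  unfolding RB_def using inj_ea inj_eb by (auto dest: injD)

lemma RA_unique: "RA r u v \<Longrightarrow> RA r' u v \<Longrightarrow> r = r'"
  unfolding RA_def using inj_ea inj_eb by (auto dest!: injD)

lemma RB_unique: "RB r u v \<Longrightarrow> RB r' u v \<Longrightarrow> r = r'"
  unfolding RB_def using inj_ea inj_eb by (auto dest!: injD)

lemma adj_less_4: "adj n D C a b = Some (i, j) \<Longrightarrow> i < 4 \<and> j < 4"
  by (cases a; cases b) (auto split: if_splits)

definition ka :: "'d anode \<Rightarrow> 'd bnode \<Rightarrow> nat" where "ka a b = key RA (ea a) (eb b)"
definition kb :: "'d bnode \<Rightarrow> 'd anode \<Rightarrow> nat" where "kb b a = key RB (eb b) (ea a)"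

abbreviation I :: pref_lists where "I \<equiv> inst vs RA RB"
abbreviation m :: nat where "m \<equiv> length vs"
abbreviation na :: "'d anode \<Rightarrow> nat" where "na a \<equiv> index vs (ea a)"
abbreviation nb :: "'d bnode \<Rightarrow> nat" where "nb b \<equiv> m + index vs (eb b)"

lemma index_mod: "v \<in> set vs \<Longrightarrow> (r * m + index vs v) mod m = index vs v"
  using index_less by simp

sublocale layered n D C ka kb
proof
  show "finite D" by (rule finite_D)
next
  fix a b b' i j i' j'
  assume "adj n D C a b = Some (i, j)" "adj n D C a b' = Some (i', j')" "i < i'"
  then show "ka a b < ka a b'"
    unfolding ka_def by (intro key_less[of RA _ i _ i'] RA_unique) (use coded[of a b] in \<open>auto simp: RA_iff\<close>)
next
  fix a a' b i j i' j'
  assume "adj n D C a b = Some (i, j)" "adj n D C a' b = Some (i', j')" "j < j'"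
  then show "kb b a < kb b a'"
    unfolding kb_def by (intro key_less[of RB _ j _ j'] RB_unique) (use coded[of a b] in \<open>auto simp: RB_iff\<close>)
next
  fix a b b'
  assume "adj n D C a b \<noteq> None" "adj n D C a b' \<noteq> None" and eq: "ka a b = ka a b'"
  then obtain i j i' j' where *: "adj n D C a b = Some (i, j)" "adj n D C a b' = Some (i', j')" by auto
  then have v: "eb b \<in> set vs" "eb b' \<in> set vs" using coded by auto
  have "key RA (ea a) (eb b) = i * m + index vs (eb b)" "key RA (ea a) (eb b') = i' * m + index vs (eb b')"
    using * by (auto intro!: key_eq[OF RA_unique] simp: RA_iff)
  \<comment> \<open>Modulo \<open>m\<close> a key is the index, whatever the rank class is.\<close>
  then have "index vs (eb b) = index vs (eb b')" using eq index_mod v by (metis ka_def)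
  then show "b = b'" using inj_index v inj_eb by (auto dest: injD)
next
  fix a a' b
  assume "adj n D C a b \<noteq> None" "adj n D C a' b \<noteq> None" and eq: "kb b a = kb b a'"
  then obtain i j i' j' where *: "adj n D C a b = Some (i, j)" "adj n D C a' b = Some (i', j')" by auto
  then have v: "ea a \<in> set vs" "ea a' \<in> set vs" using coded by auto
  have "key RB (eb b) (ea a) = j * m + index vs (ea a)" "key RB (eb b) (ea a') = j' * m + index vs (ea a')"
    using * by (auto intro!: key_eq[OF RB_unique] simp: RB_iff)
  then have "index vs (ea a) = index vs (ea a')" using eq index_mod v by (metis kb_def)
  then show "a = a'" using inj_index v inj_ea by (auto dest: injD)
qed

lemma E_coded: "E a b \<Longrightarrow> ea a \<in> set vs" "E a b \<Longrightarrow> eb b \<in> set vs"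
  using coded by (auto simp: E_def)

lemma length_I: "length (snd I) = 2 * m" "fst I = m"
  by (simp_all add: inst_def)

lemma I_eq: "I = (m, snd I)"
  by (simp add: inst_def)

lemma row_A: "v \<in> set (row vs RA u) \<longleftrightarrow> (\<exists>a b. u = ea a \<and> v = eb b \<and> E a b)"
  using adj_less_4 coded unfolding set_row RA_def E_def by fastforce

lemma row_B: "u \<in> set (row vs RB v) \<longleftrightarrow> (\<exists>a b. u = ea a \<and> v = eb b \<and> E a b)"
  using adj_less_4 coded unfolding set_row RB_def E_def by fastforce

lemma lookup_cases:
  assumes "x < 2 * m"
  obtains u where "u \<in> set vs" "x = index vs u" | u where "u \<in> set vs" "x = m + index vs u"
proof (cases "x < m")
  case True
  have "index vs (vs ! x) = x" using True
    by (simp add: index_def length_filter_sorted[OF sorted lexless_irrefl lexless_trans])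
  then show ?thesis using that(1)[of "vs ! x"] True by simp
next
  case False
  then have x: "x - m < m" using assms by simp
  have "index vs (vs ! (x - m)) = x - m" using x
    by (simp add: index_def length_filter_sorted[OF sorted lexless_irrefl lexless_trans])
  then show ?thesis using that(2)[of "vs ! (x - m)"] x False by simp
qed

lemma inj_A: "inj_on (\<lambda>w. m + index vs w) (set vs)" and inj_B: "inj_on (index vs) (set vs)"
  using inj_index by (auto intro!: inj_onI)

lemma valid: "valid_pref_lists I"
proof -
  have "distinct (snd I ! x) \<and> (\<forall>y\<in>set (snd I ! x). y < 2 * m \<and> x \<in> set (snd I ! y) \<and> (x < m \<longleftrightarrow> \<not> y < m))"
    if "x < 2 * m" for x
    using that
  proof (cases rule: lookup_cases)
    case (1 u)
    show ?thesis
    proof (intro conjI ballI)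
      show "distinct (snd I ! x)" using nth_inst(1)[OF 1(1)] 1(2) distinct_row[OF RA_unique inj_A] by simp
      fix y assume "y \<in> set (snd I ! x)"
      then obtain v where v: "y = m + index vs v" "v \<in> set (row vs RA u)" using nth_inst(1)[OF 1(1)] 1(2) by auto
      from v(2) have "v \<in> set vs" "u \<in> set (row vs RB v)" unfolding row_A row_B using E_coded by blast+
      then have "x \<in> set (snd I ! y)" using 1(2) v(1) nth_inst(2)[OF \<open>v \<in> set vs\<close>] by simp
      moreover have "x < m" "y < 2 * m" using v(1) index_less[OF \<open>v \<in> set vs\<close>] index_less[OF 1(1)] 1(2) by simp_all
      ultimately show "y < 2 * m" "x \<in> set (snd I ! y)" "x < m \<longleftrightarrow> \<not> y < m" using v(1) by simp_all
    qed
  next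
    case (2 v)
    show ?thesis
    proof (intro conjI ballI)
      show "distinct (snd I ! x)" using nth_inst(2)[OF 2(1)] 2(2) distinct_row[OF RB_unique inj_B] by simp
      fix y assume "y \<in> set (snd I ! x)"
      then obtain u where u: "y = index vs u" "u \<in> set (row vs RB v)" using nth_inst(2)[OF 2(1)] 2(2) by auto
      from u(2) have "u \<in> set vs" "v \<in> set (row vs RA u)" unfolding row_A row_B using E_coded by blast+
      then have "x \<in> set (snd I ! y)" using 2(2) u(1) nth_inst(1)[OF \<open>u \<in> set vs\<close>] by simp
      moreover have "y < m" "\<not> x < m" using u(1) index_less[OF \<open>u \<in> set vs\<close>] 2(2) by simp_all
      ultimately show "y < 2 * m" "x \<in> set (snd I ! y)" "x < m \<longleftrightarrow> \<not> y < m" by simp_all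
    qed
  qed
  then have "valid_pref_lists (m, snd I)"
    unfolding valid_pref_lists.simps length_I by (intro conjI allI impI) (simp, blast+)
  then show ?thesis unfolding I_eq[symmetric] .
qed

text \<open>Only ends of edges are known to have their codes in \<open>vs\<close>. This is why
  \<open>pref_link\<close> restricts the injectivity of names to such nodes.\<close>

sublocale layered_link n D C ka kb "graph_of I" na nb
proof
  have g: "nodes (graph_of I) = {..<2 * m}" using length_I by (subst I_eq) (auto simp: nodes_def)
  have pref: "pref (graph_of I) x = {(snd I ! x ! i, snd I ! x ! j) | i j. i < j \<and> j < length (snd I ! x)}"
    if "x < 2 * m" for x
    using that length_I by (subst I_eq) simp
  have edges: "edges (graph_of I) = {{x, y} | x y. x < 2 * m \<and> y \<in> set (snd I ! x)}"
    using length_I by (subst I_eq) simp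
  fix a b a' b'
  show "E a b \<Longrightarrow> E a' b' \<Longrightarrow> na a = na a' \<Longrightarrow> a = a'"
    using E_coded inj_index inj_ea by (meson injD)
  show "E a b \<Longrightarrow> E a' b' \<Longrightarrow> nb b = nb b' \<Longrightarrow> b = b'"
    using E_coded inj_index inj_eb by (metis add_left_cancel injD)
  show "E a b \<Longrightarrow> E a' b' \<Longrightarrow> na a \<noteq> nb b'"
    using E_coded[of a b] index_less[of "ea a"] by auto
  show "E a b \<Longrightarrow> na a \<in> nodes (graph_of I)" "E a b \<Longrightarrow> nb b \<in> nodes (graph_of I)"
    unfolding g using E_coded index_less by fastforce+
  show "edges (graph_of I) = {{na a, nb b} | a b. E a b}"
  proof (intro equalityI subsetI)
    fix e assume "e \<in> edges (graph_of I)"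
    then obtain x y where e: "e = {x, y}" "x < 2 * m" "y \<in> set (snd I ! x)" unfolding edges by auto
    from e(2) show "e \<in> {{na a, nb b} | a b. E a b}"
    proof (cases rule: lookup_cases)
      case (1 u)
      then obtain v where "y = m + index vs v" "v \<in> set (row vs RA u)" using e nth_inst(1)[OF 1(1)] by auto
      then show ?thesis using e(1) 1(2) unfolding row_A by blast
    next
      case (2 v)
      then obtain u where "y = index vs u" "u \<in> set (row vs RB v)" using e nth_inst(2)[OF 2(1)] by auto
      then show ?thesis using e(1) 2(2) unfolding row_B by (blast intro: insert_commute)
    qed
  next
    fix e assume "e \<in> {{na a, nb b} | a b. E a b}"
    then obtain a b where e: "e = {na a, nb b}" "E a b" by auto
    then have "eb b \<in> set (row vs RA (ea a))" unfolding row_A by blast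
    then have "nb b \<in> set (snd I ! na a)" using nth_inst(1)[OF E_coded(1)[OF e(2)]] by simp
    then show "e \<in> edges (graph_of I)" unfolding edges using e index_less[OF E_coded(1)[OF e(2)]] by fastforce
  qed
  show "(nb b, nb b') \<in> pref (graph_of I) (na a) \<longleftrightarrow> ka a b < ka a b'" if "E a b" "E a b'"
  proof -
    have "na a < 2 * m" using index_less[OF E_coded(1)[OF that(1)]] by simp
    then show ?thesis
      unfolding pref[OF \<open>na a < 2 * m\<close>] nth_inst(1)[OF E_coded(1)[OF that(1)]] ka_def
      by (intro pairs_row[OF RA_unique inj_A]) (use that in \<open>auto simp: row_A\<close>)
  qed
  show "(na a, na a') \<in> pref (graph_of I) (nb b) \<longleftrightarrow> kb b a < kb b a'" if "E a b" "E a' b"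
  proof -
    have "nb b < 2 * m" using index_less[OF E_coded(2)[OF that(1)]] by simp
    then show ?thesis
      unfolding pref[OF \<open>nb b < 2 * m\<close>] nth_inst(2)[OF E_coded(2)[OF that(1)]] kb_def
      by (intro pairs_row[OF RB_unique inj_B]) (use that in \<open>auto simp: row_B\<close>)
  qed
qed

text \<open>The language speaks of some instance with the given encoding; injectivity of the
  encoding identifies it with \<open>I\<close>.\<close>

theorem inst_in_language_iff:
  "enc_instance I \<in> popular_neither_stable_nor_dominant \<longleftrightarrow>
   (\<exists>ch ch'. (\<forall>t<n. ch t \<in> D \<and> ch' t \<in> D) \<and> (\<forall>t<n. \<forall>t'<n. \<not> C t (ch t) t' (ch' t')))"
proof -
  have "enc_instance I \<in> popular_neither_stable_nor_dominant \<longleftrightarrow>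
    (\<exists>M. popular (graph_of I) M \<and> \<not> stable (graph_of I) M \<and> \<not> dominant (graph_of I) M)"
    (is "_ \<longleftrightarrow> ?P I")
  proof -
    have "enc_instance I \<in> popular_neither_stable_nor_dominant \<longleftrightarrow>
      (\<exists>J. enc_instance I = enc_instance J \<and> valid_pref_lists J \<and> ?P J)"
      unfolding popular_neither_stable_nor_dominant_def by blast
    also have "\<dots> \<longleftrightarrow> ?P I"
      unfolding inj_eq[OF inj_enc_instance] using valid by blast
    finally show ?thesis .
  qed
  then show ?thesis using popular_neither_iff_choice by simp
qed

end


text \<open>Nodes are coded by vectors \<open>[k, h, t] @ d\<close> where \<open>k\<close> is the kind of the node and \<open>h * n + t\<close> is
  its layer.\<close>

fun code_A :: "nat \<Rightarrow> nat \<Rightarrow> nat list anode \<Rightarrow> nat list" where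
  "code_A w n SA = [0, 0, 0] @ replicate w 0"
| "code_A w n (PA L) = [1, L div n, L mod n] @ replicate w 0"
| "code_A w n (A1 L d) = [2, L div n, L mod n] @ d"
| "code_A w n (A2 L d) = [3, L div n, L mod n] @ d"
| "code_A w n (KA i) = [4, of_bool (\<not> i), 0] @ replicate w 0"

fun code_B :: "nat \<Rightarrow> nat \<Rightarrow> nat list bnode \<Rightarrow> nat list" where
  "code_B w n TB = [0, 0, 0] @ replicate w 0"
| "code_B w n (QB L) = [1, L div n, L mod n] @ replicate w 0"
| "code_B w n (B1 L d) = [2, L div n, L mod n] @ d"
| "code_B w n (B2 L d) = [3, L div n, L mod n] @ d"
| "code_B w n (KB i) = [4, of_bool (\<not> i), 0] @ replicate w 0"

lemma div_mod_eqD: "(L :: nat) div n = L' div n \<Longrightarrow> L mod n = L' mod n \<Longrightarrow> L = L'"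
  by (metis div_mult_mod_eq)

lemma inj_code_A: "inj (code_A w n)"
proof (rule injI)
  fix a b assume "code_A w n a = code_A w n b"
  then show "a = b" by (cases a; cases b) (auto dest: div_mod_eqD)
qed

lemma inj_code_B: "inj (code_B w n)"
proof (rule injI)
  fix a b assume "code_B w n a = code_B w n b"
  then show "a = b" by (cases a; cases b) (auto dest: div_mod_eqD)
qed

section \<open>Adjacency in terms of code vectors\<close>

definition zero_vec :: "nat list \<Rightarrow> bool" where
  "zero_vec d \<longleftrightarrow> (\<forall>x\<in>set d. x = 0)"

lemma zero_vec_iff: "length d = w \<Longrightarrow> zero_vec d \<longleftrightarrow> d = replicate w 0"
  unfolding zero_vec_def by (metis in_set_replicate replicate_length_same)

text \<open>The successor of the layer \<open>h * n + t\<close> in terms of its digits, with a carry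
  into \<open>h\<close>.\<close>

definition next_stage :: "nat \<Rightarrow> nat \<Rightarrow> nat \<Rightarrow> nat \<Rightarrow> nat \<Rightarrow> bool" where
  "next_stage n h t h' t' \<longleftrightarrow> t < n \<and> (t' = Suc t \<and> t' < n \<and> h' = h \<or> n = Suc t \<and> t' = 0 \<and> h' = Suc h)"

text \<open>The relation \<open>adj\<close> spelled out on the entries of two code vectors, with the
  ranks \<open>i\<close> and \<open>j\<close>. Layers occur only through their digits, so apart from
  \<open>C\<close> each disjunct is a combination of comparisons that a program with unary registers
  can make.\<close>

definition rel :: "nat \<Rightarrow> (nat \<Rightarrow> nat list \<Rightarrow> nat \<Rightarrow> nat list \<Rightarrow> bool) \<Rightarrow> nat \<Rightarrow> nat \<Rightarrow>
    nat \<Rightarrow> nat \<Rightarrow> nat \<Rightarrow> nat list \<Rightarrow> nat \<Rightarrow> nat \<Rightarrow> nat \<Rightarrow> nat list \<Rightarrow> bool" where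
  "rel n C i j k h t d k' h' t' d' \<longleftrightarrow>
     i = 0 \<and> j = 1 \<and> k = 0 \<and> h = 0 \<and> t = 0 \<and> zero_vec d \<and> k' = 1 \<and> h' = 0 \<and> t' = 0 \<and> zero_vec d' \<or>
     i = 0 \<and> j = 0 \<and> k = 1 \<and> k' = 1 \<and> h = h' \<and> t = t' \<and> zero_vec d \<and> zero_vec d' \<and>
       ((h = 0 \<or> h = 1) \<and> t < n \<or> h = 2 \<and> t = 0) \<or>
     i = 1 \<and> j = 0 \<and> k = 1 \<and> h = 2 \<and> t = 0 \<and> zero_vec d \<and> k' = 0 \<and> h' = 0 \<and> t' = 0 \<and> zero_vec d' \<or>
     i = 1 \<and> j = 2 \<and> k = 1 \<and> k' = 2 \<and> h = 0 \<and> h' = 0 \<and> t = t' \<and> t < n \<and> zero_vec d \<or>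
     i = 1 \<and> j = 0 \<and> k = 1 \<and> k' = 3 \<and> h = 1 \<and> h' = 1 \<and> t = t' \<and> t < n \<and> zero_vec d \<or>
     i = 0 \<and> j = 1 \<and> k = 2 \<and> k' = 1 \<and> h = 0 \<and> next_stage n h t h' t' \<and> zero_vec d' \<or>
     i = 2 \<and> j = 1 \<and> k = 2 \<and> k' = 1 \<and> h = 1 \<and> next_stage n h t h' t' \<and> zero_vec d' \<or>
     i = 1 \<and> j = 3 \<and> k = 2 \<and> k' = 2 \<and> h = 0 \<and> h = h' \<and> t = t' \<and> t < n \<and> d = d' \<or>
     i = 0 \<and> j = 3 \<and> k = 2 \<and> k' = 2 \<and> h = 1 \<and> h = h' \<and> t = t' \<and> t < n \<and> d = d' \<or>
     i = 1 \<and> j = 1 \<and> k = 2 \<and> k' = 2 \<and> h = 1 \<and> h' = 0 \<and> t < n \<and> t' < n \<and> C t' d' t d \<or>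
     i = 3 \<and> j = 1 \<and> k = 2 \<and> k' = 3 \<and> (h = 0 \<or> h = 1) \<and> h = h' \<and> t = t' \<and> t < n \<and> d = d' \<or>
     i = 1 \<and> j = 0 \<and> k = 3 \<and> k' = 2 \<and> (h = 0 \<or> h = 1) \<and> h = h' \<and> t = t' \<and> t < n \<and> d = d' \<or>
     i = 0 \<and> j = 2 \<and> k = 3 \<and> k' = 3 \<and> (h = 0 \<or> h = 1) \<and> h = h' \<and> t = t' \<and> t < n \<and> d = d' \<or>
     i = 0 \<and> j = 0 \<and> k = 4 \<and> k' = 4 \<and> h = 0 \<and> h' = 0 \<and> t = 0 \<and> t' = 0 \<and> zero_vec d \<and> zero_vec d' \<or>
     i = 0 \<and> j = 1 \<and> k = 4 \<and> k' = 4 \<and> h = 1 \<and> h' = 0 \<and> t = 0 \<and> t' = 0 \<and> zero_vec d \<and> zero_vec d' \<or>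
     i = 1 \<and> j = 0 \<and> k = 4 \<and> k' = 4 \<and> h = 0 \<and> h' = 1 \<and> t = 0 \<and> t' = 0 \<and> zero_vec d \<and> zero_vec d' \<or>
     i = 1 \<and> j = 1 \<and> k = 4 \<and> k' = 4 \<and> h = 1 \<and> h' = 1 \<and> t = 0 \<and> t' = 0 \<and> zero_vec d \<and> zero_vec d'"

lemma stage_eqs:
  assumes "0 < (n :: nat)" "t < n"
  shows "(h * n + t) div n = h" "(h * n + t) mod n = t"
  using assms by (simp_all add: div_add1_eq)

lemma stage_bounds:
  fixes n L :: nat
  assumes n: "0 < n"
  shows "L < n \<Longrightarrow> L div n = 0 \<and> L mod n = L"
    "n \<le> L \<Longrightarrow> L < 2 * n \<Longrightarrow> L div n = 1 \<and> L mod n = L - n"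
    "L < 2 * n \<Longrightarrow> (L div n = 0 \<or> L div n = 1) \<and> L mod n < n"
    "2 * n div n = 2" "2 * n mod n = 0"
    "L \<le> 2 * n \<Longrightarrow> (L div n = 0 \<or> L div n = 1) \<and> L mod n < n \<or> L div n = 2 \<and> L mod n = 0"
proof -
  show 1: "L < n \<Longrightarrow> L div n = 0 \<and> L mod n = L" by simp
  show 2: "n \<le> L \<Longrightarrow> L < 2 * n \<Longrightarrow> L div n = 1 \<and> L mod n = L - n"
    using n by (simp add: le_div_geq le_mod_geq)
  show 3: "L < 2 * n \<Longrightarrow> (L div n = 0 \<or> L div n = 1) \<and> L mod n < n"
    using 1 2 n by (cases "L < n") auto
  show 4: "2 * n div n = 2" "2 * n mod n = 0" using n by simp_all
  show "L \<le> 2 * n \<Longrightarrow> (L div n = 0 \<or> L div n = 1) \<and> L mod n < n \<or> L div n = 2 \<and> L mod n = 0"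
    using 3 4 by (cases "L = 2 * n") auto
qed

lemma next_stage_Suc: "0 < n \<Longrightarrow> next_stage n (L div n) (L mod n) (Suc L div n) (Suc L mod n)"
  by (auto simp: next_stage_def mod_Suc div_Suc intro: Suc_lessI)

lemma Suc_of_next_stage:
  assumes "0 < n" "next_stage n h t h' t'"
  shows "t < n" "Suc (h * n + t) div n = h'" "Suc (h * n + t) mod n = t'"
proof -
  show t: "t < n" using assms by (simp add: next_stage_def)
  show "Suc (h * n + t) div n = h'" "Suc (h * n + t) mod n = t'"
    using assms stage_eqs[OF assms(1) t, of h] unfolding next_stage_def div_Suc mod_Suc by auto
qed

lemma stage_less:
  fixes n t h :: nat
  assumes "t < n"
  shows "h = 0 \<or> h = 1 \<Longrightarrow> h * n + t < 2 * n"
  using assms by auto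

lemma rel_iff:
  assumes n: "0 < n" and D: "D = {d. length d = w \<and> set d \<subseteq> {..<B}}" and d: "d \<in> D" "d' \<in> D"
  shows "rel n C i j k h t d k' h' t' d' \<longleftrightarrow>
    (\<exists>a b. [k, h, t] @ d = code_A w n a \<and> [k', h', t'] @ d' = code_B w n b \<and> adj n D C a b = Some (i, j))"
    (is "_ \<longleftrightarrow> ?R")
proof
  note z = zero_vec_iff[of d w] zero_vec_iff[of d' w]
  have z: "zero_vec d \<longleftrightarrow> d = replicate w 0" "zero_vec d' \<longleftrightarrow> d' = replicate w 0"
    using z d by (simp_all add: D)
  have R: ?R if "[k, h, t] @ d = code_A w n a" "[k', h', t'] @ d' = code_B w n b" "adj n D C a b = Some (i, j)" for a b
    using that by blast
  let ?L = "h * n + t"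
  note eqs = stage_eqs[OF n]
  assume "rel n C i j k h t d k' h' t' d'"
  then show ?R
    unfolding rel_def z
  proof (elim disjE conjE, goal_cases)
    case 1 then show ?thesis using n by (intro R[of SA "QB 0"]) auto
  next
    case 2 then show ?thesis using eqs[of t h] stage_less[of t n h] by (intro R[of "PA ?L" "QB ?L"]) auto
  next
    case 3 then show ?thesis using eqs[of t h] stage_less[of t n h] by (intro R[of "PA ?L" "QB ?L"]) auto
  next
    case 4 then show ?thesis using stage_bounds[OF n] by (intro R[of "PA (2 * n)" "QB (2 * n)"]) auto
  next
    case 5 then show ?thesis using stage_bounds[OF n] by (intro R[of "PA (2 * n)" TB]) auto
  next
    case 6 then show ?thesis using eqs[of t h] d by (intro R[of "PA ?L" "B1 ?L d'"]) auto
  next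
    case 7 then show ?thesis using eqs[of t h] d by (intro R[of "PA ?L" "B2 ?L d'"]) auto
  next
    case 8 then show ?thesis using eqs[of t h] Suc_of_next_stage[OF n, of h t h' t'] d by (intro R[of "A1 ?L d" "QB (Suc ?L)"]) auto
  next
    case 9 then show ?thesis using eqs[of t h] Suc_of_next_stage[OF n, of h t h' t'] d by (intro R[of "A1 ?L d" "QB (Suc ?L)"]) auto
  next
    case 10 then show ?thesis using eqs[of t h] d by (intro R[of "A1 ?L d" "B1 ?L d"]) auto
  next
    case 11 then show ?thesis using eqs[of t h] d by (intro R[of "A1 ?L d" "B1 ?L d"]) auto
  next
    case 12
    then have "adj n D C (A1 (n + t) d) (B1 t' d') = Some (1, 1)" using d by simp
    then show ?thesis using 12 eqs[of t 1] by (intro R[of "A1 (n + t) d" "B1 t' d'"]) auto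
  next
    case 13 then show ?thesis using eqs[of t h] d stage_less[of t n h] by (intro R[of "A1 ?L d" "B2 ?L d"]) auto
  next
    case 14 then show ?thesis using eqs[of t h] d stage_less[of t n h] by (intro R[of "A1 ?L d" "B2 ?L d"]) auto
  next
    case 15 then show ?thesis using eqs[of t h] d stage_less[of t n h] by (intro R[of "A2 ?L d" "B1 ?L d"]) auto
  next
    case 16 then show ?thesis using eqs[of t h] d stage_less[of t n h] by (intro R[of "A2 ?L d" "B1 ?L d"]) auto
  next
    case 17 then show ?thesis using eqs[of t h] d stage_less[of t n h] by (intro R[of "A2 ?L d" "B2 ?L d"]) auto
  next
    case 18 then show ?thesis using eqs[of t h] d stage_less[of t n h] by (intro R[of "A2 ?L d" "B2 ?L d"]) auto
  next
    case 19 then show ?thesis by (intro R[of "KA True" "KB True"]) auto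
  next
    case 20 then show ?thesis by (intro R[of "KA False" "KB True"]) auto
  next
    case 21 then show ?thesis by (intro R[of "KA True" "KB False"]) auto
  next
    case 22 then show ?thesis by (intro R[of "KA False" "KB False"]) auto
  qed
next
  assume ?R
  then obtain a b where ab: "[k, h, t] @ d = code_A w n a" "[k', h', t'] @ d' = code_B w n b"
    and adj: "adj n D C a b = Some (i, j)" by blast
  have z: "zero_vec (replicate w 0)" by (simp add: zero_vec_def)
  note sb = stage_bounds[OF n]
  show "rel n C i j k h t d k' h' t' d'"
  proof (cases a)
    case SA
    then show ?thesis using ab adj z by (cases b) (auto simp: rel_def split: if_splits)
  next
    case (PA L)
    then show ?thesis using ab adj z sb(1,2,6)[of L] sb(4,5) by (cases b) (auto simp: rel_def split: if_splits)
  next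
    case (A1 L e)
    show ?thesis
    proof (cases b)
      case (QB L')
      then show ?thesis using A1 ab adj z sb(1,2)[of L] next_stage_Suc[OF n, of L]
        by (cases "L < n") (auto simp: rel_def split: if_splits)
    next
      case (B1 L' e')
      show ?thesis
      proof (cases "L = L' \<and> e = e'")
        case True
        then show ?thesis using A1 B1 ab adj sb(1,2)[of L] n by (cases "L < n") (auto simp: rel_def split: if_splits)
      next
        case False
        then have "L' < n" "n \<le> L" "L < 2 * n" "C L' e' (L - n) e" "i = 1" "j = 1"
          using A1 B1 adj by (auto split: if_splits)
        then show ?thesis using A1 B1 ab sb(1)[of L'] sb(2)[of L] by (auto simp: rel_def)
      qed
    next
      case (B2 L' e')
      then show ?thesis using A1 ab adj sb(3)[of L] by (auto simp: rel_def split: if_splits)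
    qed (use A1 adj in auto)
  next
    case (A2 L e)
    then show ?thesis using ab adj sb(3)[of L] by (cases b) (auto simp: rel_def split: if_splits)
  next
    case (KA x)
    then show ?thesis using ab adj z by (cases b) (auto simp: rel_def split: if_splits)
  qed
qed

lemma code_bounds:
  assumes n: "0 < n" and D: "D = {d. length d = w \<and> set d \<subseteq> {..<B}}" and B: "4 < B" "n \<le> B"
    and adj: "adj n D C a b \<noteq> None"
  shows "code_A w n a \<in> set (vecs (3 + w) B) \<and> code_B w n b \<in> set (vecs (3 + w) B)"
proof -
  have m: "L mod n < B" for L using B n mod_less_divisor[of n L] by linarith
  have dv: "L div n < B" if "L \<le> 2 * n" for L using stage_bounds(6)[OF n that] B by auto
  have A: "code_A w n a \<in> set (vecs (3 + w) B)"
    using adj B m dv by (cases a; cases b) (auto simp: set_vecs D split: if_splits)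
  have "code_B w n b \<in> set (vecs (3 + w) B)"
    using adj B m dv by (cases a; cases b) (auto simp: set_vecs D split: if_splits)
  with A show ?thesis ..
qed


section \<open>Formulas for the ranks\<close>


abbreviation val :: "store \<Rightarrow> nat \<Rightarrow> nat" where "val \<sigma> r \<equiv> length (\<sigma> r)"

text \<open>A test needs two different tapes, so the case of equal registers is settled when the
  formula is built.\<close>

definition lt :: "nat \<Rightarrow> nat \<Rightarrow> fm" where
  "lt r s = (if r = s then Neg Truth else Test r s False nonblank)"

definition sc :: "nat \<Rightarrow> nat \<Rightarrow> fm" where
  "sc r s = (if r = s then Neg Truth else Conj (lt r s) (Neg (Test r s True nonblank)))"

definition eqf :: "nat \<Rightarrow> nat \<Rightarrow> fm" where
  "eqf r s = Conj (Neg (lt r s)) (Neg (lt s r))"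

definition impf :: "fm \<Rightarrow> fm \<Rightarrow> fm" where
  "impf f g = Disj (Neg f) g"

definition conjs :: "fm list \<Rightarrow> fm" where "conjs fs = foldr Conj fs Truth"
definition disjs :: "fm list \<Rightarrow> fm" where "disjs fs = foldr Disj fs (Neg Truth)"

lemma holds_lt [simp]: "holds \<sigma> (lt r s) \<longleftrightarrow> val \<sigma> r < val \<sigma> s"
  by (simp add: lt_def test_less)

lemma holds_sc [simp]: "holds \<sigma> (sc r s) \<longleftrightarrow> val \<sigma> s = Suc (val \<sigma> r)"
  by (auto simp: sc_def test_Suc_less)

lemma holds_eqf [simp]: "holds \<sigma> (eqf r s) \<longleftrightarrow> val \<sigma> r = val \<sigma> s"
  by (auto simp: eqf_def)

lemma holds_impf [simp]: "holds \<sigma> (impf f g) \<longleftrightarrow> (holds \<sigma> f \<longrightarrow> holds \<sigma> g)"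
  by (auto simp: impf_def)

lemma holds_conjs [simp]: "holds \<sigma> (conjs fs) \<longleftrightarrow> (\<forall>f\<in>set fs. holds \<sigma> f)"
  by (induction fs) (auto simp: conjs_def)

lemma holds_disjs [simp]: "holds \<sigma> (disjs fs) \<longleftrightarrow> (\<exists>f\<in>set fs. holds \<sigma> f)"
  by (induction fs) (auto simp: disjs_def)

lemma fm_ok_lt [simp]: "fm_ok (lt r s)" and fm_ok_sc [simp]: "fm_ok (sc r s)"
  and fm_ok_eqf [simp]: "fm_ok (eqf r s)"
  by (auto simp: lt_def sc_def eqf_def)

lemma fm_ok_impf [simp]: "fm_ok (impf f g) \<longleftrightarrow> fm_ok f \<and> fm_ok g"
  by (simp add: impf_def)

lemma fm_ok_conjs [simp]: "fm_ok (conjs fs) \<longleftrightarrow> (\<forall>f\<in>set fs. fm_ok f)"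
  by (induction fs) (auto simp: conjs_def)

lemma fm_ok_disjs [simp]: "fm_ok (disjs fs) \<longleftrightarrow> (\<forall>f\<in>set fs. fm_ok f)"
  by (induction fs) (auto simp: disjs_def)

definition all_eq :: "nat list \<Rightarrow> nat list \<Rightarrow> fm" where
  "all_eq ds es = conjs (map (\<lambda>(r, s). eqf r s) (zip ds es))"

lemma holds_all_eq [simp]:
  "length ds = length es \<Longrightarrow> holds \<sigma> (all_eq ds es) \<longleftrightarrow> map (val \<sigma>) ds = map (val \<sigma>) es"
  by (induction ds es rule: list_induct2) (auto simp: all_eq_def)

lemma fm_ok_all_eq [simp]: "fm_ok (all_eq ds es)"
  by (auto simp: all_eq_def)

fun lexf :: "nat list \<Rightarrow> nat list \<Rightarrow> fm" where
  "lexf (r # rs) (s # ss) = Disj (lt r s) (Conj (eqf r s) (lexf rs ss))"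
| "lexf _ _ = Neg Truth"

lemma holds_lexf [simp]: "holds \<sigma> (lexf rs ss) \<longleftrightarrow> lexless (map (val \<sigma>) rs) (map (val \<sigma>) ss)"
  by (induction rs ss rule: lexf.induct) auto

lemma fm_ok_lexf [simp]: "fm_ok (lexf rs ss)"
  by (induction rs ss rule: lexf.induct) auto

text \<open>The registers with fixed contents: 0 is the input, 1 the word \<open>W\<close>, 2 to 8 the numbers
  \<open>B\<close>, \<open>T + 3\<close>, \<open>T\<close>, \<open>T + 1\<close>, \<open>T + 2\<close>, \<open>lo\<close> and \<open>hi\<close>, and \<open>9 + c\<close> the number \<open>c\<close>.\<close>

definition params :: "nat \<Rightarrow> bool list \<Rightarrow> nat \<Rightarrow> nat \<Rightarrow> nat \<Rightarrow> nat \<Rightarrow> store \<Rightarrow> bool" where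
  "params cm W lo hi T B \<sigma> \<longleftrightarrow> \<sigma> 1 = W \<and> val \<sigma> 2 = B \<and> val \<sigma> 3 = T + 3 \<and> val \<sigma> 4 = T \<and>
     val \<sigma> 5 = T + 1 \<and> val \<sigma> 6 = T + 2 \<and> val \<sigma> 7 = lo \<and> val \<sigma> 8 = hi \<and> (\<forall>c\<le>cm. val \<sigma> (9 + c) = c)"

definition isc :: "nat \<Rightarrow> nat \<Rightarrow> fm" where "isc r c = eqf r (9 + c)"

lemma holds_isc: "params cm W lo hi T B \<sigma> \<Longrightarrow> c \<le> cm \<Longrightarrow> holds \<sigma> (isc r c) \<longleftrightarrow> val \<sigma> r = c"
  by (simp add: isc_def params_def)

lemma fm_ok_isc [simp]: "fm_ok (isc r c)"
  by (simp add: isc_def)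

text \<open>Functions of the row index are known when the program is built. They are tabulated, with
  one disjunct for each row.\<close>

definition table :: "nat \<Rightarrow> nat \<Rightarrow> (nat \<Rightarrow> fm) \<Rightarrow> fm" where
  "table cn r f = disjs (map (\<lambda>c. Conj (isc r c) (f c)) [0..<cn])"

lemma holds_table:
  "params cm W lo hi T B \<sigma> \<Longrightarrow> cn \<le> cm \<Longrightarrow> val \<sigma> r < cn \<Longrightarrow> holds \<sigma> (table cn r f) \<longleftrightarrow> holds \<sigma> (f (val \<sigma> r))"
  by (auto simp: table_def holds_isc)

lemma fm_ok_table [simp]: "fm_ok (table cn r f) \<longleftrightarrow> (\<forall>c<cn. fm_ok (f c))"
  by (auto simp: table_def)

definition constf :: "bool \<Rightarrow> fm" where "constf b = (if b then Truth else Neg Truth)"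

lemma holds_constf [simp]: "holds \<sigma> (constf b) \<longleftrightarrow> b" and fm_ok_constf [simp]: "fm_ok (constf b)"
  by (auto simp: constf_def)

section \<open>Formulas for compatibility and adjacency\<close>

context
  fixes M :: turing_machine and rows :: "(nat \<times> nat list) list"
begin

abbreviation kk :: nat where "kk \<equiv> num_tapes M"
abbreviation cn :: nat where "cn \<equiv> length rows"
abbreviation st_of where "st_of \<equiv> tableau.state rows"
abbreviation sy_of where "sy_of \<equiv> tableau.sym rows"
abbreviation nst_of where "nst_of \<equiv> tableau.nstate M rows"
abbreviation wr_of where "wr_of \<equiv> tableau.wr M rows"
abbreviation mv_of where "mv_of \<equiv> tableau.mv M rows"

text \<open>\<open>s\<close> maps a symbol to the formula saying that this symbol is read. The word
  \<open>W\<close> is in register 1 and indexed by the length of \<open>h\<close>; the condition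
  \<open>h \<noteq> 1\<close> keeps the two tapes of the test distinct.\<close>

definition ini_fm :: "nat \<Rightarrow> nat \<Rightarrow> (nat \<Rightarrow> fm) \<Rightarrow> nat \<Rightarrow> fm" where
  "ini_fm j h s l = Disj (Conj (isc h 0) (s 1)) (Conj (Neg (isc h 0))
     (if j = 0 \<and> h \<noteq> 1 then
        Disj (Conj (lt h 1) (Disj (Conj (Test h 1 False {2}) (s 2)) (Conj (Test h 1 False {3}) (s 3))))
             (Conj (Neg (lt h 1)) (Disj (Conj (Neg (lt l h)) (Disj (s 2) (s 3))) (Conj (lt l h) (s 0))))
      else s 0))"

definition self_fm :: "nat \<Rightarrow> nat list \<Rightarrow> fm" where
  "self_fm t d = conjs ([Neg (lt (d ! 0) 7), Neg (lt 8 (d ! 0)),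
     impf (isc t 0) (Conj (table cn (d ! 1) (\<lambda>c. constf (st_of c = 0))) (conjs (map (\<lambda>j. isc (d ! (2 + j)) 0) [0..<kk]))),
     impf (eqf t 4) (table cn (d ! 1) (\<lambda>c. constf (st_of c = 1))),
     impf (eqf t 5) (Conj (table cn (d ! 1) (\<lambda>c. constf (sy_of c (kk - 1) = 3))) (conjs (map (\<lambda>j. isc (d ! (2 + j)) 1) [0..<kk]))),
     impf (eqf t 6) (Conj (table cn (d ! 1) (\<lambda>c. constf (sy_of c (kk - 1) = 0))) (conjs (map (\<lambda>j. isc (d ! (2 + j)) 2) [0..<kk])))] @
     map (\<lambda>j. Conj (Neg (lt t (d ! (2 + kk + j)))) (impf (eqf (d ! (2 + kk + j)) t)
       (ini_fm j (d ! (2 + j)) (\<lambda>s. table cn (d ! 1) (\<lambda>c. constf (sy_of c j = s))) (d ! 0)))) [0..<kk])"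

definition move_fm :: "head_move \<Rightarrow> nat \<Rightarrow> nat \<Rightarrow> fm" where
  "move_fm m r s = (case m of Stay \<Rightarrow> eqf s r | Go_Right \<Rightarrow> sc r s
     | Go_Left \<Rightarrow> Disj (sc s r) (Conj (isc r 0) (isc s 0)))"

definition before_fm :: "nat \<Rightarrow> nat list \<Rightarrow> nat \<Rightarrow> nat list \<Rightarrow> fm" where
  "before_fm t d t' e = conjs ([eqf (d ! 0) (e ! 0),
     impf (Conj (sc t t') (Neg (lt 4 t')))
       (Conj (table cn (d ! 1) (\<lambda>c. table cn (e ! 1) (\<lambda>c'. constf (st_of c' = nst_of c))))
         (conjs (map (\<lambda>j. table cn (d ! 1) (\<lambda>c. move_fm (mv_of c j) (d ! (2 + j)) (e ! (2 + j)))) [0..<kk])))] @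
     map (\<lambda>j. Conj
       (impf (eqf (e ! (2 + kk + j)) t) (Conj (eqf (d ! (2 + j)) (e ! (2 + j)))
          (table cn (d ! 1) (\<lambda>c. table cn (e ! 1) (\<lambda>c'. constf (sy_of c' j = wr_of c j))))))
       (impf (Disj (eqf (e ! (2 + kk + j)) t') (lt (e ! (2 + kk + j)) t)) (Neg (eqf (d ! (2 + j)) (e ! (2 + j)))))) [0..<kk])"

text \<open>The register \<open>9 + cn\<close> contains the number of rows. The comparisons with it
  are guards: \<open>table\<close> gives the right answer only for an index in range.\<close>

definition compat_fm :: "nat \<Rightarrow> nat list \<Rightarrow> nat \<Rightarrow> nat list \<Rightarrow> fm" where
  "compat_fm t d t' e = conjs [lt (d ! 1) (9 + cn), lt (e ! 1) (9 + cn),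
     Disj (Conj (eqf t t') (Conj (all_eq d e) (self_fm t d)))
       (Disj (Conj (lt t t') (before_fm t d t' e)) (Conj (lt t' t) (before_fm t' e t d)))]"

text \<open>The entries correspond to the disjuncts of \<open>rel\<close>, in the same order. The
  ranks are kept apart from the formulas, so that \<open>rank_A\<close> and \<open>rank_B\<close>
  can select from the same list.\<close>

definition entries :: "nat list \<Rightarrow> nat list \<Rightarrow> (nat \<times> nat \<times> fm) list" where
  "entries u v = (let k = u ! 0; h = u ! 1; t = u ! 2; d = drop 3 u;
        k' = v ! 0; h' = v ! 1; t' = v ! 2; d' = drop 3 v;
        z = conjs (map (\<lambda>r. isc r 0) d); z' = conjs (map (\<lambda>r. isc r 0) d');
        valid = lt t 3; valid' = lt t' 3; bin = Disj (isc h 0) (isc h 1);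
        nxt = Conj valid (Disj (conjs [sc t t', valid', eqf h' h]) (conjs [sc t 3, isc t' 0, sc h h']));
        same = conjs [eqf h h', eqf t t', valid, all_eq d d']
      in [(0, 1, conjs [isc k 0, isc h 0, isc t 0, z, isc k' 1, isc h' 0, isc t' 0, z']),
          (0, 0, conjs [isc k 1, isc k' 1, eqf h h', eqf t t', z, z', Disj (Conj bin valid) (Conj (isc h 2) (isc t 0))]),
          (1, 0, conjs [isc k 1, isc h 2, isc t 0, z, isc k' 0, isc h' 0, isc t' 0, z']),
          (1, 2, conjs [isc k 1, isc k' 2, isc h 0, isc h' 0, eqf t t', valid, z]),
          (1, 0, conjs [isc k 1, isc k' 3, isc h 1, isc h' 1, eqf t t', valid, z]),
          (0, 1, conjs [isc k 2, isc k' 1, isc h 0, nxt, z']),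
          (2, 1, conjs [isc k 2, isc k' 1, isc h 1, nxt, z']),
          (1, 3, conjs [isc k 2, isc k' 2, isc h 0, same]),
          (0, 3, conjs [isc k 2, isc k' 2, isc h 1, same]),
          (1, 1, conjs [isc k 2, isc k' 2, isc h 1, isc h' 0, valid, valid', Neg (compat_fm t' d' t d)]),
          (3, 1, conjs [isc k 2, isc k' 3, bin, same]),
          (1, 0, conjs [isc k 3, isc k' 2, bin, same]),
          (0, 2, conjs [isc k 3, isc k' 3, bin, same]),
          (0, 0, conjs [isc k 4, isc k' 4, isc h 0, isc h' 0, isc t 0, isc t' 0, z, z']),
          (0, 1, conjs [isc k 4, isc k' 4, isc h 1, isc h' 0, isc t 0, isc t' 0, z, z']),
          (1, 0, conjs [isc k 4, isc k' 4, isc h 0, isc h' 1, isc t 0, isc t' 0, z, z']),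
          (1, 1, conjs [isc k 4, isc k' 4, isc h 1, isc h' 1, isc t 0, isc t' 0, z, z'])])"

definition rank_A :: "nat \<Rightarrow> nat list \<Rightarrow> nat list \<Rightarrow> fm" where
  "rank_A r u v = disjs (map (\<lambda>(i, j, f). if i = r then f else Neg Truth) (entries u v))"

definition rank_B :: "nat \<Rightarrow> nat list \<Rightarrow> nat list \<Rightarrow> fm" where
  "rank_B r v u = disjs (map (\<lambda>(i, j, f). if j = r then f else Neg Truth) (entries u v))"

lemma fm_ok_ini_fm: "(\<And>s. fm_ok (f s)) \<Longrightarrow> fm_ok (ini_fm j h f l)"
  by (auto simp: ini_fm_def)

lemma fm_ok_move_fm: "fm_ok (move_fm m r s)"
  by (auto simp: move_fm_def split: head_move.split)

lemma fm_ok_compat_fm: "fm_ok (compat_fm t d t' e)"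
  by (auto simp: compat_fm_def self_fm_def before_fm_def fm_ok_ini_fm fm_ok_move_fm)

lemma fm_ok_rank: "fm_ok (rank_A r u v)" "fm_ok (rank_B r u v)"
  by (auto simp: rank_A_def rank_B_def entries_def Let_def fm_ok_compat_fm)

context
  fixes cm W lo hi T B and \<sigma> :: store
  assumes M: "wf_tm M" "set rows = valid_rows M" and p: "params cm W lo hi T B \<sigma>" and cm: "4 \<le> cm" "cn \<le> cm"
begin

interpretation tableau M rows W lo hi T B
  by unfold_locales (rule M)+

lemma regs: "val \<sigma> 4 = T" "val \<sigma> 5 = Suc T" "val \<sigma> 6 = Suc (Suc T)" "val \<sigma> 7 = lo" "val \<sigma> 8 = hi" "val \<sigma> 3 = T + 3"
  "\<sigma> 1 = W" "val \<sigma> (9 + cn) = cn"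
  using p cm by (auto simp: params_def)

lemma holds_table_regs: "val \<sigma> r < cn \<Longrightarrow> holds \<sigma> (table cn r f) \<longleftrightarrow> holds \<sigma> (f (val \<sigma> r))"
  using holds_table[OF p cm(2)] .

lemma holds_ini_fm:
  assumes "\<And>x. holds \<sigma> (f x) \<longleftrightarrow> s = x" "h \<noteq> 1"
  shows "holds \<sigma> (ini_fm j h f l) \<longleftrightarrow> ini j (val \<sigma> h) s (val \<sigma> l)"
proof -
  have "test h 1 False {2} \<sigma> \<longleftrightarrow> bit_symbol (W ! val \<sigma> h) = 2" "test h 1 False {3} \<sigma> \<longleftrightarrow> bit_symbol (W ! val \<sigma> h) = 3"
    if "val \<sigma> h < length W"
    using that by (auto simp: test_def word_tape_def regs[unfolded One_nat_def] regs)
  note T = this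
  have z: "holds \<sigma> (isc h 0) \<longleftrightarrow> val \<sigma> h = 0" using holds_isc[OF p] by simp
  have l: "holds \<sigma> (lt h 1) \<longleftrightarrow> val \<sigma> h < length W" by (simp add: regs(7)[unfolded One_nat_def])
  consider "val \<sigma> h = 0" | "val \<sigma> h \<noteq> 0" "j \<noteq> 0" | "val \<sigma> h \<noteq> 0" "j = 0" "val \<sigma> h < length W"
    | "val \<sigma> h \<noteq> 0" "j = 0" "\<not> val \<sigma> h < length W" by blast
  then show ?thesis
  proof cases
    case 1
    then show ?thesis by (simp add: ini_fm_def ini_def z assms(1) del: holds_lt)
  next
    case 2
    then show ?thesis by (simp add: ini_fm_def ini_def z assms(1) del: holds_lt)
  next
    case 3
    then have "holds \<sigma> (ini_fm j h f l) \<longleftrightarrow>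
        bit_symbol (W ! val \<sigma> h) = 2 \<and> s = 2 \<or> bit_symbol (W ! val \<sigma> h) = 3 \<and> s = 3"
      unfolding ini_fm_def using assms(2) by (simp add: z l T assms(1) del: holds_lt One_nat_def)
    then show ?thesis using 3 bit_symbol_range[of "W ! val \<sigma> h"] by (auto simp: ini_def)
  next
    case 4
    then have "holds \<sigma> (ini_fm j h f l) \<longleftrightarrow>
        (\<not> val \<sigma> l < val \<sigma> h \<and> (s = 2 \<or> s = 3)) \<or> (val \<sigma> l < val \<sigma> h \<and> s = 0)"
      unfolding ini_fm_def using assms(2) by (auto simp: z assms(1) regs(7)[unfolded One_nat_def])
    then show ?thesis using 4 by (auto simp: ini_def)
  qed
qed

lemma holds_self_fm:
  assumes "length d = 2 + 2 * kk" "val \<sigma> (d ! 1) < cn" "1 \<notin> set d"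
  shows "holds \<sigma> (self_fm t d) \<longleftrightarrow> self (val \<sigma> t) (map (val \<sigma>) d)"
proof -
  have ini: "holds \<sigma> (ini_fm j (d ! (2 + j)) (\<lambda>s. table cn (d ! 1) (\<lambda>c. constf (sy_of c j = s))) (d ! 0)) \<longleftrightarrow>
      ini j (val \<sigma> (d ! (2 + j))) (sy_of (val \<sigma> (d ! 1)) j) (val \<sigma> (d ! 0))" if "j < kk" for j
  proof (rule holds_ini_fm)
    have "d ! (2 + j) \<in> set d" using that assms(1) by (intro nth_mem) simp
    then show "d ! (2 + j) \<noteq> 1" using assms(3) by metis
  qed (simp only: holds_table_regs[OF assms(2)] holds_constf)
  have nth: "map (val \<sigma>) d ! i = val \<sigma> (d ! i)" if "i < 2 + 2 * kk" for i using that assms(1) by simp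
  have nths: "map (val \<sigma>) d ! 0 = val \<sigma> (d ! 0)" "map (val \<sigma>) d ! 1 = val \<sigma> (d ! 1)"
    "j < kk \<Longrightarrow> map (val \<sigma>) d ! (2 + j) = val \<sigma> (d ! (2 + j))"
    "j < kk \<Longrightarrow> map (val \<sigma>) d ! (2 + kk + j) = val \<sigma> (d ! (2 + kk + j))" for j
    by (intro nth; simp)+
  have conv: "(\<forall>f\<in>set (map g [0..<kk]). holds \<sigma> f) \<longleftrightarrow> (\<forall>j<kk. holds \<sigma> (g j))" for g by auto
  have six: "(\<forall>f\<in>set [f1, f2, f3, f4, f5, f6]. holds \<sigma> f) \<longleftrightarrow> holds \<sigma> f1 \<and> holds \<sigma> f2 \<and> holds \<sigma> f3 \<and>
      holds \<sigma> f4 \<and> holds \<sigma> f5 \<and> holds \<sigma> f6" for f1 f2 f3 f4 f5 f6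
    by simp
  have c: "holds \<sigma> (isc r 0) \<longleftrightarrow> val \<sigma> r = 0" "holds \<sigma> (isc r 1) \<longleftrightarrow> val \<sigma> r = 1"
    "holds \<sigma> (isc r 2) \<longleftrightarrow> val \<sigma> r = 2" for r
    using holds_isc[OF p] cm(1) by simp_all
  have r: "val \<sigma> 4 = T" "val \<sigma> 5 = T + 1" "val \<sigma> 6 = T + 2" "val \<sigma> 7 = lo" "val \<sigma> 8 = hi"
    using p by (simp_all add: params_def)
  show ?thesis
    unfolding self_fm_def self_def holds_conjs set_append ball_Un conv six nths(1,2)
      holds.simps holds_impf holds_eqf holds_lt holds_table_regs[OF assms(2)] holds_constf c r not_less conj_assoc
    by (simp only: assms(2) simp_thms ini nths(3,4) cong: all_cong imp_cong conj_cong)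
qed

lemma holds_before_fm:
  assumes d: "length d = 2 + 2 * kk" "val \<sigma> (d ! 1) < cn" and e: "length e = 2 + 2 * kk" "val \<sigma> (e ! 1) < cn"
  shows "holds \<sigma> (before_fm t d t' e) \<longleftrightarrow> before (val \<sigma> t) (map (val \<sigma>) d) (val \<sigma> t') (map (val \<sigma>) e)"
proof -
  have mv: "holds \<sigma> (move_fm m r s) \<longleftrightarrow> val \<sigma> s = move_head m (val \<sigma> r)" for m r s
  proof -
    have "holds \<sigma> (isc r 0) \<longleftrightarrow> val \<sigma> r = 0" for r using holds_isc[OF p] by simp
    moreover have "y = x - 1 \<longleftrightarrow> x = Suc y \<or> x = 0 \<and> y = 0" for x y :: nat by arith
    ultimately show ?thesis
      unfolding move_fm_def
      by (cases m) (simp_all only: head_move.case holds.simps holds_sc holds_eqf move_head.simps Suc_eq_plus1)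
  qed
  have nths: "map (val \<sigma>) x ! 0 = val \<sigma> (x ! 0)" "map (val \<sigma>) x ! 1 = val \<sigma> (x ! 1)"
    "j < kk \<Longrightarrow> map (val \<sigma>) x ! (2 + j) = val \<sigma> (x ! (2 + j))"
    "j < kk \<Longrightarrow> map (val \<sigma>) x ! (2 + kk + j) = val \<sigma> (x ! (2 + kk + j))" if "length x = 2 + 2 * kk" for j x
    using that by (intro nth_map; simp)+
  have conv: "(\<forall>f\<in>set (map g [0..<kk]). holds \<sigma> f) \<longleftrightarrow> (\<forall>j<kk. holds \<sigma> (g j))" for g by auto
  have two: "(\<forall>f\<in>set [f1, f2]. holds \<sigma> f) \<longleftrightarrow> holds \<sigma> f1 \<and> holds \<sigma> f2" for f1 f2 by simp
  note tab = holds_table_regs[OF d(2)] holds_table_regs[OF e(2)] holds_constf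
  show ?thesis
    unfolding before_fm_def before_def holds_conjs set_append ball_Un conv two nths(1,2)[OF d(1)] nths(1,2)[OF e(1)]
      holds.simps holds_impf holds_eqf holds_lt holds_sc tab mv regs(1) not_less conj_assoc
    by (simp only: nths(3,4)[OF d(1)] nths(3,4)[OF e(1)] cong: all_cong imp_cong conj_cong)
qed

text \<open>What the formula decides on all vectors, including those whose row index is out of
  range.\<close>

definition guarded_compat :: "nat \<Rightarrow> nat list \<Rightarrow> nat \<Rightarrow> nat list \<Rightarrow> bool" where
  "guarded_compat t d t' e \<longleftrightarrow> d ! 1 < cn \<and> e ! 1 < cn \<and> compat t d t' e"

lemma holds_compat_fm:
  assumes d: "length d = 2 + 2 * kk" "1 \<notin> set d" and e: "length e = 2 + 2 * kk"
  shows "holds \<sigma> (compat_fm t d t' e) \<longleftrightarrow> guarded_compat (val \<sigma> t) (map (val \<sigma>) d) (val \<sigma> t') (map (val \<sigma>) e)"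
proof (cases "val \<sigma> (d ! 1) < cn \<and> val \<sigma> (e ! 1) < cn")
  case True
  have nths: "map (val \<sigma>) d ! 1 = val \<sigma> (d ! 1)" "map (val \<sigma>) e ! 1 = val \<sigma> (e ! 1)" using d e by simp_all
  have "holds \<sigma> (compat_fm t d t' e) \<longleftrightarrow> compat (val \<sigma> t) (map (val \<sigma>) d) (val \<sigma> t') (map (val \<sigma>) e)"
  proof -
    have three: "(\<forall>f\<in>set [f1, f2, f3]. holds \<sigma> f) \<longleftrightarrow> holds \<sigma> f1 \<and> holds \<sigma> f2 \<and> holds \<sigma> f3" for f1 f2 f3
      by simp
    have len: "length d = length e" using d e by simp
    have "holds \<sigma> (before_fm t d t' e) \<longleftrightarrow> before (val \<sigma> t) (map (val \<sigma>) d) (val \<sigma> t') (map (val \<sigma>) e)"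
      "holds \<sigma> (before_fm t' e t d) \<longleftrightarrow> before (val \<sigma> t') (map (val \<sigma>) e) (val \<sigma> t) (map (val \<sigma>) d)"
      "holds \<sigma> (self_fm t d) \<longleftrightarrow> self (val \<sigma> t) (map (val \<sigma>) d)"
      using holds_before_fm holds_self_fm True d e by blast+
    note * = this
    show ?thesis
      unfolding compat_fm_def compat_def holds_conjs three holds.simps * holds_eqf holds_lt regs(8) holds_all_eq[OF len]
      using True by (cases "val \<sigma> t" "val \<sigma> t'" rule: linorder_cases) simp_all
  qed
  then show ?thesis using True unfolding guarded_compat_def nths by blast
next
  case False
  have nths: "map (val \<sigma>) d ! 1 = val \<sigma> (d ! 1)" "map (val \<sigma>) e ! 1 = val \<sigma> (e ! 1)" using d e by simp_all
  show ?thesis using False unfolding guarded_compat_def nths compat_fm_def holds_conjs by (simp add: regs(8)) blast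
qed

lemma holds_entries:
  assumes u: "length u = 5 + 2 * kk" "length v = 5 + 2 * kk" "1 \<notin> set u" "1 \<notin> set v"
  shows "(\<exists>f. (i, j, f) \<in> set (entries u v) \<and> holds \<sigma> f) \<longleftrightarrow>
     rel (T + 3) (\<lambda>t d t' e. \<not> guarded_compat t d t' e) i j
       (val \<sigma> (u ! 0)) (val \<sigma> (u ! 1)) (val \<sigma> (u ! 2)) (map (val \<sigma>) (drop 3 u))
       (val \<sigma> (v ! 0)) (val \<sigma> (v ! 1)) (val \<sigma> (v ! 2)) (map (val \<sigma>) (drop 3 v))"
proof -
  have z: "holds \<sigma> (conjs (map (\<lambda>r. isc r 0) d)) \<longleftrightarrow> zero_vec (map (val \<sigma>) d)" for d
    using holds_isc[OF p, of 0] by (auto simp: zero_vec_def)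
  have c: "holds \<sigma> (isc r 0) \<longleftrightarrow> val \<sigma> r = 0" "holds \<sigma> (isc r 1) \<longleftrightarrow> val \<sigma> r = 1"
    "holds \<sigma> (isc r 2) \<longleftrightarrow> val \<sigma> r = 2" "holds \<sigma> (isc r 3) \<longleftrightarrow> val \<sigma> r = 3" "holds \<sigma> (isc r 4) \<longleftrightarrow> val \<sigma> r = 4" for r
    using holds_isc[OF p] cm(1) by simp_all
  have cf: "holds \<sigma> (compat_fm (v ! 2) (drop 3 v) (u ! 2) (drop 3 u)) \<longleftrightarrow>
      guarded_compat (val \<sigma> (v ! 2)) (map (val \<sigma>) (drop 3 v)) (val \<sigma> (u ! 2)) (map (val \<sigma>) (drop 3 u))"
    using u by (intro holds_compat_fm) (auto dest: in_set_dropD)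
  have a: "holds \<sigma> (all_eq (drop 3 u) (drop 3 v)) \<longleftrightarrow> map (val \<sigma>) (drop 3 u) = map (val \<sigma>) (drop 3 v)"
    using u by (intro holds_all_eq) simp
  have b: "(\<exists>f. (i, j, f) \<in> set ((x, y, g) # xs) \<and> holds \<sigma> f) \<longleftrightarrow>
      i = x \<and> j = y \<and> holds \<sigma> g \<or> (\<exists>f. (i, j, f) \<in> set xs \<and> holds \<sigma> f)" for x y g xs by auto
  have b0: "(\<exists>f. (i, j, f) \<in> set [] \<and> holds \<sigma> f) \<longleftrightarrow> False" by simp
  have h: "holds \<sigma> (conjs (f # fs)) \<longleftrightarrow> holds \<sigma> f \<and> holds \<sigma> (conjs fs)" "holds \<sigma> (conjs []) \<longleftrightarrow> True" for f fs
    by simp_all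
  show ?thesis
    unfolding entries_def Let_def b b0 h z rel_def next_stage_def holds.simps cf a
    by (simp only: c regs(6) holds_eqf holds_lt holds_sc conj_assoc simp_thms)
qed

lemma holds_rank:
  assumes u: "length u = 5 + 2 * kk" "length v = 5 + 2 * kk" "1 \<notin> set u" "1 \<notin> set v"
  shows "holds \<sigma> (rank_A r u v) \<longleftrightarrow> (\<exists>j. rel (T + 3) (\<lambda>t d t' e. \<not> guarded_compat t d t' e) r j
       (val \<sigma> (u ! 0)) (val \<sigma> (u ! 1)) (val \<sigma> (u ! 2)) (map (val \<sigma>) (drop 3 u))
       (val \<sigma> (v ! 0)) (val \<sigma> (v ! 1)) (val \<sigma> (v ! 2)) (map (val \<sigma>) (drop 3 v)))"
    "holds \<sigma> (rank_B r v u) \<longleftrightarrow> (\<exists>i. rel (T + 3) (\<lambda>t d t' e. \<not> guarded_compat t d t' e) i r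
       (val \<sigma> (u ! 0)) (val \<sigma> (u ! 1)) (val \<sigma> (u ! 2)) (map (val \<sigma>) (drop 3 u))
       (val \<sigma> (v ! 0)) (val \<sigma> (v ! 1)) (val \<sigma> (v ! 2)) (map (val \<sigma>) (drop 3 v)))"
  unfolding holds_entries[OF u, symmetric] rank_A_def rank_B_def holds_disjs
  by (force split: if_splits)+

end

end


section \<open>The program that writes the instance\<close>


lemma emits_cong: "emits c X f \<Longrightarrow> (\<And>\<sigma>. f \<sigma> = g \<sigma>) \<Longrightarrow> emits c X g"
  by (simp add: ext[of f g])

lemma concat_if_replicate:
  "concat (map (\<lambda>z. if P z then [True] else []) xs) = replicate (length (filter P xs)) True"
  by (induction xs) auto

lemma load_vals:
  assumes "distinct is" "v \<in> set (vecs (length is) B)"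
  shows "map (val (load \<sigma> is v)) is = v"
  using assms load_same[of "is" v \<sigma>] by (simp add: set_vecs comp_def)

lemma load_vals_other: "set is \<inter> set rs = {} \<Longrightarrow> map (val (load \<sigma> is v)) rs = map (val \<sigma>) rs"
proof (rule map_cong)
  fix x assume "set is \<inter> set rs = {}" "x \<in> set rs"
  then have "x \<notin> set is" by auto
  then show "val (load \<sigma> is v) x = val \<sigma> x" by (simp add: load_other)
qed simp

text \<open>\<open>U\<close> runs through the owners of the lists, \<open>V\<close> through the
  candidates for an entry, and \<open>Z\<close> through the vectors that are counted in order to
  write a number. Register 2, whose length bounds all these loops, is none of them.\<close>

locale output_prog =
  fixes U V Z :: "nat list" and l :: nat
  assumes len: "length U = l" "length V = l" "length Z = l"
    and dist: "distinct (U @ V @ Z)" and two: "2 \<notin> set (U @ V @ Z)"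
begin

text \<open>The unary number of the vector in \<open>V\<close>: one \<open>True\<close> for each
  smaller vector.\<close>

definition number_A :: cmd where
  "number_A = Seq (For_vec 2 Z (cond (lexf Z V) (Emit True) Skip)) (Emit False)"

definition number_B :: cmd where
  "number_B = Seq (For_vec 2 Z (Emit True)) number_A"

abbreviation vectors :: "store \<Rightarrow> nat list list" where "vectors \<sigma> \<equiv> vecs l (val \<sigma> 2)"

lemma emits_number_A: "emits number_A (set Z) (\<lambda>\<sigma>. enc_nat (index (vectors \<sigma>) (map (val \<sigma>) V)))"
proof -
  have "emits (For_vec 2 Z (cond (lexf Z V) (Emit True) Skip)) (set Z \<union> ({} \<union> {}))
     (\<lambda>\<sigma>. concat (map (\<lambda>z. if holds (load \<sigma> Z z) (lexf Z V) then [True] else []) (vecs (length Z) (val \<sigma> 2))))"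
    by (rule emits_For_vec[OF emits_cond[OF emits_Emit emits_Skip]]) (use dist two in auto)
  from emits_Seq[OF this emits_Emit[of False]] show ?thesis
    unfolding number_A_def
  proof (rule emits_cong[OF emits_mono])
    fix \<sigma>
    have "holds (load \<sigma> Z z) (lexf Z V) \<longleftrightarrow> lexless z (map (val \<sigma>) V)" if "z \<in> set (vectors \<sigma>)" for z
    proof -
      have 1: "map (val (load \<sigma> Z z)) Z = z" by (rule load_vals) (use that dist len in auto)
      have 2: "map (val (load \<sigma> Z z)) V = map (val \<sigma>) V" by (rule load_vals_other) (use dist in auto)
      show ?thesis unfolding holds_lexf 1 2 ..
    qed
    then have "concat (map (\<lambda>z. if holds (load \<sigma> Z z) (lexf Z V) then [True] else []) (vecs (length Z) (val \<sigma> 2))) =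
       concat (map (\<lambda>z. if lexless z (map (val \<sigma>) V) then [True] else []) (vectors \<sigma>))"
      using len by (intro arg_cong[of _ _ concat] map_cong) auto
    then show "concat (map (\<lambda>z. if holds (load \<sigma> Z z) (lexf Z V) then [True] else []) (vecs (length Z) (val \<sigma> 2))) @ [False] =
       enc_nat (index (vectors \<sigma>) (map (val \<sigma>) V))"
      by (simp add: concat_if_replicate enc_nat_def index_def)
  qed simp
qed

lemma emits_count: "emits (For_vec 2 Z (Emit True)) (set Z) (\<lambda>\<sigma>. replicate (length (vectors \<sigma>)) True)"
proof -
  have "emits (For_vec 2 Z (Emit True)) (set Z \<union> {}) (\<lambda>\<sigma>. concat (map (\<lambda>_. [True]) (vecs (length Z) (val \<sigma> 2))))"
    by (rule emits_For_vec[OF emits_Emit]) (use dist two in auto)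
  then show ?thesis using len by (simp add: map_replicate_const)
qed

lemma emits_number_B:
  "emits number_B (set Z) (\<lambda>\<sigma>. enc_nat (length (vectors \<sigma>) + index (vectors \<sigma>) (map (val \<sigma>) V)))"
proof -
  have "emits number_B (set Z) (\<lambda>\<sigma>. replicate (length (vectors \<sigma>)) True @ enc_nat (index (vectors \<sigma>) (map (val \<sigma>) V)))"
    unfolding number_B_def using emits_Seq[OF emits_count emits_number_A] by simp
  then show ?thesis by (rule emits_cong) (simp add: enc_nat_def replicate_add)
qed

definition lists_prog :: "(nat \<Rightarrow> fm) \<Rightarrow> cmd \<Rightarrow> cmd" where
  "lists_prog q num = (let c = (\<lambda>r. For_vec 2 V (cond (q r) (Seq (Emit True) num) Skip)) in
     For_vec 2 U (Seq (Emit True) (Seq (Seq (c 0) (Seq (c 1) (Seq (c 2) (c 3)))) (Emit False))))"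

lemma emits_lists_prog:
  assumes q: "\<And>r. fm_ok (q r)" and num: "emits num (set Z) (\<lambda>\<sigma>. enc_nat (g \<sigma>))"
  shows "emits (lists_prog q num) (set U \<union> set V \<union> set Z) (\<lambda>\<sigma>. concat (map (\<lambda>u. True #
     concat (map (\<lambda>r. concat (map (\<lambda>v. if holds (load (load \<sigma> U u) V v) (q r)
        then True # enc_nat (g (load (load \<sigma> U u) V v)) else []) (vectors \<sigma>))) [0..<4]) @ [False]) (vectors \<sigma>)))"
proof -
  let ?f = "\<lambda>r \<sigma>. concat (map (\<lambda>v. if holds (load \<sigma> V v) (q r) then [True] @ enc_nat (g (load \<sigma> V v)) else []) (vecs (length V) (val \<sigma> 2)))"
  let ?c = "\<lambda>r. For_vec 2 V (cond (q r) (Seq (Emit True) num) Skip)"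
  have c: "emits (?c r) (set V \<union> set Z) (?f r)" for r
  proof -
    have "emits (?c r) (set V \<union> (({} \<union> set Z) \<union> {})) (?f r)"
      by (rule emits_For_vec[OF emits_cond[OF emits_Seq[OF emits_Emit num] emits_Skip q]])
        (use dist two in auto)
    then show ?thesis by simp
  qed
  note body = emits_Seq[OF emits_Emit emits_Seq[OF emits_Seq[OF c emits_Seq[OF c emits_Seq[OF c c]]] emits_Emit]]
  have "emits (lists_prog q num) (set U \<union> ({} \<union> ((set V \<union> set Z \<union> (set V \<union> set Z \<union> (set V \<union> set Z \<union> (set V \<union> set Z)))) \<union> {})))
    (\<lambda>\<sigma>. concat (map (\<lambda>u. (\<lambda>\<sigma>. [True] @ (?f 0 \<sigma> @ ?f 1 \<sigma> @ ?f 2 \<sigma> @ ?f 3 \<sigma>) @ [False]) (load \<sigma> U u)) (vecs (length U) (val \<sigma> 2))))"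
    unfolding lists_prog_def Let_def
    by (rule emits_For_vec[OF body]) (use dist two in auto)
  then show ?thesis
  proof (rule emits_cong[OF emits_mono])
    fix \<sigma>
    have "val (load \<sigma> U u) 2 = val \<sigma> 2" for u using two by (simp add: load_other)
    then show "concat (map (\<lambda>u. (\<lambda>\<sigma>. [True] @ (?f 0 \<sigma> @ ?f 1 \<sigma> @ ?f 2 \<sigma> @ ?f 3 \<sigma>) @ [False]) (load \<sigma> U u)) (vecs (length U) (val \<sigma> 2))) =
      concat (map (\<lambda>u. True #
     concat (map (\<lambda>r. concat (map (\<lambda>v. if holds (load (load \<sigma> U u) V v) (q r)
        then True # enc_nat (g (load (load \<sigma> U u) V v)) else []) (vectors \<sigma>))) [0..<4]) @ [False]) (vectors \<sigma>))"
    proof -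
      have four: "[0..<4] = [0, 1, 2, 3]" by (simp add: upt_rec)
      show ?thesis
        unfolding len four using \<open>\<And>u. val (load \<sigma> U u) 2 = val \<sigma> 2\<close> by (simp cong: if_cong)
    qed
  qed auto
qed

lemma concat_rows:
  "concat (map (\<lambda>r. concat (map (\<lambda>v. if Q r u v then True # enc_nat (f v) else []) vs)) [0..<4]) @ [False] =
   enc_list enc_nat (map f (row vs Q u))"
proof -
  have "concat (map (\<lambda>v. if P v then True # enc_nat (f v) else []) vs) =
      concat (map (\<lambda>v. True # enc_nat (f v)) (filter P vs))" for P
    by (induction vs) auto
  then show ?thesis by (simp add: enc_list_def row_def map_concat concat_concat comp_def)
qed

definition main_prog :: "(nat \<Rightarrow> fm) \<Rightarrow> (nat \<Rightarrow> fm) \<Rightarrow> cmd" where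
  "main_prog qa qb = Seq (For_vec 2 Z (Emit True)) (Seq (Emit False)
     (Seq (lists_prog qa number_B) (Seq (lists_prog qb number_A) (Emit False))))"

text \<open>The output \<open>F\<close> is fixed by the formulas alone. It is the encoding of an
  instance for whatever relations the formulas decide in the store at hand, so the meaning of the
  formulas can be supplied later, for each input separately.\<close>

lemma emits_main_prog:
  assumes ok: "\<And>r. fm_ok (qa r)" "\<And>r. fm_ok (qb r)"
  shows "\<exists>F. emits (main_prog qa qb) (set U \<union> set V \<union> set Z) F \<and>
    (\<forall>\<sigma> QA QB. (\<forall>u\<in>set (vectors \<sigma>). \<forall>v\<in>set (vectors \<sigma>). \<forall>r. 
        (holds (load (load \<sigma> U u) V v) (qa r) \<longleftrightarrow> QA r u v) \<and>
        (holds (load (load \<sigma> U u) V v) (qb r) \<longleftrightarrow> QB r u v)) \<longrightarrow> F \<sigma> = enc_instance (inst (vectors \<sigma>) QA QB))"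
proof -
  note main = emits_Seq[OF emits_count emits_Seq[OF emits_Emit[of False]
     emits_Seq[OF emits_lists_prog[OF ok(1) emits_number_B] emits_Seq[OF emits_lists_prog[OF ok(2) emits_number_A] emits_Emit[of False]]]]]
  let ?F = "\<lambda>\<sigma>. replicate (length (vectors \<sigma>)) True @ [False] @
      concat (map (\<lambda>u. True # concat (map (\<lambda>r. concat (map (\<lambda>v. if holds (load (load \<sigma> U u) V v) (qa r)
        then True # enc_nat (length (vectors (load (load \<sigma> U u) V v)) +
           index (vectors (load (load \<sigma> U u) V v)) (map (val (load (load \<sigma> U u) V v)) V)) else []) (vectors \<sigma>))) [0..<4]) @ [False]) (vectors \<sigma>)) @
      concat (map (\<lambda>u. True # concat (map (\<lambda>r. concat (map (\<lambda>v. if holds (load (load \<sigma> U u) V v) (qb r)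
        then True # enc_nat (index (vectors (load (load \<sigma> U u) V v)) (map (val (load (load \<sigma> U u) V v)) V)) else []) (vectors \<sigma>))) [0..<4]) @ [False]) (vectors \<sigma>)) @ [False]"
  show ?thesis
    unfolding main_prog_def
  proof (intro exI[of _ ?F] conjI allI impI)
    show "emits (Seq (For_vec 2 Z (Emit True)) (Seq (Emit False)
     (Seq (lists_prog qa number_B) (Seq (lists_prog qb number_A) (Emit False))))) (set U \<union> set V \<union> set Z) ?F"
      by (rule emits_mono[OF main]) auto
  next
    fix \<sigma> QA QB
    let ?vs = "vectors \<sigma>"
    assume hyp: "\<forall>u\<in>set ?vs. \<forall>v\<in>set ?vs. \<forall>r. 
        (holds (load (load \<sigma> U u) V v) (qa r) \<longleftrightarrow> QA r u v) \<and>
        (holds (load (load \<sigma> U u) V v) (qb r) \<longleftrightarrow> QB r u v)"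
    have vec: "vectors (load (load \<sigma> U u) V v) = ?vs" for u v
      using two by (simp add: load_other)
    have V: "map (val (load (load \<sigma> U u) V v)) V = v" if "v \<in> set ?vs" for u v
      using load_vals[of V v] that len dist by simp
    have A: "concat (map (\<lambda>r. concat (map (\<lambda>v. if holds (load (load \<sigma> U u) V v) (qa r)
        then True # enc_nat (length (vectors (load (load \<sigma> U u) V v)) +
           index (vectors (load (load \<sigma> U u) V v)) (map (val (load (load \<sigma> U u) V v)) V)) else []) ?vs)) [0..<4]) @ [False] =
        enc_list enc_nat (map (\<lambda>v. length ?vs + index ?vs v) (row ?vs QA u))" if "u \<in> set ?vs" for u
      unfolding concat_rows[symmetric] vec using hyp that V by (simp cong: map_cong if_cong)
    have B: "concat (map (\<lambda>r. concat (map (\<lambda>v. if holds (load (load \<sigma> U u) V v) (qb r)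
        then True # enc_nat (index (vectors (load (load \<sigma> U u) V v)) (map (val (load (load \<sigma> U u) V v)) V)) else []) ?vs)) [0..<4]) @ [False] =
        enc_list enc_nat (map (index ?vs) (row ?vs QB u))" if "u \<in> set ?vs" for u
      unfolding concat_rows[symmetric] vec using hyp that V by (simp cong: map_cong if_cong)
    show "replicate (length ?vs) True @ [False] @
      concat (map (\<lambda>u. True # concat (map (\<lambda>r. concat (map (\<lambda>v. if holds (load (load \<sigma> U u) V v) (qa r)
        then True # enc_nat (length (vectors (load (load \<sigma> U u) V v)) +
           index (vectors (load (load \<sigma> U u) V v)) (map (val (load (load \<sigma> U u) V v)) V)) else []) ?vs)) [0..<4]) @ [False]) ?vs) @
      concat (map (\<lambda>u. True # concat (map (\<lambda>r. concat (map (\<lambda>v. if holds (load (load \<sigma> U u) V v) (qb r)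
        then True # enc_nat (index (vectors (load (load \<sigma> U u) V v)) (map (val (load (load \<sigma> U u) V v)) V)) else []) ?vs)) [0..<4]) @ [False]) ?vs) @ [False] =
      enc_instance (inst ?vs QA QB)"
      using A B by (simp add: inst_def enc_nat_def[of "length _"] enc_list_def[of "enc_list enc_nat"] comp_def cong: map_cong)
  qed
qed

end

text \<open>Register 1 receives the known part of the verifier's input: a dummy bit for the marker,
  the doubled input and the separator.\<close>

definition word_prog :: "nat \<Rightarrow> cmd" where
  "word_prog i = Seq (App 1 True) (Seq (For i 0 (cond (Test i 0 False {3})
     (Seq (App 1 True) (App 1 True)) (Seq (App 1 False) (App 1 False)))) (Seq (App 1 False) (App 1 True)))"

definition double_word :: "bool list \<Rightarrow> bool list" where
  "double_word x = True # concat (map (\<lambda>b. [b, b]) x)"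

lemma big_step_word_prog:
  assumes i: "i \<noteq> 0" "i \<noteq> 1"
  shows "\<exists>q :: nat poly. \<forall>\<sigma>. \<sigma> 1 = [] \<longrightarrow> \<sigma> i = [] \<longrightarrow>
    big_step (word_prog i) \<sigma> [] (\<sigma>(1 := double_word (\<sigma> 0) @ [False, True])) (poly q (length (\<sigma> 0)))"
proof (intro exI allI impI)
  fix \<sigma> :: store assume e: "\<sigma> 1 = []" "\<sigma> i = []"
  let ?x = "\<sigma> 0"
  let ?n = "length ?x"
  let ?t = "12 * ?n + 100"
  let ?s = "\<lambda>v. \<sigma>(1 := double_word (take v ?x))"
  have len: "length (double_word y) = 2 * length y + 1" for y by (induction y) (auto simp: double_word_def)
  have app: "big_step (App 1 b) (\<sigma>'(1 := w)) [] (\<sigma>'(1 := w @ [b])) t" if "3 * length w + 10 \<le> t" for \<sigma>' w b t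
    using big_step_App[of "\<sigma>'(1 := w)" 1 t b] that by simp
  have app2: "big_step (Seq (App 1 b) (App 1 c)) (\<sigma>'(1 := w)) [] (\<sigma>'(1 := w @ [b, c])) t"
    if "6 * length w + 23 \<le> t" for \<sigma>' w b c t
    using big_step_Seq[OF app[where w = w and t = "3 * length w + 10"] app[where w = "w @ [b]" and t = "3 * length w + 13"]] that by simp
  have 1: "big_step (App 1 True) \<sigma> [] (?s 0) 10"
    using app[where w = "[]" and t = 10 and \<sigma>' = \<sigma> and b = True] e by (simp add: double_word_def fun_upd_idem)
  have main: "big_step (For i 0 (cond (Test i 0 False {3}) (Seq (App 1 True) (App 1 True)) (Seq (App 1 False) (App 1 False))))
      ((?s 0)(i := [])) (concat (map (\<lambda>_. []) [0..<?n])) ((?s ?n)(i := []))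
      ((?n + 1) * ((12 * ?n + 29 + 1 * (3 * (3 * ?n + 3) + 12)) + 6 * ?n + 22))"
  proof (rule big_step_For[OF i(1)])
    fix v assume v: "v < ?n"
    let ?\<sigma> = "(?s v)(i := unary v)"
    have t: "holds ?\<sigma> (Test i 0 False {3}) \<longleftrightarrow> ?x ! v"
      using i v by (cases "?x ! v") (auto simp: test_def word_tape_def)
    have eq: "?\<sigma> = (\<sigma>(i := unary v))(1 := double_word (take v ?x))"
      "(?s (Suc v))(i := unary v) = (\<sigma>(i := unary v))(1 := double_word (take v ?x) @ [?x ! v, ?x ! v])"
      using i v by (auto simp: take_Suc_conv_app_nth double_word_def)
    have "big_step (if ?x ! v then Seq (App 1 True) (App 1 True) else Seq (App 1 False) (App 1 False))
        ?\<sigma> [] ((?s (Suc v))(i := unary v)) (12 * ?n + 29)"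
      unfolding eq using app2[where w = "double_word (take v ?x)" and t = "12 * ?n + 29"] len[of "take v ?x"] v
      by (cases "?x ! v") auto
    then have "big_step (if holds ?\<sigma> (Test i 0 False {3}) then Seq (App 1 True) (App 1 True) else Seq (App 1 False) (App 1 False))
        ?\<sigma> [] ((?s (Suc v))(i := unary v)) (12 * ?n + 29)"
      unfolding t .
    moreover have "3 * length (?\<sigma> i) + 12 \<le> 3 * (3 * ?n + 3) + 12" using v by simp
    ultimately show "big_step (cond (Test i 0 False {3}) (Seq (App 1 True) (App 1 True)) (Seq (App 1 False) (App 1 False)))
        ?\<sigma> [] ((?s (Suc v))(i := unary v)) (12 * ?n + 29 + 1 * (3 * (3 * ?n + 3) + 12))"
      by (auto split: if_splits intro: big_step_CondT big_step_CondF)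
  qed simp
  have same: "(?s v)(i := []) = ?s v" for v using e i by auto
  have nil: "concat (map (\<lambda>_. []) [0..<?n]) = ([] :: bool list)" by simp
  have arith: "(?n + 1) * ((12 * ?n + 29 + 1 * (3 * (3 * ?n + 3) + 12)) + 6 * ?n + 22) = (?n + 1) * (27 * ?n + 72)"
    by simp
  have 2: "big_step (For i 0 (cond (Test i 0 False {3}) (Seq (App 1 True) (App 1 True)) (Seq (App 1 False) (App 1 False))))
      (?s 0) [] (?s ?n) ((?n + 1) * (27 * ?n + 72))"
    using main unfolding same nil arith .
  have 3: "big_step (Seq (App 1 False) (App 1 True)) (?s ?n) [] (\<sigma>(1 := double_word ?x @ [False, True])) (12 * ?n + 29)"
    using app2[where w = "double_word ?x" and t = "12 * ?n + 29"] len[of ?x] by simp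
  show "big_step (word_prog i) \<sigma> [] (\<sigma>(1 := double_word ?x @ [False, True])) (poly ([:10:] + [:1, 1:] * [:72, 27:] + [:29, 12:]) ?n)"
    unfolding word_prog_def
    using big_step_Seq[OF 1 big_step_Seq[OF 2 3 order_refl] order_refl] by (simp add: algebra_simps)
qed

lemma poly_nat_mono: "a \<le> b \<Longrightarrow> poly p a \<le> poly p b" for p :: "nat poly"
  by (induction p) (auto intro!: mult_mono add_mono)


section \<open>The reduction\<close>


text \<open>The verifier \<open>M\<close> runs for at most \<open>pv\<close> steps, and \<open>p\<close> bounds the length of the certificates.\<close>

locale reduction =
  fixes M :: turing_machine and rows :: "(nat \<times> nat list) list" and p pv :: "nat poly"
  assumes wf: "wf_tm M" and rows: "set rows = valid_rows M"
begin

abbreviation (input) k :: nat where "k \<equiv> num_tapes M"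

text \<open>The largest length of a verifier input: the doubled word, the separator and a
  certificate of maximal length.\<close>

definition hi_poly :: "nat poly" where "hi_poly = [:2, 2:] + p"
definition T_poly :: "nat poly" where "T_poly = pcompose pv hi_poly"
text \<open>The largest constant with which formulas compare: the kinds of nodes go up to 4, and the
  row indices are bounded by \<open>length rows\<close>.\<close>

definition cm :: nat where "cm = max 4 (length rows)"
text \<open>A strict bound for every entry of a code vector that is needed, be it a length, a time,
  a position, a row index or a kind. It also bounds the prepared contents of all registers.\<close>

definition B_poly :: "nat poly" where "B_poly = T_poly + hi_poly + [:cm + 5:]"

definition input_word :: "bool list \<Rightarrow> bool list" where "input_word x = double_word x @ [False, True]"
definition lo :: "bool list \<Rightarrow> nat" where "lo x = 2 * length x + 2"
definition hi :: "bool list \<Rightarrow> nat" where "hi x = poly hi_poly (length x)"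
definition T :: "bool list \<Rightarrow> nat" where "T x = poly T_poly (length x)"
definition B :: "bool list \<Rightarrow> nat" where "B x = poly B_poly (length x)"

lemma hi_eq: "hi x = lo x + poly p (length x)"
  by (simp add: hi_def lo_def hi_poly_def)

lemma B_eq: "B x = T x + hi x + cm + 5"
  by (simp add: B_def T_def hi_def B_poly_def)

definition D :: "bool list \<Rightarrow> nat list set" where
  "D x = {d. length d = 2 + 2 * k \<and> set d \<subseteq> {..<B x}}"

text \<open>The guards are those of \<open>compat_fm\<close>, so that the formula decides exactly
  the complement of this relation.\<close>

definition C :: "bool list \<Rightarrow> nat \<Rightarrow> nat list \<Rightarrow> nat \<Rightarrow> nat list \<Rightarrow> bool" where
  "C x t d t' e \<longleftrightarrow> \<not> (d ! 1 < length rows \<and> e ! 1 < length rows \<and>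
     tableau.compat M rows (input_word x) (lo x) (hi x) (T x) t d t' e)"

abbreviation w :: nat where "w \<equiv> 2 + 2 * k"
abbreviation vs :: "bool list \<Rightarrow> nat list list" where "vs x \<equiv> vecs (3 + w) (B x)"

lemma finite_D: "finite (D x)"
proof -
  have "finite {d. set d \<subseteq> {..<B x} \<and> length d = w}" by (rule finite_lists_length_eq) simp
  then show ?thesis by (simp add: D_def conj_commute)
qed

lemma coded: "coded_layered (vs x) (T x + 3) (D x) (C x) (code_A w (T x + 3)) (code_B w (T x + 3))"
proof
  show "sorted_wrt lexless (vs x)" by (rule sorted_vecs)
  show "finite (D x)" by (rule finite_D)
  show "inj (code_A w (T x + 3))" "inj (code_B w (T x + 3))" by (rule inj_code_A inj_code_B)+
  fix a b assume "adj (T x + 3) (D x) (C x) a b \<noteq> None"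
  then show "code_A w (T x + 3) a \<in> set (vs x) \<and> code_B w (T x + 3) b \<in> set (vs x)"
    by (intro code_bounds[OF _ D_def[of x]]) (simp_all add: B_eq)
qed

abbreviation inst_of :: "bool list \<Rightarrow> pref_lists" where
  "inst_of x \<equiv> inst (vs x)
     (coded_layered.RA (T x + 3) (D x) (C x) (code_A w (T x + 3)) (code_B w (T x + 3)))
     (coded_layered.RB (T x + 3) (D x) (C x) (code_A w (T x + 3)) (code_B w (T x + 3)))"

lemma inst_of_iff:
  assumes comp: "\<And>u. computes_within M (pair_word x u) (f (pair_word x u)) (poly pv (length (pair_word x u)))"
  shows "enc_instance (inst_of x) \<in> popular_neither_stable_nor_dominant \<longleftrightarrow>
     (\<exists>u. length u \<le> poly p (length x) \<and> f (pair_word x u) = [True])"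
proof -
  interpret coded_layered "vs x" "T x + 3" "D x" "C x" "code_A w (T x + 3)" "code_B w (T x + 3)"
    by (rule coded)
  interpret tab: tableau M rows "input_word x" "lo x" "hi x" "T x" "B x"
    by unfold_locales (rule wf rows)+
  have W: "input_word x = True # concat (map (\<lambda>b. [b, b]) x) @ [False, True]"
    by (simp add: input_word_def double_word_def)
  have hi: "hi x - lo x = poly p (length x)" by (simp add: hi_eq)
  have comp': "computes_within M (pair_word x u) (f (pair_word x u)) (T x)" if "length u \<le> hi x - lo x" for u
  proof -
    \<comment> \<open>\<open>T x\<close> is the time bound for the longest input, and polynomials
      with natural coefficients are monotone; thus one number of steps serves all
      certificates.\<close>
    have "length (pair_word x u) \<le> hi x" using that by (simp add: length_pair_word hi_eq lo_def)
    then have "poly pv (length (pair_word x u)) \<le> T x"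
      by (simp add: T_def T_poly_def poly_pcompose hi_def poly_nat_mono)
    then show ?thesis using comp[of u] unfolding computes_within_def by (meson le_trans)
  qed
  have "(\<exists>ch ch'. (\<forall>t<T x + 3. ch t \<in> D x \<and> ch' t \<in> D x) \<and> (\<forall>t<T x + 3. \<forall>t'<T x + 3. \<not> C x t (ch t) t' (ch' t')))
    \<longleftrightarrow> (\<exists>u. length u \<le> poly p (length x) \<and> f (pair_word x u) = [True])" (is "?L \<longleftrightarrow> ?R")
  proof
    assume ?L
    then obtain ch ch' where "\<And>t t'. t < T x + 3 \<Longrightarrow> t' < T x + 3 \<Longrightarrow> tab.compat t (ch t) t' (ch' t')"
      unfolding C_def by blast
    from tab.accepting_of_items[OF W lo_def comp' this] show ?R unfolding hi by blast
  next
    assume ?R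
    then obtain u where u: "length u \<le> hi x - lo x" "f (pair_word x u) = [True]" unfolding hi by blast
    have "\<exists>ch. (\<forall>t<T x + 3. ch t \<in> tab.items) \<and> (\<forall>t<T x + 3. \<forall>t'<T x + 3. tab.compat t (ch t) t' (ch t'))"
      by (rule tab.items_of_accepting[OF W lo_def _ u(1)])
        (use comp'[OF u(1)] u(2) in \<open>simp_all add: hi_eq B_eq cm_def\<close>)
    then obtain ch where ch: "\<And>t. t < T x + 3 \<Longrightarrow> ch t \<in> tab.items"
      "\<And>t t'. t < T x + 3 \<Longrightarrow> t' < T x + 3 \<Longrightarrow> tab.compat t (ch t) t' (ch t')" by blast
    \<comment> \<open>Compatibility of an item with itself contains the range condition of the
      guards.\<close>
    have "ch t ! 1 < length rows" if "t < T x + 3" for t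
      using ch(2)[OF that that] by (simp add: tab.compat_def tab.self_def)
    moreover have "tab.items = D x" by (simp add: tab.items_def D_def)
    ultimately show ?L using ch unfolding C_def by blast
  qed
  then show ?thesis using inst_in_language_iff by simp
qed

text \<open>The first register behind the parameters 0 to 8 and the constants in 9 to
  \<open>9 + cm\<close>.\<close>

definition ub :: nat where "ub = 10 + cm"
definition reg_U :: "nat list" where "reg_U = [ub..<ub + (3 + w)]"
definition reg_V :: "nat list" where "reg_V = [ub + (3 + w)..<ub + 2 * (3 + w)]"
definition reg_Z :: "nat list" where "reg_Z = [ub + 2 * (3 + w)..<ub + 3 * (3 + w)]"

sublocale output_prog reg_U reg_V reg_Z "3 + w"
  by unfold_locales (auto simp: reg_U_def reg_V_def reg_Z_def ub_def)

text \<open>The vectors are loaded into registers from \<open>ub\<close> on, so the parameters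
  survive. A vector splits into the three digits and the item, which turns \<open>rel\<close> into
  the relation on codes.\<close>

lemma holds_ranks:
  assumes p: "params cm (input_word x) (lo x) (hi x) (T x) (B x) \<sigma>" and uv: "u \<in> set (vs x)" "v \<in> set (vs x)"
  defines "\<sigma>' \<equiv> load (load \<sigma> reg_U u) reg_V v"
  shows "holds \<sigma>' (rank_A M rows r reg_U reg_V) \<longleftrightarrow>
      coded_layered.RA (T x + 3) (D x) (C x) (code_A w (T x + 3)) (code_B w (T x + 3)) r u v"
    "holds \<sigma>' (rank_B M rows r reg_U reg_V) \<longleftrightarrow>
      coded_layered.RB (T x + 3) (D x) (C x) (code_A w (T x + 3)) (code_B w (T x + 3)) r u v"
proof -
  interpret coded_layered "vs x" "T x + 3" "D x" "C x" "code_A w (T x + 3)" "code_B w (T x + 3)"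
    by (rule coded)
  have small: "r \<notin> set reg_U" "r \<notin> set reg_V" if "r < ub" for r
    using that by (auto simp: reg_U_def reg_V_def)
  have same: "\<sigma>' r = \<sigma> r" if "r < ub" for r
    using small[OF that] by (simp add: \<sigma>'_def load_other)
  have p': "params cm (input_word x) (lo x) (hi x) (T x) (B x) \<sigma>'"
    using p same by (simp add: params_def ub_def)
  have "map (val \<sigma>') reg_U = map (val (load \<sigma> reg_U u)) reg_U"
    unfolding \<sigma>'_def by (rule load_vals_other) (use dist in auto)
  also have "\<dots> = u" by (rule load_vals) (use dist uv len in auto)
  finally have U: "map (val \<sigma>') reg_U = u" .
  have V: "map (val \<sigma>') reg_V = v" unfolding \<sigma>'_def by (rule load_vals) (use dist uv len in auto)
  have l: "length reg_U = 5 + 2 * k" "length reg_V = 5 + 2 * k" using len by simp_all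
  have one: "1 \<notin> set reg_U" "1 \<notin> set reg_V" using small[of 1] by (simp_all add: ub_def)
  have cm: "4 \<le> cm" "length rows \<le> cm" by (simp_all add: cm_def)
  have C: "(\<lambda>t d t' e. \<not> guarded_compat M rows (input_word x) (lo x) (hi x) (T x) t d t' e) = C x"
    unfolding C_def guarded_compat_def[OF wf rows p' cm] by blast
  have D: "drop 3 u \<in> D x" "drop 3 v \<in> D x"
    using uv by (auto simp: set_vecs D_def dest: in_set_dropD)
  have split: "[y ! 0, y ! 1, y ! 2] @ drop 3 y = y" if "y \<in> set (vs x)" for y
  proof -
    have "3 \<le> length y" using that by (simp add: set_vecs)
    then obtain a b c zs where "y = a # b # c # zs" by (metis Suc_le_length_iff numeral_3_eq_3)
    then show ?thesis by simp
  qed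
  have nthU: "val \<sigma>' (reg_U ! i) = u ! i" if "i < 5 + 2 * k" for i
    unfolding U[symmetric] using that l by simp
  have nthV: "val \<sigma>' (reg_V ! i) = v ! i" if "i < 5 + 2 * k" for i
    unfolding V[symmetric] using that l by simp
  have dropU: "map (val \<sigma>') (drop 3 reg_U) = drop 3 u" unfolding U[symmetric] drop_map ..
  have dropV: "map (val \<sigma>') (drop 3 reg_V) = drop 3 v" unfolding V[symmetric] drop_map ..
  have n: "0 < T x + 3" by simp
  have "holds \<sigma>' (rank_A M rows r reg_U reg_V) \<longleftrightarrow> (\<exists>j. rel (T x + 3) (C x) r j (u ! 0) (u ! 1) (u ! 2) (drop 3 u) (v ! 0) (v ! 1) (v ! 2) (drop 3 v))"
    unfolding holds_rank(1)[OF wf rows p' cm l one] C dropU dropV by (simp add: nthU nthV)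
  then show "holds \<sigma>' (rank_A M rows r reg_U reg_V) \<longleftrightarrow> RA r u v"
    unfolding rel_iff[OF n D_def D] RA_def split[OF uv(1)] split[OF uv(2)] by blast
  have "holds \<sigma>' (rank_B M rows r reg_U reg_V) \<longleftrightarrow> (\<exists>i. rel (T x + 3) (C x) i r (v ! 0) (v ! 1) (v ! 2) (drop 3 v) (u ! 0) (u ! 1) (u ! 2) (drop 3 u))"
    unfolding holds_rank(2)[OF wf rows p' cm l(2,1) one(2,1)] C dropU dropV by (simp add: nthU nthV)
  then show "holds \<sigma>' (rank_B M rows r reg_U reg_V) \<longleftrightarrow> RB r u v"
    unfolding rel_iff[OF n D_def D(2,1)] RB_def split[OF uv(1)] split[OF uv(2)] by blast
qed

definition regs_init :: "(nat \<times> nat poly) list" where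
  "regs_init = [(2, B_poly), (3, T_poly + [:3:]), (4, T_poly), (5, T_poly + [:1:]), (6, T_poly + [:2:]),
     (7, [:2, 2:]), (8, hi_poly)] @ map (\<lambda>c. (9 + c, [:c:])) [0..<Suc cm]"

lemma distinct_regs_init: "distinct (map fst regs_init)"
  by (auto simp: regs_init_def comp_def distinct_map inj_on_def simp del: upt_Suc)

lemma fst_regs_init: "fst ` set regs_init \<subseteq> {2..<ub}"
  by (auto simp: regs_init_def ub_def)

lemma length_double_word: "length (double_word x) = 2 * length x + 1"
  by (induction x) (auto simp: double_word_def)

lemma polytime_inst_of: "polytime_computable (\<lambda>x. enc_instance (inst_of x))"
proof -
  have ub: "ub \<noteq> 0" "ub \<noteq> 1" by (simp_all add: ub_def)
  obtain q1 :: "nat poly" where q1: "\<And>\<sigma>. \<sigma> 1 = [] \<Longrightarrow> \<sigma> ub = [] \<Longrightarrow>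
      big_step (word_prog ub) \<sigma> [] (\<sigma>(1 := input_word (\<sigma> 0))) (poly q1 (length (\<sigma> 0)))"
    using big_step_word_prog[OF ub] unfolding input_word_def by blast
  let ?F = "{..<ub + 3 * (3 + w)}"
  have "0 \<notin> fst ` set regs_init" using fst_regs_init by fastforce
  from ex_set_regs[OF distinct_regs_init this, of ?F] obtain c X and q2 :: "nat poly" where
    c: "X \<inter> ?F = {}" "tests_ok c" and
    q2: "\<And>\<sigma>. \<forall>i\<in>X \<union> fst ` set regs_init. \<sigma> i = [] \<Longrightarrow> big_step c \<sigma> [] (set_regs regs_init \<sigma>) (poly q2 (length (\<sigma> 0)))"
    by auto
  let ?main = "main_prog (\<lambda>r. rank_A M rows r reg_U reg_V) (\<lambda>r. rank_B M rows r reg_U reg_V)"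
  let ?hyp = "\<lambda>\<sigma> QA QB. \<forall>u\<in>set (vectors \<sigma>). \<forall>v\<in>set (vectors \<sigma>). \<forall>r.
        (holds (load (load \<sigma> reg_U u) reg_V v) (rank_A M rows r reg_U reg_V) \<longleftrightarrow> QA r u v) \<and>
        (holds (load (load \<sigma> reg_U u) reg_V v) (rank_B M rows r reg_U reg_V) \<longleftrightarrow> QB r u v)"
  obtain F where F: "emits ?main (set reg_U \<union> set reg_V \<union> set reg_Z) F"
    "\<forall>\<sigma> QA QB. ?hyp \<sigma> QA QB \<longrightarrow> F \<sigma> = enc_instance (inst (vectors \<sigma>) QA QB)"
    using emits_main_prog[of "\<lambda>r. rank_A M rows r reg_U reg_V" "\<lambda>r. rank_B M rows r reg_U reg_V", OF fm_ok_rank]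
    by (elim exE conjE) (rule that)
  from F(1) obtain q3 :: "nat poly" where q3: "\<And>\<sigma> b. \<forall>r. length (\<sigma> r) \<le> b \<Longrightarrow>
      \<forall>i\<in>set reg_U \<union> set reg_V \<union> set reg_Z. \<sigma> i = [] \<Longrightarrow> big_step ?main \<sigma> (F \<sigma>) \<sigma> (poly q3 b)"
    and ok: "tests_ok ?main"
    unfolding emits_def by blast
  let ?prog = "Seq (word_prog ub) (Seq c ?main)"
  \<comment> \<open>When the main program starts, all registers are bounded by \<open>B x\<close>,
    so its time is a polynomial in this number.\<close>
  let ?q = "q1 + (q2 + pcompose q3 B_poly)"
  have "\<exists>\<sigma>'. big_step ?prog ((\<lambda>_. [])(0 := x)) (enc_instance (inst_of x)) \<sigma>' (poly ?q (length x))" for x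
  proof -
    let ?n = "length x"
    let ?\<sigma>0 = "(\<lambda>_. [])(0 := x)"
    let ?\<sigma>1 = "?\<sigma>0(1 := input_word x)"
    let ?\<sigma>2 = "set_regs regs_init ?\<sigma>1"
    have 1: "big_step (word_prog ub) ?\<sigma>0 [] ?\<sigma>1 (poly q1 ?n)" using q1[of ?\<sigma>0] ub by simp
    have "\<forall>i\<in>X \<union> fst ` set regs_init. ?\<sigma>1 i = []"
    proof
      fix i assume "i \<in> X \<union> fst ` set regs_init"
      then have "i \<noteq> 0" "i \<noteq> 1" using c(1) fst_regs_init by (auto simp: ub_def)
      then show "?\<sigma>1 i = []" by simp
    qed
    from q2[of ?\<sigma>1, OF this] have 2: "big_step c ?\<sigma>1 [] ?\<sigma>2 (poly q2 ?n)" by simp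
    have reg: "?\<sigma>2 r = unary (poly P ?n)" if "(r, P) \<in> set regs_init" for r P
      using map_of_is_SomeI[OF distinct_regs_init that] by (simp add: set_regs_def)
    have other: "?\<sigma>2 r = ?\<sigma>1 r" if "r \<notin> fst ` set regs_init" for r
      using that by (simp add: set_regs_def map_of_eq_None_iff[THEN iffD2])
    have "1 \<notin> fst ` set regs_init" using fst_regs_init by fastforce
    then have "?\<sigma>2 1 = input_word x" using other[of 1] by simp
    moreover have "val ?\<sigma>2 (9 + c) = c" if "c \<le> cm" for c
    proof -
      have "(9 + c, [:c:]) \<in> set regs_init"
        using that by (auto simp: regs_init_def simp del: upt_Suc)
      from reg[OF this] show ?thesis by simp
    qed
    moreover have "val ?\<sigma>2 2 = B x" "val ?\<sigma>2 3 = T x + 3" "val ?\<sigma>2 4 = T x" "val ?\<sigma>2 5 = T x + 1"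
      "val ?\<sigma>2 6 = T x + 2" "val ?\<sigma>2 7 = lo x" "val ?\<sigma>2 8 = hi x"
      using reg[of 2 B_poly] reg[of 3 "T_poly + [:3:]"] reg[of 4 T_poly] reg[of 5 "T_poly + [:1:]"]
        reg[of 6 "T_poly + [:2:]"] reg[of 7 "[:2, 2:]"] reg[of 8 hi_poly]
      by (simp_all add: regs_init_def B_def T_def lo_def hi_def)
    ultimately have params: "params cm (input_word x) (lo x) (hi x) (T x) (B x) ?\<sigma>2"
      by (simp add: params_def)
    then have vec: "vectors ?\<sigma>2 = vs x" by (simp add: params_def)
    have empty: "\<forall>i\<in>set reg_U \<union> set reg_V \<union> set reg_Z. ?\<sigma>2 i = []"
    proof
      fix i assume "i \<in> set reg_U \<union> set reg_V \<union> set reg_Z"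
      then have "ub \<le> i" by (auto simp: reg_U_def reg_V_def reg_Z_def)
      then have "i \<notin> fst ` set regs_init" "i \<noteq> 0" "i \<noteq> 1" using fst_regs_init by (auto simp: ub_def)
      then show "?\<sigma>2 i = []" using other[of i] by simp
    qed
    have bound: "\<forall>r. length (?\<sigma>2 r) \<le> B x"
    proof
      fix r
      show "length (?\<sigma>2 r) \<le> B x"
      proof (cases "r \<in> fst ` set regs_init")
        case True
        then obtain P where P: "(r, P) \<in> set regs_init" by auto
        then have "poly P ?n \<le> B x"
          by (auto simp: regs_init_def B_eq hi_eq lo_def T_def B_def[symmetric] hi_def[symmetric])
        then show ?thesis using reg[OF P] by simp
      next
        case False
        then show ?thesis
          using other[of r] by (auto simp: B_eq hi_eq lo_def input_word_def length_double_word)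
      qed
    qed
    let ?QA = "coded_layered.RA (T x + 3) (D x) (C x) (code_A w (T x + 3)) (code_B w (T x + 3))"
    let ?QB = "coded_layered.RB (T x + 3) (D x) (C x) (code_A w (T x + 3)) (code_B w (T x + 3))"
    have "?hyp ?\<sigma>2 ?QA ?QB" unfolding vec using holds_ranks[OF params] by blast
    with F(2) have "F ?\<sigma>2 = enc_instance (inst (vectors ?\<sigma>2) ?QA ?QB)" by blast
    then have "F ?\<sigma>2 = enc_instance (inst_of x)" unfolding vec .
    with q3[OF bound empty] have 3: "big_step ?main ?\<sigma>2 (enc_instance (inst_of x)) ?\<sigma>2 (poly q3 (B x))" by simp
    have "poly ?q ?n = poly q1 ?n + (poly q2 ?n + poly q3 (B x))"
      by (simp add: poly_pcompose B_def)
    then show ?thesis using big_step_Seq[OF 1 big_step_Seq[OF 2 3 order_refl] order_refl] by auto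
  qed
  moreover have "tests_ok ?prog"
    using c(2) ok ub by (simp add: word_prog_def For_def)
  ultimately show ?thesis by (rule polytime_computable_big_step)
qed

end

theorem theorem7: "NP_hard popular_neither_stable_nor_dominant"
  unfolding NP_hard_def
proof (intro allI impI)
  fix L assume "in_NP L"
  then obtain V and p :: "nat poly" where V: "polytime_computable V"
    and L: "\<And>x. x \<in> L \<longleftrightarrow> (\<exists>u. length u \<le> poly p (length x) \<and> V (pair_word x u) = [True])"
    unfolding in_NP_def by blast
  obtain M and pv :: "nat poly" where M: "wf_tm M" "\<And>x. computes_within M x (V x) (poly pv (length x))"
    using V unfolding polytime_computable_def by blast
  \<comment> \<open>An enumeration of the rows is fixed once for the verifier. It becomes part of
    the program and does not depend on the input.\<close>
  obtain rows where "set rows = valid_rows M" using finite_list[OF finite_valid_rows] by blast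
  then interpret reduction M rows p pv by unfold_locales (rule M(1))
  show "polytime_reducible L popular_neither_stable_nor_dominant"
    unfolding polytime_reducible_def
  proof (intro exI conjI allI)
    show "polytime_computable (\<lambda>x. enc_instance (inst_of x))" by (rule polytime_inst_of)
    show "x \<in> L \<longleftrightarrow> enc_instance (inst_of x) \<in> popular_neither_stable_nor_dominant" for x
      using inst_of_iff[where f = V and x = x, OF M(2)] L[of x] by simp
  qed
qed

end
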